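(* Let $(T,d)$ be a compact metric space, and let $\varphi$ and $\psi$ be Young functions with $\varphi(1)=\psi(1)=1$ such that for some $R\geq 1$ and some integer $n_0\geq 1$ $$\sum_{k=0}^{\infty}\frac{\psi(R^k)}{\varphi(R^{k+n_0})}<\infty .$$ Suppose $\rho$ is a metric on $T$ such that for each separable process $X(t)$, $t\in T$, which has $\psi$-bounded increments, i.e. satisfies $\sup_{s,t\in T}\mathbf{E}\,\psi\big(\frac{|X(s)-X(t)|}{d(s,t)}\big)\leq 1$, we have $$\mathbf{P}\Big(\sup_{s,t\in T}\frac{|X(s)-X(t)|}{\rho(s,t)}<\infty\Big)=1 .$$ Then there exist a constant $K$ and a Borel probability measure $m$ on $T$ (which depends on $(\varphi,\psi)$ only) such that $$\tau_{m,\varphi}(s,t)\leq K\rho(s,t)\quad\text{for all } s,t\in T .$$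
   Context: A (finite) Young function is an increasing convex function $\varphi:[0,\infty)\to[0,\infty)$ with $\varphi(0)=0$ and $\lim_{x\to\infty}\varphi(x)=\infty$; $\varphi^{-1}$ denotes its inverse function, with $\varphi^{-1}(\infty)=\infty$. For a Borel probability measure $m$ on $T$, with closed balls $B(x,\varepsilon)=\{y\in T:d(x,y)\leq\varepsilon\}$, the minorizing metric is $$\tau_{m,\varphi}(s,t):=\max\Big\{\int_0^{d(s,t)}\varphi^{-1}\Big(\frac{1}{m(B(s,\varepsilon))}\Big)d\varepsilon,\ \int_0^{d(s,t)}\varphi^{-1}\Big(\frac{1}{m(B(t,\varepsilon))}\Big)d\varepsilon\Big\},\quad s,t\in T.$$ Conventions: $0/0=0$ and $1/0=\infty$. Processes are real-valued, and "separable" is meant in the usual sense for stochastic processes.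
   Formalization: The measure m and constant K may depend on T, d and ρ as well as (φ,ψ), but not on the process, R or n_0; independence of ρ, as "depends on (φ,ψ) only" suggests, is false in general (scaling ρ for K, a countable ultrametric counterexample for m). T is assumed nonempty. *)

theory Defs
  imports "HOL-Probability.Probability"
begin

text \<open>
  Only the values on $[0,\infty)$ matter. \<open>Increasing\<close> is taken in the weak sense, so that
  a Young function may vanish on an initial segment; this includes the strictly increasing ones.
\<close>

definition young_function :: "(real \<Rightarrow> real) \<Rightarrow> bool" where
  "young_function \<phi> \<longleftrightarrow>
     mono_on {0..} \<phi> \<and> convex_on {0..} \<phi> \<and> \<phi> 0 = 0 \<and> filterlim \<phi> at_top at_top"

text \<open>
  The inverse of a Young function, extended by $\infty \mapsto \infty$. If the function vanishes on an
  initial segment, the inverse is not determined at $0$, but it is at every positive argument (see the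
  lemma below), and it is only ever applied to $1/m(B) \ge 1$.
\<close>

definition young_inv :: "(real \<Rightarrow> real) \<Rightarrow> ennreal \<Rightarrow> ennreal" where
  "young_inv \<phi> y =
     (if y = \<infinity> then \<infinity> else ennreal (the_inv_into {0..} \<phi> (enn2real y)))"

lemma young_function_ex1:
  assumes Y: "young_function \<phi>" and y: "0 < y"
  shows "\<exists>!x. x \<in> {0..} \<and> \<phi> x = y"
proof -
  have mono: "\<phi> a \<le> \<phi> b" if "0 \<le> a" "a \<le> b" for a b
    using Y that by (auto simp: young_function_def mono_on_def)
  have conv: "convex_on {0..} \<phi>" and zero: "\<phi> 0 = 0" and lim: "filterlim \<phi> at_top at_top"
    using Y by (auto simp: young_function_def)
  have scale: "\<phi> (u * b) \<le> u * \<phi> b" if "0 \<le> u" "u \<le> 1" "0 \<le> b" for u b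
    using convex_onD[OF conv, of u 0 b] that zero by simp
  have uniq: "a = b" if "0 \<le> a" "a \<le> b" "\<phi> a = y" "\<phi> b = y" for a b
  proof (rule ccontr)
    assume "a \<noteq> b"
    then have ab: "a < b" "0 < b" using that by auto
    have "\<phi> ((a / b) * b) \<le> (a / b) * \<phi> b"
      using scale[of "a / b" b] ab that by simp
    then have "y \<le> (a / b) * y" using ab that by simp
    moreover have "(a / b) * y < y" using ab y by (simp add: pos_divide_less_eq mult.commute)
    ultimately show False by simp
  qed
  obtain b where b: "0 < b" "y \<le> \<phi> b"
  proof -
    have "eventually (\<lambda>x. y \<le> \<phi> x \<and> 0 < x) at_top"
      using lim eventually_gt_at_top[of "0::real"]
      by (auto simp: filterlim_at_top intro: eventually_conj)
    then show ?thesis using that by (auto simp: eventually_at_top_linorder)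
  qed
  have cont0: "continuous_on {0<..} \<phi>"
    by (intro convex_on_continuous convex_on_subset[OF conv]) auto
  define c where "c = min b (b * y / (2 * \<phi> b))"
  have c: "0 < c" "c \<le> b" "\<phi> c \<le> y"
  proof -
    show "0 < c" "c \<le> b" using b y by (auto simp: c_def)
    have "\<phi> c \<le> \<phi> ((y / (2 * \<phi> b)) * b)"
      using b y \<open>0 < c\<close> by (intro mono) (auto simp: c_def mult.commute)
    also have "\<dots> \<le> (y / (2 * \<phi> b)) * \<phi> b"
      using b y by (intro scale) (auto simp: pos_divide_le_eq)
    also have "\<dots> \<le> y" using b y by simp
    finally show "\<phi> c \<le> y" .
  qed
  have "continuous_on {c..b} \<phi>"
    by (rule continuous_on_subset[OF cont0]) (use c in auto)
  then obtain x where "c \<le> x" "x \<le> b" "\<phi> x = y"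
    using IVT'[of \<phi> c y b] c b by auto
  then have x: "0 \<le> x" "\<phi> x = y" using c by auto
  show ?thesis
  proof (rule ex1I[of _ x])
    show "x \<in> {0..} \<and> \<phi> x = y" using x by simp
    show "z = x" if "z \<in> {0..} \<and> \<phi> z = y" for z
      using uniq[of x z] uniq[of z x] x that by (cases "x \<le> z") auto
  qed
qed

definition minorizing_metric ::
    "'a::metric_space set \<Rightarrow> 'a measure \<Rightarrow> (real \<Rightarrow> real) \<Rightarrow> 'a \<Rightarrow> 'a \<Rightarrow> ennreal" where
  "minorizing_metric T m \<phi> s t =
     max (\<integral>\<^sup>+\<epsilon>\<in>{0..dist s t}. young_inv \<phi> (1 / emeasure m (T \<inter> cball s \<epsilon>)) \<partial>lborel)
         (\<integral>\<^sup>+\<epsilon>\<in>{0..dist s t}. young_inv \<phi> (1 / emeasure m (T \<inter> cball t \<epsilon>)) \<partial>lborel)"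

definition stochastic_process :: "'a set \<Rightarrow> 'w measure \<Rightarrow> ('a \<Rightarrow> 'w \<Rightarrow> real) \<Rightarrow> bool" where
  "stochastic_process T M X \<longleftrightarrow> prob_space M \<and> (\<forall>t\<in>T. X t \<in> borel_measurable M)"

definition separable_process ::
    "'a::metric_space set \<Rightarrow> 'w measure \<Rightarrow> ('a \<Rightarrow> 'w \<Rightarrow> real) \<Rightarrow> bool" where
  "separable_process T M X \<longleftrightarrow> stochastic_process T M X \<and>
     (\<exists>D. countable D \<and> D \<subseteq> T \<and>
       (AE \<omega> in M. \<forall>t\<in>T. \<exists>u. (\<forall>n::nat. u n \<in> D) \<and> u \<longlonglongrightarrow> t \<and>
                                 (\<lambda>n. X (u n) \<omega>) \<longlonglongrightarrow> X t \<omega>))"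

definition bounded_increments ::
    "(real \<Rightarrow> real) \<Rightarrow> 'a::metric_space set \<Rightarrow> 'w measure \<Rightarrow> ('a \<Rightarrow> 'w \<Rightarrow> real) \<Rightarrow> bool" where
  "bounded_increments \<psi> T M X \<longleftrightarrow>
     (SUP (s, t)\<in>T \<times> T. \<integral>\<^sup>+\<omega>. ennreal (\<psi> (\<bar>X s \<omega> - X t \<omega>\<bar> / dist s t)) \<partial>M) \<le> 1"

text \<open>
  All separable processes with $\psi$-bounded increments are almost surely Lipschitz with respect to
  $\rho$. A formula cannot quantify over the type of the sample space, so the sample space is a set of
  functions on the index type, with an arbitrary $\sigma$-algebra and probability measure. There is no
  loss of generality: an arbitrary process may be replaced by the coordinate process on path space under
  the image of the (completed) probability measure, with the largest $\sigma$-algebra making the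
  path map measurable; increments, separability and the almost sure property are the same for both.
  Almost sure validity is used because the event need not be measurable: $\rho$ is not assumed to be
  continuous with respect to the given metric.
\<close>

definition increments_as_dominated ::
    "(real \<Rightarrow> real) \<Rightarrow> 'a::metric_space set \<Rightarrow> ('a \<Rightarrow> 'a \<Rightarrow> real) \<Rightarrow> bool" where
  "increments_as_dominated \<psi> T \<rho> \<longleftrightarrow>
     (\<forall>(M :: ('a \<Rightarrow> real) measure) X.
        separable_process T M X \<longrightarrow> bounded_increments \<psi> T M X \<longrightarrow>
        (AE \<omega> in M. (SUP (s, t)\<in>T \<times> T. ennreal (\<bar>X s \<omega> - X t \<omega>\<bar> / \<rho> s t)) < \<infinity>))"

end

theory Submission
  imports Defs
begin

text \<open>
  Call a set of pairs \<open>(s, t)\<close> feasible with constant \<open>K\<close> if one finitely additive probability \<open>\<nu>\<close> on \<open>T\<close>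
  satisfies \<open>\<integral>\<^sub>0\<^bsup>d(s,t)\<^esup> \<phi>\<inverse>(1 / \<nu>(B(s, \<epsilon>))) d\<epsilon> \<le> K \<rho>(s, t)\<close> on it. If all finite sets of pairs are
  feasible with the same \<open>K\<close>, then so is \<open>T \<times> T\<close>, by compactness of the set of these \<open>\<nu>\<close> in the product
  topology, and an outer regularisation of \<open>\<nu>\<close> is a Borel measure which is at least as large on closed balls.

  Otherwise, compactness of \<open>T\<close> provides a point \<open>s\<^sub>0\<close> such that the pairs with \<open>s\<close> close to \<open>s\<^sub>0\<close>, but
  different from it, are not uniformly feasible. If a finite set of pairs is not feasible with \<open>K\<close>, the
  multiplicative weights method gives a probability \<open>q\<close> on the set under which every \<open>\<nu>\<close> violates
  the inequality with \<open>K / 4\<close> with probability at least \<open>1 / 4\<close>. Draw \<open>(s, t)\<close> from \<open>q\<close>, let \<open>\<mu>\<close> be the law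
  of \<open>s\<close>, and apply this to \<open>\<nu> = (\<delta>\<^bsub>s\<^sub>0\<^esub> + \<mu>) / 2\<close>. The random function that sends \<open>u\<close> to the integral of
  \<open>\<phi>\<inverse>(1 / \<mu>(B(s, \<epsilon>)))\<close> over \<open>2 d(u, s) \<le> \<epsilon> \<le> min (d(s, t), d(s, s\<^sub>0))\<close> is then, up to a constant factor, a
  process with \<open>\<psi>\<close>-bounded increments supported near \<open>s\<^sub>0\<close> that has a large increment from \<open>t\<close> to \<open>s\<close>
  relative to \<open>\<rho>(s, t)\<close> with probability at least \<open>1 / 4\<close>. Superposing independent processes of this
  kind with supports shrinking to \<open>s\<^sub>0\<close> (a gliding hump) contradicts the hypothesis.
\<close>

section \<open>The function \<open>x \<mapsto> \<phi>\<inverse>(1 / x)\<close>\<close>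

text \<open>Masses are real while values are extended, so the values of a charge can be inserted
  directly and a null ball contributes infinity.\<close>

definition young_rec :: "(real \<Rightarrow> real) \<Rightarrow> real \<Rightarrow> ennreal" where
  "young_rec \<phi> x = young_inv \<phi> (1 / ennreal x)"

lemma young_nonneg: "young_function \<phi> \<Longrightarrow> 0 \<le> a \<Longrightarrow> 0 \<le> \<phi> a"
  unfolding young_function_def mono_on_def by (metis atLeast_iff order_refl)

lemma young_mono: "young_function \<phi> \<Longrightarrow> 0 \<le> a \<Longrightarrow> a \<le> b \<Longrightarrow> \<phi> a \<le> \<phi> b"
  unfolding young_function_def mono_on_def by auto

lemma young_scale:
  assumes "young_function \<phi>" "0 \<le> u" "u \<le> 1" "0 \<le> b"
  shows "\<phi> (u * b) \<le> u * \<phi> b"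
  using assms convex_onD[of "{0..}" \<phi> u 0 b] by (simp add: young_function_def)

lemma young_rec_0: "young_rec \<phi> 0 = \<infinity>"
  by (simp add: young_rec_def young_inv_def)

lemma young_rec_eq:
  assumes Y: "young_function \<phi>" and x: "0 < x"
  shows "\<exists>z\<ge>0. young_rec \<phi> x = ennreal z \<and> \<phi> z = 1 / x"
proof -
  define z where "z = the_inv_into {0..} \<phi> (1 / x)"
  have "\<exists>!z. z \<in> {0..} \<and> \<phi> z = 1 / x"
    using young_function_ex1[OF Y] x by simp
  then have z: "z \<in> {0..} \<and> \<phi> z = 1 / x"
    unfolding z_def the_inv_into_def by (rule theI')
  have "1 / ennreal x = ennreal (1 / x)"
    using x by (metis divide_ennreal ennreal_1 zero_le_one)
  then have "young_rec \<phi> x = ennreal z"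
    using x by (simp add: young_rec_def young_inv_def z_def)
  then show ?thesis using z by auto
qed

text \<open>Uniqueness of the preimage of \<open>1 / x\<close> makes the comparison strict in both
  directions, and \<open>x = 0\<close> is covered because the value is then infinite. Most estimates
  of \<open>young_rec\<close> go through this criterion instead of the inverse function.\<close>

lemma less_young_rec_iff:
  assumes Y: "young_function \<phi>" and a: "0 \<le> a" and x: "0 \<le> x"
  shows "ennreal a < young_rec \<phi> x \<longleftrightarrow> \<phi> a * x < 1"
proof (cases "x = 0")
  case True
  then show ?thesis by (simp add: young_rec_0)
next
  case False
  with x have x: "x > 0" by simp
  obtain z where z: "0 \<le> z" "young_rec \<phi> x = ennreal z" "\<phi> z = 1 / x"
    using young_rec_eq[OF Y x] by blast
  have ex1: "\<exists>!z. z \<in> {0..} \<and> \<phi> z = 1 / x"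
    using young_function_ex1[OF Y] x by simp
  have "a < z \<longleftrightarrow> \<phi> a < 1 / x"
  proof
    assume "a < z"
    then have "\<phi> a \<le> \<phi> z" "a \<noteq> z" using young_mono[OF Y a] by auto
    moreover have "\<phi> a \<noteq> 1 / x" using ex1 z a \<open>a \<noteq> z\<close> by auto
    ultimately show "\<phi> a < 1 / x" using z by auto
  next
    assume "\<phi> a < 1 / x"
    then show "a < z" using young_mono[OF Y, of z a] z by force
  qed
  then show ?thesis using a x by (simp add: z(2) ennreal_less_iff pos_less_divide_eq)
qed

text \<open>By density of the order, an upper bound need only be tested on the reals strictly below
  the value, which \<open>less_young_rec_iff\<close> describes.\<close>

lemma young_rec_leI:
  assumes Y: "young_function \<phi>" and x: "0 \<le> x"
    and le: "\<And>a. 0 \<le> a \<Longrightarrow> \<phi> a * x < 1 \<Longrightarrow> ennreal a \<le> c"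
  shows "young_rec \<phi> x \<le> c"
proof (rule ccontr)
  assume "\<not> young_rec \<phi> x \<le> c"
  then have "c < young_rec \<phi> x" by simp
  then obtain b where b: "c < b" "b < young_rec \<phi> x" using dense by blast
  then obtain a where a: "0 \<le> a" "b = ennreal a" by (cases b) auto
  with b less_young_rec_iff[OF Y a(1) x] have "\<phi> a * x < 1" by simp
  with le[OF a(1)] b a show False by auto
qed

lemma young_rec_antimono:
  assumes Y: "young_function \<phi>" and "0 \<le> x" "x \<le> y"
  shows "young_rec \<phi> y \<le> young_rec \<phi> x"
proof (rule young_rec_leI[OF Y])
  fix a :: real assume a: "0 \<le> a" "\<phi> a * y < 1"
  have "\<phi> a * x \<le> \<phi> a * y" using young_nonneg[OF Y a(1)] assms by (intro mult_left_mono) auto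
  then show "ennreal a \<le> young_rec \<phi> x"
    using less_young_rec_iff[OF Y a(1), of x] assms a by auto
qed (use assms in auto)

text \<open>Convexity and \<open>\<phi> 0 = 0\<close> give
  \<open>\<phi> (a / c) \<le> \<phi> a / c\<close>. A charge that dominates the fraction
  \<open>1 / c\<close> of another one therefore costs at most a factor \<open>c\<close>, which makes
  mixtures of charges affordable.\<close>

lemma young_rec_scale:
  assumes Y: "young_function \<phi>" and "0 \<le> x" "1 \<le> c"
  shows "young_rec \<phi> x \<le> ennreal c * young_rec \<phi> (c * x)"
proof (rule young_rec_leI[OF Y])
  fix a :: real assume a: "0 \<le> a" "\<phi> a * x < 1"
  have "\<phi> ((1 / c) * a) \<le> (1 / c) * \<phi> a"
    using assms a by (intro young_scale) auto
  then have "\<phi> (a / c) * (c * x) \<le> (1 / c * \<phi> a) * (c * x)"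
    using assms by (intro mult_right_mono) auto
  also have "\<dots> = \<phi> a * x" using assms by simp
  finally have "ennreal (a / c) < young_rec \<phi> (c * x)"
    using less_young_rec_iff[OF Y, of "a / c" "c * x"] assms a by auto
  then have "ennreal c * ennreal (a / c) \<le> ennreal c * young_rec \<phi> (c * x)"
    by (intro mult_left_mono) auto
  then show "ennreal a \<le> ennreal c * young_rec \<phi> (c * x)"
    using assms a by (simp flip: ennreal_mult)
qed (use assms in auto)

lemma young_le_self:
  assumes "young_function \<phi>" "\<phi> 1 = 1" "0 \<le> a" "a \<le> 1"
  shows "\<phi> a \<le> a"
  using young_scale[of \<phi> a 1] assms by simp

text \<open>Convexity and \<open>\<phi> 1 = 1\<close> give \<open>\<phi> a \<le> a\<close> on the
  unit interval. As a consequence, a ball integral is at least the length of its interval.\<close>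

lemma young_rec_ge_1:
  assumes Y: "young_function \<phi>" "\<phi> 1 = 1" and x: "0 \<le> x" "x \<le> 1"
  shows "1 \<le> young_rec \<phi> x"
proof (rule ccontr)
  assume "\<not> 1 \<le> young_rec \<phi> x"
  then obtain a where a: "0 \<le> a" "young_rec \<phi> x = ennreal a" "a < 1"
    by (cases "young_rec \<phi> x") (auto simp: not_le)
  then have "\<phi> a * x \<ge> 1" using less_young_rec_iff[OF Y(1) a(1) x(1)] by auto
  moreover have "\<phi> a * x \<le> a * 1"
    using young_le_self[OF Y a(1)] a young_nonneg[OF Y(1) a(1)] x by (intro mult_mono) auto
  ultimately show False using a by simp
qed

lemma young_rec_1:
  assumes Y: "young_function \<phi>" "\<phi> 1 = 1"
  shows "young_rec \<phi> 1 = 1"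
proof (rule antisym)
  show "young_rec \<phi> 1 \<le> 1"
  proof (rule young_rec_leI[OF Y(1)])
    fix a :: real assume "0 \<le> a" "\<phi> a * 1 < 1"
    then have "a < 1" using young_mono[OF Y(1), of 1 a] Y by force
    then show "ennreal a \<le> 1" by (simp add: ennreal_le_1)
  qed simp
qed (use young_rec_ge_1[OF Y] in simp)

lemma young_rec_finite:
  assumes Y: "young_function \<phi>" and x: "0 < x"
  shows "young_rec \<phi> x < \<infinity>"
  using young_rec_eq[OF Y x] by auto

section \<open>Finitely additive probabilities and averaging\<close>

text \<open>Superlevel sets are downward closed, so minus the indicator of such a set is a monotone
  real function.\<close>

lemma antimono_borel_measurable:
  fixes f :: "real \<Rightarrow> ennreal"
  assumes "antimono f"
  shows "f \<in> borel_measurable borel"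
proof (rule borel_measurableI_greater)
  fix y
  define A where "A = {x. y < f x}"
  have down: "a \<in> A" if "b \<in> A" "a \<le> b" for a b
    using assms that by (force simp: A_def monotone_def intro: less_le_trans)
  have "mono (\<lambda>x. - (indicator A x :: real))"
    using down by (auto simp: mono_def indicator_def)
  then have [measurable]: "(\<lambda>x. - (indicator A x :: real)) \<in> borel_measurable borel"
    by (rule borel_measurable_mono)
  have "{x \<in> space borel. - (indicator A x :: real) \<le> - 1} \<in> sets borel" by measurable
  also have "{x \<in> space borel. - (indicator A x :: real) \<le> - 1} = A"
    by (auto simp: indicator_def split: if_splits)
  finally show "{x \<in> space borel. y < f x} \<in> sets borel" by (simp add: A_def)
qed

text \<open>
  Finite additivity on all subsets is used instead of \<open>\<sigma>\<close>-additivity because it survives pointwise limits.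
\<close>

definition prob_charge :: "'a set \<Rightarrow> ('a set \<Rightarrow> real) \<Rightarrow> bool" where
  "prob_charge T \<nu> \<longleftrightarrow> (\<forall>A. 0 \<le> \<nu> A) \<and> (\<forall>A B. A \<inter> B = {} \<longrightarrow> \<nu> (A \<union> B) = \<nu> A + \<nu> B) \<and>
     \<nu> T = 1 \<and> \<nu> UNIV = 1"

lemma prob_charge_nonneg: "prob_charge T \<nu> \<Longrightarrow> 0 \<le> \<nu> A"
  by (simp add: prob_charge_def)

lemma prob_charge_Un_disjoint: "prob_charge T \<nu> \<Longrightarrow> A \<inter> B = {} \<Longrightarrow> \<nu> (A \<union> B) = \<nu> A + \<nu> B"
  by (simp add: prob_charge_def)

lemma prob_charge_mono:
  assumes "prob_charge T \<nu>" "A \<subseteq> B"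
  shows "\<nu> A \<le> \<nu> B"
proof -
  have "\<nu> (A \<union> (B - A)) = \<nu> A + \<nu> (B - A)" "0 \<le> \<nu> (B - A)"
    using assms(1) unfolding prob_charge_def by blast+
  moreover have "A \<union> (B - A) = B" using assms(2) by auto
  ultimately show ?thesis by simp
qed

lemma prob_charge_le_1: "prob_charge T \<nu> \<Longrightarrow> \<nu> A \<le> 1"
  using prob_charge_mono[of T \<nu> A UNIV] by (simp add: prob_charge_def)

text \<open>The value 1 on both \<open>T\<close> and \<open>UNIV\<close> makes the complement of
  \<open>T\<close> null, so balls of the ambient type can be used without intersecting them with
  \<open>T\<close>.\<close>

lemma prob_charge_Int_support:
  assumes "prob_charge T \<nu>"
  shows "\<nu> (T \<inter> A) = \<nu> A"
proof -
  have "\<nu> (T \<union> - T) = \<nu> T + \<nu> (- T)" "\<nu> (T \<inter> A \<union> (A - T)) = \<nu> (T \<inter> A) + \<nu> (A - T)"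
    by (rule prob_charge_Un_disjoint[OF assms], blast)+
  moreover have "\<nu> T = 1" "\<nu> (T \<union> - T) = 1" using assms by (auto simp: prob_charge_def)
  moreover have "\<nu> (A - T) \<le> \<nu> (- T)" "0 \<le> \<nu> (A - T)"
    using prob_charge_mono[OF assms, of "A - T" "- T"] prob_charge_nonneg[OF assms] by auto
  moreover have "T \<inter> A \<union> (A - T) = A" by auto
  ultimately show ?thesis by auto
qed

lemma prob_charge_Un_le:
  assumes "prob_charge T \<nu>"
  shows "\<nu> (A \<union> B) \<le> \<nu> A + \<nu> B"
proof -
  have "\<nu> (A \<union> (B - A)) = \<nu> A + \<nu> (B - A)" by (rule prob_charge_Un_disjoint[OF assms]) blast
  moreover have "\<nu> (B - A) \<le> \<nu> B" by (intro prob_charge_mono[OF assms]) auto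
  moreover have "A \<union> (B - A) = A \<union> B" by auto
  ultimately show ?thesis by simp
qed

lemma prob_charge_empty: "prob_charge T \<nu> \<Longrightarrow> \<nu> {} = 0"
  using prob_charge_Un_disjoint[of T \<nu> "{}" "{}"] by simp

lemma prob_charge_UN_le:
  assumes "prob_charge T \<nu>" "finite I"
  shows "\<nu> (\<Union>i\<in>I. A i) \<le> (\<Sum>i\<in>I. \<nu> (A i))"
  using assms(2)
proof (induction I rule: finite_induct)
  case (insert i I)
  then show ?case using prob_charge_Un_le[OF assms(1), of "A i" "\<Union>i\<in>I. A i"] by simp
qed (simp add: prob_charge_empty[OF assms(1)])

lemma prob_charge_mean:
  assumes "finite J" "J \<noteq> {}" "\<And>j. j \<in> J \<Longrightarrow> prob_charge T (\<nu> j)"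
  shows "prob_charge T (\<lambda>A. (\<Sum>j\<in>J. \<nu> j A) / card J)"
  using assms unfolding prob_charge_def
  by (auto simp: sum_nonneg sum.distrib simp flip: add_divide_distrib)

lemma prob_charge_midpoint:
  assumes "prob_charge T \<mu>" "prob_charge T \<nu>"
  shows "prob_charge T (\<lambda>A. (\<mu> A + \<nu> A) / 2)"
  using assms unfolding prob_charge_def by (auto simp: field_simps)

lemma prob_charge_pmf:
  assumes "\<And>\<omega>. \<omega> \<in> set_pmf q \<Longrightarrow> g \<omega> \<in> T"
  shows "prob_charge T (\<lambda>A. measure_pmf.prob q (g -` A))"
proof -
  have "measure_pmf.prob q (g -` T) = 1"
    using assms by (subst measure_pmf.prob_eq_1) (auto intro!: AE_pmfI)
  then show ?thesis
    unfolding prob_charge_def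
    by (auto simp: measure_pmf.finite_measure_Union[symmetric] vimage_Un disjoint_iff)
qed

lemma prob_charge_dirac: "a \<in> T \<Longrightarrow> prob_charge T (\<lambda>A. indicator A a)"
  unfolding prob_charge_def by (auto simp: indicator_def)

text \<open>One of the two integrals in \<open>minorizing_metric\<close>, for a charge. Bounding it
  on all ordered pairs controls both.\<close>

definition ball_integral ::
    "(real \<Rightarrow> real) \<Rightarrow> ('a::metric_space set \<Rightarrow> real) \<Rightarrow> 'a \<Rightarrow> real \<Rightarrow> ennreal" where
  "ball_integral \<phi> \<nu> s d = (\<integral>\<^sup>+\<epsilon>\<in>{0..d}. young_rec \<phi> (\<nu> (cball s \<epsilon>)) \<partial>lborel)"

lemma young_rec_charge_antimono:
  assumes "young_function \<phi>" "prob_charge T \<nu>"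
  shows "antimono (\<lambda>\<epsilon>. young_rec \<phi> (\<nu> (cball s \<epsilon>)))"
  using assms by (intro antimonoI young_rec_antimono prob_charge_nonneg prob_charge_mono) auto

lemma young_rec_charge_measurable [measurable]:
  assumes "young_function \<phi>" "prob_charge T \<nu>"
  shows "(\<lambda>\<epsilon>. young_rec \<phi> (\<nu> (cball s \<epsilon>))) \<in> borel_measurable borel"
  by (intro antimono_borel_measurable young_rec_charge_antimono[where T = T] assms)

text \<open>
  For a single \<open>x\<^sub>i\<close> one has \<open>f x\<^sub>i \<ge> f a * (1 - x\<^sub>i / (4 a))\<close> with \<open>f = young_rec \<phi>\<close> and \<open>a\<close> the mean,
  since \<open>1 / z \<ge> 1 - z / 4\<close>; these bounds are summed over \<open>I\<close>.
\<close>

lemma young_rec_mean_le: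
  fixes x :: "'i \<Rightarrow> real"
  assumes Y: "young_function \<phi>" and J: "finite J" "J \<noteq> {}" "I \<subseteq> J" "card J \<le> 2 * card I"
    and x: "\<And>j. j \<in> J \<Longrightarrow> 0 \<le> x j"
  shows "young_rec \<phi> ((\<Sum>j\<in>J. x j) / card J) \<le> ennreal (4 / card J) * (\<Sum>i\<in>I. young_rec \<phi> (x i))"
proof -
  define n where "n = real (card J)"
  define a where "a = (\<Sum>j\<in>J. x j) / n"
  have fI: "finite I" using J finite_subset by auto
  have n: "n > 0" "n \<le> 2 * real (card I)" using J by (auto simp: n_def card_gt_0_iff)
  have "I \<noteq> {}" using n by auto
  have a0: "a \<ge> 0" using x n by (auto simp: a_def sum_nonneg)
  show ?thesis
  proof (cases "\<exists>i\<in>I. x i = 0")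
    case True
    then obtain i where "i \<in> I" "x i = 0" by auto
    then have "young_rec \<phi> (x i) = \<infinity>" by (simp add: young_rec_0)
    then have "(\<Sum>i\<in>I. young_rec \<phi> (x i)) = \<infinity>"
      using member_le_sum[of i I "\<lambda>i. young_rec \<phi> (x i)"] \<open>i \<in> I\<close> fI by (simp add: top_unique)
    then show ?thesis using n by (simp add: n_def ennreal_mult_top)
  next
    case False
    then have xpos: "0 < x i" if "i \<in> I" for i using x J(3) that by (metis less_eq_real_def subsetD)
    obtain i0 where "i0 \<in> I" using \<open>I \<noteq> {}\<close> by auto
    then have "0 < (\<Sum>j\<in>J. x j)" using J x xpos[of i0] by (intro sum_pos2[of J i0]) auto
    then have a: "a > 0" using n by (simp add: a_def)
    define g where "g i = enn2real (young_rec \<phi> (x i))" for i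
    define f where "f = enn2real (young_rec \<phi> a)"
    have f: "young_rec \<phi> a = ennreal f" "f \<ge> 0"
      using young_rec_finite[OF Y a] by (auto simp: f_def ennreal_enn2real_if)
    have g: "young_rec \<phi> (x i) = ennreal (g i)" "g i \<ge> 0" if "i \<in> I" for i
      using young_rec_finite[OF Y xpos[OF that]] by (auto simp: g_def ennreal_enn2real_if)
    have le: "f * (1 - x i / (4 * a)) \<le> g i" if i: "i \<in> I" for i
    proof (cases "x i \<le> a")
      case True
      have "f \<le> g i"
        using young_rec_antimono[OF Y _ True] xpos[OF i] f g[OF i] by simp
      moreover have "f * (1 - x i / (4 * a)) \<le> f * 1"
        using f xpos[OF i] a by (intro mult_left_mono) auto
      ultimately show ?thesis by simp
    next
      case False
      define c where "c = x i / a"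
      have c: "c > 1" "c * a = x i" using False a by (auto simp: c_def)
      have "young_rec \<phi> a \<le> ennreal c * young_rec \<phi> (c * a)"
        using young_rec_scale[OF Y, of a c] a c by simp
      then have fc: "f \<le> c * g i"
        using f g[OF i] c by (simp flip: ennreal_mult)
      \<comment> \<open>This is \<open>1 / z \<ge> 1 - z / 4\<close> at \<open>z = c\<close>,
        multiplied by \<open>c\<close>; it expands the square of \<open>c / 2 - 1\<close>.\<close>
      have "c * (1 - c / 4) \<le> 1" using zero_le_power2[of "c / 2 - 1"]
        by (simp add: power2_eq_square algebra_simps)
      then have "f * (c * (1 - c / 4)) \<le> f * 1" using f by (intro mult_left_mono) auto
      then have "c * (f * (1 - c / 4)) \<le> c * g i" using fc by (simp add: algebra_simps)
      then have "f * (1 - c / 4) \<le> g i" using c by simp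
      then show ?thesis by (simp add: c_def mult.commute)
    qed
    have sumI: "(\<Sum>i\<in>I. x i) \<le> n * a"
      using J x n by (auto simp: a_def intro: sum_mono2)
    \<comment> \<open>\<open>I\<close> has at least \<open>n / 2\<close> elements, and the values on
      \<open>I\<close> sum to at most \<open>n * a\<close>, so the linear bounds lose at most
      \<open>n / 4\<close>. What remains is \<open>n / 4\<close>, whence the factor
      \<open>4 / n\<close>.\<close>
    have "f * (n / 4) \<le> f * (card I - n / 4)" using n f by (intro mult_left_mono) auto
    also have "\<dots> \<le> f * (card I - (\<Sum>i\<in>I. x i) / (4 * a))"
      using f a sumI by (intro mult_left_mono) (auto simp: field_simps)
    also have "\<dots> = (\<Sum>i\<in>I. f * (1 - x i / (4 * a)))"
      by (simp add: sum_subtractf sum_divide_distrib flip: sum_distrib_left)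
    also have "\<dots> \<le> (\<Sum>i\<in>I. g i)" by (intro sum_mono le)
    finally have "f \<le> 4 / n * (\<Sum>i\<in>I. g i)" using n by (simp add: field_simps)
    moreover have "(\<Sum>i\<in>I. young_rec \<phi> (x i)) = ennreal (\<Sum>i\<in>I. g i)"
      using g by (simp add: sum_ennreal)
    ultimately show ?thesis
      using f n by (simp add: a_def[symmetric] n_def[symmetric] sum_nonneg g flip: ennreal_mult)
  qed
qed

text \<open>The pointwise bound is integrated. Any half of the charges controls their mean up to a
  constant, however bad the other half is.\<close>

lemma ball_integral_mean_le:
  assumes Y: "young_function \<phi>" and J: "finite J" "J \<noteq> {}" "I \<subseteq> J" "card J \<le> 2 * card I"
    and nu: "\<And>j. j \<in> J \<Longrightarrow> prob_charge T (\<nu> j)"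
  shows "ball_integral \<phi> (\<lambda>A. (\<Sum>j\<in>J. \<nu> j A) / card J) s d
           \<le> ennreal (4 / card J) * (\<Sum>i\<in>I. ball_integral \<phi> (\<nu> i) s d)"
proof -
  have [measurable]: "(\<lambda>\<epsilon>. young_rec \<phi> (\<nu> i (cball s \<epsilon>))) \<in> borel_measurable borel" if "i \<in> I" for i
    using young_rec_charge_measurable[OF Y nu[of i]] that J by auto
  have "ball_integral \<phi> (\<lambda>A. (\<Sum>j\<in>J. \<nu> j A) / card J) s d
      \<le> (\<integral>\<^sup>+\<epsilon>. ennreal (4 / card J) *
            (\<Sum>i\<in>I. young_rec \<phi> (\<nu> i (cball s \<epsilon>)) * indicator {0..d} \<epsilon>) \<partial>lborel)"
    unfolding ball_integral_def sum_distrib_right[symmetric] mult.assoc[symmetric]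
    using prob_charge_nonneg[OF nu]
    by (intro nn_integral_mono mult_right_mono young_rec_mean_le[OF Y J]) auto
  also have "\<dots> = ennreal (4 / card J) * (\<Sum>i\<in>I. ball_integral \<phi> (\<nu> i) s d)"
    unfolding ball_integral_def by (subst nn_integral_cmult; (subst nn_integral_sum)?) auto
  finally show ?thesis .
qed

section \<open>Multiplicative weights and hard distributions on pairs\<close>

text \<open>
  The weight of \<open>p\<close> is divided by \<open>4\<close> whenever \<open>p\<close> is satisfied. The total weight then shrinks by a factor
  \<open>7 / 16 < 1 / 2\<close> in each round, while it would stay above \<open>(1 / 2)\<^sup>n\<close> after \<open>n\<close> rounds if some \<open>p\<close>
  were satisfied less than half of the time.
\<close>

lemma multiplicative_weights:
  fixes Sat :: "'n \<Rightarrow> 'p \<Rightarrow> bool"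
  assumes F: "finite F" "F \<noteq> {}"
    and ex: "\<And>q. set_pmf q \<subseteq> F \<Longrightarrow> \<exists>\<nu>. P \<nu> \<and> measure_pmf.prob q {p. Sat \<nu> p} \<ge> 3 / 4"
  shows "\<exists>n \<nu>. n > 0 \<and> (\<forall>i<n. P (\<nu> i)) \<and> (\<forall>p\<in>F. n \<le> 2 * card {i. i < n \<and> Sat (\<nu> i) p})"
proof -
  \<comment> \<open>Normalising positive weights to a pmf turns the hypothesis into a statement
    about weighted sums.\<close>
  have "\<exists>\<nu>. P \<nu> \<and> (\<Sum>p\<in>{p\<in>F. Sat \<nu> p}. w p) \<ge> 3 / 4 * (\<Sum>p\<in>F. w p)"
    if w: "\<And>p. p \<in> F \<Longrightarrow> w p > (0::real)" for w
  proof -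
    define W where "W = (\<Sum>p\<in>F. w p)"
    have W: "W > 0" unfolding W_def using F w by (intro sum_pos) auto
    define d where "d p = (if p \<in> F then w p / W else 0)" for p
    have d0: "d p \<ge> 0" for p using w[of p] W by (auto simp: d_def)
    have "(\<integral>\<^sup>+p. ennreal (d p) \<partial>count_space UNIV) = (\<integral>\<^sup>+p. ennreal (d p) \<partial>count_space F)"
      by (intro nn_integral_count_space_eq) (auto simp: d_def)
    also have "\<dots> = ennreal (\<Sum>p\<in>F. d p)"
      using F d0 by (simp add: nn_integral_count_space_finite sum_ennreal)
    also have "(\<Sum>p\<in>F. d p) = 1"
      using W by (simp add: d_def W_def flip: sum_divide_distrib)
    finally have d1: "(\<integral>\<^sup>+p. ennreal (d p) \<partial>count_space UNIV) = 1" by simp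
    define q where "q = embed_pmf d"
    have q: "pmf q p = d p" for p unfolding q_def by (rule pmf_embed_pmf[OF d0 d1])
    have "set_pmf q \<subseteq> F" by (auto simp: set_pmf_eq q d_def split: if_splits)
    with ex[of q] obtain \<nu> where nu: "P \<nu>" "measure_pmf.prob q {p. Sat \<nu> p} \<ge> 3 / 4" by auto
    have "measure_pmf.prob q {p. Sat \<nu> p} = measure_pmf.prob q {p\<in>F. Sat \<nu> p}"
      using \<open>set_pmf q \<subseteq> F\<close> by (intro measure_pmf.finite_measure_eq_AE AE_pmfI) auto
    also have "\<dots> = (\<Sum>p\<in>{p\<in>F. Sat \<nu> p}. w p) / W"
      using F by (auto simp: measure_measure_pmf_finite q d_def sum_divide_distrib)
    finally show ?thesis using nu W by (auto simp: W_def field_simps)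
  qed
  then obtain N where N: "P (N w)" "(\<Sum>p\<in>{p\<in>F. Sat (N w) p}. w p) \<ge> 3 / 4 * (\<Sum>p\<in>F. w p)"
    if "\<And>p. p \<in> F \<Longrightarrow> w p > (0::real)" for w by metis
  define w where "w = rec_nat (\<lambda>_. 1::real) (\<lambda>_ w p. w p * (if Sat (N w) p then 1 / 4 else 1))"
  define \<nu> where "\<nu> k = N (w k)" for k
  have w_Suc: "w (Suc k) p = w k p * (if Sat (\<nu> k) p then 1 / 4 else 1)" for k p
    by (simp add: w_def \<nu>_def)
  have w_eq: "w k p = (1 / 4) ^ card {i. i < k \<and> Sat (\<nu> i) p}" for k p
  proof (induction k)
    case (Suc k)
    have "{i. i < Suc k \<and> Sat (\<nu> i) p} =
        (if Sat (\<nu> k) p then insert k {i. i < k \<and> Sat (\<nu> i) p} else {i. i < k \<and> Sat (\<nu> i) p})"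
      by (auto simp: less_Suc_eq)
    then show ?case by (auto simp: w_Suc Suc)
  qed (simp add: w_def)
  have wpos: "w k p > 0" for k p by (simp add: w_eq)
  have total: "(\<Sum>p\<in>F. w k p) \<le> card F * (7 / 16) ^ k" for k
  proof (induction k)
    case (Suc k)
    have "(\<Sum>p\<in>F. w (Suc k) p) = (\<Sum>p\<in>F. w k p - (if Sat (\<nu> k) p then 3 / 4 * w k p else 0))"
      by (intro sum.cong) (auto simp: w_Suc)
    also have "\<dots> = (\<Sum>p\<in>F. w k p) - 3 / 4 * (\<Sum>p\<in>{p\<in>F. Sat (\<nu> k) p}. w k p)"
      using F by (simp only: sum_subtractf sum.inter_filter sum_distrib_left) (auto intro!: sum.cong split: if_splits)
    \<comment> \<open>A share of at least \<open>3 / 4\<close> of the weight loses three quarters of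
      itself, and \<open>1 - 3 / 4 * (3 / 4) = 7 / 16\<close>.\<close>
    also have "\<dots> \<le> 7 / 16 * (\<Sum>p\<in>F. w k p)"
      using N(2)[of "w k"] wpos unfolding \<nu>_def by simp
    also have "\<dots> \<le> card F * (7 / 16) ^ Suc k" using Suc by simp
    finally show ?case .
  qed (simp add: w_def)
  \<comment> \<open>As \<open>7 / 16 = 7 / 8 * (1 / 2)\<close>, the total weight drops below
    \<open>(1 / 2) ^ n\<close> as soon as \<open>(7 / 8) ^ n\<close> beats the initial weight
    \<open>card F\<close>.\<close>
  have "(\<lambda>n. real (card F) * (7 / 8) ^ n) \<longlonglongrightarrow> real (card F) * 0"
    by (intro tendsto_mult tendsto_const LIMSEQ_power_zero) auto
  then have "eventually (\<lambda>n. real (card F) * (7 / 8) ^ n < 1) sequentially"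
    by (auto dest: order_tendstoD(2)[where a = 1])
  then obtain m where m: "\<And>n. n \<ge> m \<Longrightarrow> real (card F) * (7 / 8) ^ n < 1"
    by (auto simp: eventually_sequentially)
  define n where "n = Suc m"
  have n: "real (card F) * (7 / 8) ^ n < 1" unfolding n_def by (rule m) simp
  have "n \<le> 2 * card {i. i < n \<and> Sat (\<nu> i) p}" if p: "p \<in> F" for p
  proof (rule ccontr)
    define c where "c = card {i. i < n \<and> Sat (\<nu> i) p}"
    assume "\<not> n \<le> 2 * card {i. i < n \<and> Sat (\<nu> i) p}"
    then have "2 * c \<le> n" by (simp add: c_def)
    then have "(1 / 2 :: real) ^ n \<le> (1 / 2) ^ (2 * c)" by (intro power_decreasing) auto
    also have "\<dots> = w n p" by (simp add: w_eq c_def power_mult power2_eq_square)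
    also have "\<dots> \<le> (\<Sum>p\<in>F. w n p)" using F p wpos by (intro member_le_sum) (auto simp: less_imp_le)
    also have "\<dots> \<le> card F * (7 / 16) ^ n" by (rule total)
    also have "(7 / 16 :: real) ^ n = (7 / 8) ^ n * (1 / 2) ^ n" by (simp flip: power_mult_distrib)
    finally show False using n by simp
  qed
  moreover have "P (\<nu> i)" for i unfolding \<nu>_def using N(1) wpos by blast
  ultimately show ?thesis by (intro exI[of _ n] exI[of _ \<nu>]) (auto simp: n_def)
qed

text \<open>A minimax argument by contradiction. If every distribution on \<open>F\<close> had a
  charge meeting the constraints for \<open>K / 4\<close> with probability \<open>3 / 4\<close>,
  multiplicative weights would give finitely many charges such that each pair is satisfied by at
  least half of them. By \<open>ball_integral_mean_le\<close> their mean would be feasible with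
  \<open>K\<close>, the factor \<open>4\<close> being absorbed.\<close>

lemma infeasible_imp_hard_distribution:
  fixes T :: "'a::metric_space set"
  assumes Y: "young_function \<phi>" and T: "T \<noteq> {}" and F: "finite F" and K: "0 \<le> K"
    and rho: "\<And>s t. 0 \<le> \<rho> s t"
    and infeas: "\<not> (\<exists>\<nu>. prob_charge T \<nu> \<and>
        (\<forall>(s, t)\<in>F. ball_integral \<phi> \<nu> s (dist s t) \<le> ennreal (K * \<rho> s t)))"
  shows "\<exists>q. set_pmf q \<subseteq> F \<and> (\<forall>\<nu>. prob_charge T \<nu> \<longrightarrow>
      measure_pmf.prob q {(s, t). ball_integral \<phi> \<nu> s (dist s t) \<le> ennreal (K / 4 * \<rho> s t)} < 3 / 4)"
proof (rule ccontr)
  assume "\<not> ?thesis"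
  then have ex: "\<exists>\<nu>. prob_charge T \<nu> \<and> measure_pmf.prob q
      {p. ball_integral \<phi> \<nu> (fst p) (dist (fst p) (snd p)) \<le> ennreal (K / 4 * \<rho> (fst p) (snd p))} \<ge> 3 / 4"
    if "set_pmf q \<subseteq> F" for q
    using that by (auto simp: not_less case_prod_unfold)
  obtain a where "a \<in> T" using T by auto
  then have "F \<noteq> {}" using infeas prob_charge_dirac[of a T] by auto
  from multiplicative_weights[OF F this ex]
  obtain n \<nu> where n: "n > 0" "\<And>i. i < n \<Longrightarrow> prob_charge T (\<nu> i)"
    and maj: "\<And>p. p \<in> F \<Longrightarrow> n \<le> 2 * card {i. i < n \<and>
        ball_integral \<phi> (\<nu> i) (fst p) (dist (fst p) (snd p)) \<le> ennreal (K / 4 * \<rho> (fst p) (snd p))}"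
    by auto
  define \<mu> where "\<mu> A = (\<Sum>j<n. \<nu> j A) / card {..<n}" for A
  have "prob_charge T \<mu>" unfolding \<mu>_def using n by (intro prob_charge_mean) auto
  moreover have "ball_integral \<phi> \<mu> s (dist s t) \<le> ennreal (K * \<rho> s t)" if "(s, t) \<in> F" for s t
  proof -
    define I where "I = {i. i < n \<and> ball_integral \<phi> (\<nu> i) s (dist s t) \<le> ennreal (K / 4 * \<rho> s t)}"
    have I: "finite I" "I \<subseteq> {..<n}" "card I \<le> n"
      using card_mono[of "{..<n}" I] by (auto simp: I_def)
    have "ball_integral \<phi> \<mu> s (dist s t)
        \<le> ennreal (4 / card {..<n}) * (\<Sum>i\<in>I. ball_integral \<phi> (\<nu> i) s (dist s t))"
      unfolding \<mu>_def using n maj[OF that] I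
      by (intro ball_integral_mean_le[OF Y, where T = T]) (auto simp: I_def)
    also have "\<dots> \<le> ennreal (4 / card {..<n}) * (\<Sum>i\<in>I. ennreal (K / 4 * \<rho> s t))"
      by (intro mult_left_mono sum_mono) (auto simp: I_def)
    also have "\<dots> = ennreal (4 / n * (card I * (K / 4 * \<rho> s t)))"
      using K rho[of s t] by (simp add: ennreal_of_nat_eq_real_of_nat del: times_divide_eq_left times_divide_eq_right flip: ennreal_mult)
    also have "\<dots> \<le> ennreal (4 / n * (n * (K / 4 * \<rho> s t)))"
      using K rho[of s t] I n by (intro ennreal_leI mult_left_mono mult_right_mono) auto
    also have "4 / n * (n * (K / 4 * \<rho> s t)) = K * \<rho> s t" using n by simp
    finally show ?thesis .
  qed
  ultimately show False using infeas by auto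
qed

section \<open>From finitely additive probabilities to Borel measures\<close>

definition inner_content :: "('a::metric_space set \<Rightarrow> real) \<Rightarrow> 'a set \<Rightarrow> ennreal" where
  "inner_content \<nu> U = (SUP C\<in>{C. closed C \<and> C \<subseteq> U}. ennreal (\<nu> C))"

text \<open>Approximating first from inside by closed sets and then from outside by open ones can
  only increase the mass of a closed set, and it produces countable subadditivity by compactness of
  \<open>T\<close>.\<close>

definition outer_content :: "('a::metric_space set \<Rightarrow> real) \<Rightarrow> 'a set \<Rightarrow> ennreal" where
  "outer_content \<nu> A = (INF U\<in>{U. open U \<and> A \<subseteq> U}. inner_content \<nu> U)"

text \<open>A closed set inside the union meets \<open>T\<close> in a compact set, which finitely
  many \<open>U i\<close> cover. A Lebesgue number \<open>e\<close> of this cover splits it into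
  closed pieces \<open>C' i\<close> inside the \<open>U i\<close>, to which finite subadditivity
  applies.\<close>

lemma inner_content_UN_le:
  assumes T: "compact T" and nu: "prob_charge T \<nu>" and U: "\<And>i::nat. open (U i)"
  shows "inner_content \<nu> (\<Union>i. U i) \<le> (\<Sum>i. inner_content \<nu> (U i))"
  unfolding inner_content_def[of \<nu> "\<Union>i. U i"]
proof (rule SUP_least, clarify)
  fix C assume C: "closed C" "C \<subseteq> (\<Union>i. U i)"
  have TC: "compact (T \<inter> C)" using T C by auto
  obtain I :: "nat set" where I: "finite I" "T \<inter> C \<subseteq> (\<Union>i\<in>I. U i)"
  proof -
    have "T \<inter> C \<subseteq> (\<Union>i\<in>UNIV. U i)" using C by auto
    then obtain J where "J \<subseteq> UNIV" "finite J" "T \<inter> C \<subseteq> (\<Union>i\<in>J. U i)"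
      by (rule compactE_image[OF TC U])
    then show ?thesis using that by blast
  qed
  obtain e where e: "0 < e" "\<And>x. x \<in> T \<inter> C \<Longrightarrow> \<exists>G\<in>U ` I. ball x e \<subseteq> G"
    proof -
    have "T \<inter> C \<subseteq> \<Union>(U ` I)" "\<And>G. G \<in> U ` I \<Longrightarrow> open G" using I U by auto
    from Heine_Borel_lemma[OF TC this] that show ?thesis by blast
  qed
  define C' where "C' i = T \<inter> C \<inter> {x. ball x e \<subseteq> U i}" for i
  have C': "closed (C' i)" "C' i \<subseteq> U i" for i
  proof -
    have "{x. ball x e \<subseteq> U i} = - (\<Union>y\<in>- U i. ball y e)" by (auto simp: dist_commute)
    then have "closed {x. ball x e \<subseteq> U i}" by (simp add: closed_def open_UN)
    then show "closed (C' i)" unfolding C'_def by (rule closed_Int[OF compact_imp_closed[OF TC]])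
    show "C' i \<subseteq> U i" using e(1) by (auto simp: C'_def)
  qed
  have "\<nu> C = \<nu> (T \<inter> C)" using prob_charge_Int_support[OF nu] by simp
  also have "\<dots> \<le> \<nu> (\<Union>i\<in>I. C' i)"
    by (intro prob_charge_mono[OF nu]) (use e(2) in \<open>auto simp: C'_def\<close>)
  also have "\<dots> \<le> (\<Sum>i\<in>I. \<nu> (C' i))" by (rule prob_charge_UN_le[OF nu I(1)])
  finally have "ennreal (\<nu> C) \<le> (\<Sum>i\<in>I. ennreal (\<nu> (C' i)))"
    using prob_charge_nonneg[OF nu] by (simp add: sum_ennreal ennreal_leI)
  also have "\<dots> \<le> (\<Sum>i\<in>I. inner_content \<nu> (U i))"
    unfolding inner_content_def using C' by (intro sum_mono SUP_upper) auto
  also have "\<dots> \<le> (\<Sum>i. inner_content \<nu> (U i))"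
    by (intro sum_le_suminf) (auto simp: I)
  finally show "ennreal (\<nu> C) \<le> (\<Sum>i. inner_content \<nu> (U i))" .
qed

lemma inner_content_le_1: "prob_charge T \<nu> \<Longrightarrow> inner_content \<nu> U \<le> 1"
  unfolding inner_content_def by (intro SUP_least) (simp add: prob_charge_le_1)

lemma outer_content_le: "open U \<Longrightarrow> A \<subseteq> U \<Longrightarrow> outer_content \<nu> A \<le> inner_content \<nu> U"
  unfolding outer_content_def by (rule INF_lower) auto

lemma outer_content_close:
  assumes "prob_charge T \<nu>" "0 < (e::real)"
  obtains U where "open U" "A \<subseteq> U" "inner_content \<nu> U \<le> outer_content \<nu> A + ennreal e"
proof -
  have "outer_content \<nu> A \<le> 1"
    using outer_content_le[of UNIV A \<nu>] inner_content_le_1[OF assms(1)] order_trans by blast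
  then have "outer_content \<nu> A < outer_content \<nu> A + ennreal e"
    using assms(2) by (cases "outer_content \<nu> A") (auto simp flip: ennreal_plus simp: ennreal_less_iff top_unique)
  then show ?thesis
    using that unfolding outer_content_def[of \<nu> A] INF_less_iff by (auto intro: less_imp_le)
qed

lemma outer_measure_space_outer_content:
  assumes T: "compact T" and nu: "prob_charge T \<nu>"
  shows "outer_measure_space UNIV (outer_content \<nu>)"
  unfolding outer_measure_space_def
proof (intro conjI)
  have "inner_content \<nu> {} = 0"
    using prob_charge_empty[OF nu] by (auto simp: inner_content_def)
  then show "positive UNIV (outer_content \<nu>)"
    using outer_content_le[of "{}" "{}" \<nu>] by (simp add: positive_def)
  show "increasing UNIV (outer_content \<nu>)"
    unfolding increasing_def outer_content_def by (intro ballI impI INF_superset_mono) auto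
  show "countably_subadditive UNIV (outer_content \<nu>)"
    unfolding countably_subadditive_def
  proof safe
    fix A :: "nat \<Rightarrow> 'a set"
    show "outer_content \<nu> (\<Union>i. A i) \<le> (\<Sum>i. outer_content \<nu> (A i))"
    proof (rule ennreal_le_epsilon)
      fix e :: real assume e: "0 < e"
      have "\<exists>U. open U \<and> A i \<subseteq> U \<and> inner_content \<nu> U \<le> outer_content \<nu> (A i) + ennreal (e * (1 / 2) ^ Suc i)" for i
        using outer_content_close[OF nu, of "e * (1 / 2) ^ Suc i" "A i"] e by force
      then obtain U where U: "\<And>i. open (U i)" "\<And>i. A i \<subseteq> U i"
        "\<And>i. inner_content \<nu> (U i) \<le> outer_content \<nu> (A i) + ennreal (e * (1 / 2) ^ Suc i)" by metis
      have "outer_content \<nu> (\<Union>i. A i) \<le> inner_content \<nu> (\<Union>i. U i)"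
        using U by (intro outer_content_le) auto
      also have "\<dots> \<le> (\<Sum>i. inner_content \<nu> (U i))" by (rule inner_content_UN_le[OF T nu U(1)])
      also have "\<dots> \<le> (\<Sum>i. outer_content \<nu> (A i) + ennreal (e * (1 / 2) ^ Suc i))"
        by (intro suminf_le U(3)) auto
      also have "\<dots> = (\<Sum>i. outer_content \<nu> (A i)) + (\<Sum>i. ennreal (e * (1 / 2) ^ Suc i))"
        by (rule suminf_add[symmetric]) auto
      also have "(\<Sum>i. ennreal (e * (1 / 2) ^ Suc i)) = ennreal e"
        using e sums_mult[OF power_half_series, of e]
        by (subst suminf_ennreal2) (auto simp: sums_iff)
      finally show "outer_content \<nu> (\<Union>i. A i) \<le> (\<Sum>i. outer_content \<nu> (A i)) + ennreal e" .
    qed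
  qed
qed

text \<open>The nontrivial half of the Caratheodory condition: for an open \<open>V\<close>
  containing \<open>X\<close>, exhaust \<open>U \<inter> V\<close> by a closed \<open>C\<close>,
  then the open set \<open>V - C\<close>, which contains \<open>X - U\<close>, by a closed
  \<open>D\<close>. Being disjoint, \<open>C\<close> and \<open>D\<close> have total mass at most
  the inner content of \<open>V\<close>.\<close>

lemma open_in_lambda_system:
  assumes T: "compact T" and nu: "prob_charge T \<nu>" and U: "open U"
  shows "U \<in> lambda_system UNIV UNIV (outer_content \<nu>)"
  unfolding lambda_system_def
proof (intro CollectI conjI ballI UNIV_I antisym)
  fix X
  have oms: "outer_measure_space UNIV (outer_content \<nu>)"
    by (rule outer_measure_space_outer_content[OF T nu])
  interpret P: sigma_algebra UNIV "UNIV :: 'a set set"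
    using sigma_algebra_Pow[of UNIV] by simp
  have "subadditive UNIV (outer_content \<nu>)"
    using oms P.countably_subadditive_subadditive by (auto simp: outer_measure_space_def)
  from subadditiveD[OF this, of "U \<inter> X" "(UNIV - U) \<inter> X"]
  have "outer_content \<nu> (U \<inter> X \<union> (UNIV - U) \<inter> X) \<le>
      outer_content \<nu> (U \<inter> X) + outer_content \<nu> ((UNIV - U) \<inter> X)" by auto
  also have "U \<inter> X \<union> (UNIV - U) \<inter> X = X" by auto
  finally show "outer_content \<nu> X \<le> outer_content \<nu> (U \<inter> X) + outer_content \<nu> ((UNIV - U) \<inter> X)" .
  show "outer_content \<nu> (U \<inter> X) + outer_content \<nu> ((UNIV - U) \<inter> X) \<le> outer_content \<nu> X"
    unfolding outer_content_def[of \<nu> X]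
  proof (rule INF_greatest, clarify)
    fix V assume V: "open V" "X \<subseteq> V"
    let ?r = "outer_content \<nu> ((UNIV - U) \<inter> X)"
    have "outer_content \<nu> (U \<inter> X) + ?r \<le> inner_content \<nu> (U \<inter> V) + ?r"
      using U V by (intro add_right_mono outer_content_le) auto
    also have "\<dots> = (SUP C\<in>{C. closed C \<and> C \<subseteq> U \<inter> V}. ennreal (\<nu> C) + ?r)"
      unfolding inner_content_def
      by (rule ennreal_SUP_add_left[symmetric]) auto
    also have "\<dots> \<le> inner_content \<nu> V"
    proof (rule SUP_least, clarify)
      fix C assume C: "closed C" "C \<subseteq> U \<inter> V"
      have "ennreal (\<nu> C) + ?r \<le> ennreal (\<nu> C) + inner_content \<nu> (V - C)"
        using C V by (intro add_left_mono outer_content_le) auto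
      also have "\<dots> = (SUP D\<in>{D. closed D \<and> D \<subseteq> V - C}. ennreal (\<nu> C) + ennreal (\<nu> D))"
        unfolding inner_content_def by (rule ennreal_SUP_add_right) auto
      also have "\<dots> \<le> inner_content \<nu> V"
      proof (rule SUP_least, clarify)
        fix D assume D: "closed D" "D \<subseteq> V - C"
        have "ennreal (\<nu> C) + ennreal (\<nu> D) = ennreal (\<nu> C + \<nu> D)"
          using prob_charge_nonneg[OF nu] by (simp add: ennreal_plus)
        also have "\<nu> C + \<nu> D = \<nu> (C \<union> D)"
        proof -
          have "C \<inter> D = {}" using D by auto
          then show ?thesis using prob_charge_Un_disjoint[OF nu] by simp
        qed
        also have "ennreal (\<nu> (C \<union> D)) \<le> inner_content \<nu> V"
          unfolding inner_content_def using C D by (intro SUP_upper) auto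
        finally show "ennreal (\<nu> C) + ennreal (\<nu> D) \<le> inner_content \<nu> V" .
      qed
      finally show "ennreal (\<nu> C) + ?r \<le> inner_content \<nu> V" .
    qed
    finally show "outer_content \<nu> (U \<inter> X) + ?r \<le> inner_content \<nu> V" .
  qed
qed

text \<open>The outer content restricted to Borel sets is a measure by Caratheodory. It is at least
  \<open>\<nu>\<close> on closed sets and at most 1 everywhere; since \<open>T\<close> is closed
  with \<open>\<nu> T = 1\<close>, the restriction to \<open>T\<close> is a probability.\<close>

lemma prob_charge_closed_dominated:
  fixes T :: "'a::metric_space set"
  assumes T: "compact T" and nu: "prob_charge T \<nu>"
  shows "\<exists>m. prob_space m \<and> sets m = sets (restrict_space borel T) \<and>
     (\<forall>C. closed C \<longrightarrow> ennreal (\<nu> C) \<le> emeasure m (T \<inter> C))"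
proof -
  interpret P: sigma_algebra UNIV "UNIV :: 'a set set"
    using sigma_algebra_Pow[of UNIV] by simp
  let ?L = "lambda_system UNIV UNIV (outer_content \<nu>)"
  have L: "measure_space UNIV ?L (outer_content \<nu>)"
    by (rule P.caratheodory_lemma[OF outer_measure_space_outer_content[OF T nu]])
  then have "sigma_algebra UNIV ?L" by (simp add: measure_space_def)
  then interpret L: sigma_algebra UNIV ?L .
  have "sets borel \<subseteq> ?L"
    unfolding borel_def using open_in_lambda_system[OF T nu]
    by (auto intro!: L.sigma_sets_subset)
  then have ms: "measure_space UNIV (sets borel) (outer_content \<nu>)"
    using measure_down[OF L] sets.sigma_algebra_axioms[of borel] by simp
  define M where "M = measure_of UNIV (sets (borel :: 'a measure)) (outer_content \<nu>)"
  have M: "sets M = sets borel" "space M = UNIV"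
    using sets.sigma_sets_eq[of "borel :: 'a measure"] by (simp_all add: M_def)
  have em: "emeasure M A = outer_content \<nu> A" if "A \<in> sets borel" for A
    using emeasure_measure_of_sigma[of UNIV "sets borel" "outer_content \<nu>" A] ms that
    by (simp add: M_def measure_space_def)
  have ge: "ennreal (\<nu> C) \<le> emeasure M C" if "closed C" for C
    using that unfolding em[OF borel_closed[OF that]] outer_content_def
    by (auto intro!: INF_greatest SUP_upper simp: inner_content_def)
  have T_sets: "T \<in> sets M" using T by (simp add: M compact_imp_closed)
  have "emeasure M T \<le> 1"
    using outer_content_le[of UNIV T \<nu>] inner_content_le_1[OF nu, of UNIV] em[of T] T_sets M by auto
  moreover have "emeasure M T \<ge> 1"
    using ge[OF compact_imp_closed[OF T]] nu by (simp add: prob_charge_def)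
  ultimately have "emeasure M T = 1" by simp
  then have "prob_space (restrict_space M T)"
    using T_sets by (intro prob_spaceI) (simp add: M emeasure_restrict_space)
  moreover have "sets (restrict_space M T) = sets (restrict_space borel T)"
    by (rule sets_restrict_space_cong[OF M(1)])
  moreover have "ennreal (\<nu> C) \<le> emeasure (restrict_space M T) (T \<inter> C)" if "closed C" for C
  proof -
    have "\<nu> C = \<nu> (T \<inter> C)" using prob_charge_Int_support[OF nu] by simp
    also have "ennreal (\<nu> (T \<inter> C)) \<le> emeasure M (T \<inter> C)"
      using T that by (intro ge) (auto simp: compact_imp_closed)
    also have "\<dots> = emeasure (restrict_space M T) (T \<inter> C)"
      using T_sets by (subst emeasure_restrict_space) auto
    finally show ?thesis .
  qed
  ultimately show ?thesis by blast
qed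

section \<open>Compactness: from finite sets of pairs to all pairs\<close>

text \<open>Lower semicontinuity from the right: the condition \<open>\<phi> a * x < 1\<close> is
  open in \<open>x\<close>. It is what Fatou's lemma needs in the passage to a limit charge.\<close>

lemma young_rec_le_liminf:
  assumes Y: "young_function \<phi>" and x: "0 \<le> x"
  shows "young_rec \<phi> x \<le> liminf (\<lambda>n. young_rec \<phi> (x + 1 / Suc n))"
  unfolding le_Liminf_iff
proof clarify
  fix y assume "y < young_rec \<phi> x"
  then obtain a where a: "y = ennreal a" "0 \<le> a" by (cases y) auto
  then have "\<phi> a * x < 1" using less_young_rec_iff[OF Y a(2) x] \<open>y < young_rec \<phi> x\<close> by simp
  moreover have "(\<lambda>n. \<phi> a * (x + 1 / Suc n)) \<longlonglongrightarrow> \<phi> a * (x + 0)"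
    by (intro tendsto_intros LIMSEQ_Suc[OF lim_1_over_n])
  ultimately have "eventually (\<lambda>n. \<phi> a * (x + 1 / Suc n) < 1) sequentially"
    by (auto dest: order_tendstoD(2)[where a = 1])
  then show "eventually (\<lambda>n. y < young_rec \<phi> (x + 1 / Suc n)) sequentially"
    by eventually_elim (use less_young_rec_iff[OF Y a(2)] x a in auto)
qed

text \<open>
  The approximating charge need only be close to \<open>\<nu>\<close> at the radii \<open>k * d / n\<close>: rounding the radius
  down to such a value costs a shift of the integration variable by \<open>d / n\<close>.
\<close>

lemma ball_integral_le_of_approx:
  fixes s :: "'a::metric_space"
  assumes Y: "young_function \<phi>" and nu: "prob_charge T \<nu>" and d: "0 < d"
    and approx: "\<And>\<A> e. finite \<A> \<Longrightarrow> 0 < e \<Longrightarrow>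
      \<exists>\<mu>. prob_charge T \<mu> \<and> ball_integral \<phi> \<mu> s d \<le> c \<and> (\<forall>A\<in>\<A>. \<bar>\<mu> A - \<nu> A\<bar> < e)"
  shows "ball_integral \<phi> \<nu> s d \<le> c"
proof -
  define g where "g n \<epsilon> = young_rec \<phi> (\<nu> (cball s \<epsilon>) + 1 / Suc n)" for n and \<epsilon> :: real
  have [measurable]: "g n \<in> borel_measurable borel" for n unfolding g_def
    using prob_charge_nonneg[OF nu]
    by (intro antimono_borel_measurable antimonoI young_rec_antimono[OF Y] add_right_mono prob_charge_mono[OF nu]) auto
  have le: "(\<integral>\<^sup>+\<epsilon>. g n \<epsilon> * indicator {d / Suc n..d} \<epsilon> \<partial>lborel) \<le> c" for n
  proof -
    define h where "h = d / Suc n"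
    have h: "h > 0" using d by (simp add: h_def)
    obtain \<mu> where mu: "prob_charge T \<mu>" "ball_integral \<phi> \<mu> s d \<le> c"
      and close: "\<And>k. k \<le> Suc n \<Longrightarrow> \<bar>\<mu> (cball s (real k * h)) - \<nu> (cball s (real k * h))\<bar> < 1 / Suc n"
      using approx[of "(\<lambda>k. cball s (real k * h)) ` {..Suc n}" "1 / Suc n"] by auto
    have [measurable]: "(\<lambda>\<epsilon>. young_rec \<phi> (\<mu> (cball s \<epsilon>))) \<in> borel_measurable borel"
      by (rule young_rec_charge_measurable[OF Y mu(1)])
    have pt: "g n \<epsilon> \<le> young_rec \<phi> (\<mu> (cball s (\<epsilon> - h)))" if "h \<le> \<epsilon>" "\<epsilon> \<le> d" for \<epsilon>
    proof -
      define k where "k = nat \<lfloor>\<epsilon> / h\<rfloor>"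
      have k: "real k = of_int \<lfloor>\<epsilon> / h\<rfloor>" using that h by (simp add: k_def)
      have "real k \<le> \<epsilon> / h" "\<epsilon> / h < real k + 1" unfolding k by linarith+
      then have k1: "real k * h \<le> \<epsilon>" "\<epsilon> - h \<le> real k * h" using h by (auto simp: field_simps)
      have "real k * h \<le> real (Suc n) * h" using k1(1) that d by (simp add: h_def)
      then have kn: "k \<le> Suc n" using h by (metis mult_le_cancel_right_pos of_nat_le_iff)
      have "\<mu> (cball s (\<epsilon> - h)) \<le> \<mu> (cball s (real k * h))"
        using k1 by (intro prob_charge_mono[OF mu(1)]) auto
      also have "\<dots> \<le> \<nu> (cball s (real k * h)) + 1 / Suc n" using close[OF kn] by linarith
      also have "\<nu> (cball s (real k * h)) \<le> \<nu> (cball s \<epsilon>)"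
        using k1 by (intro prob_charge_mono[OF nu]) auto
      finally show ?thesis unfolding g_def
        by (intro young_rec_antimono[OF Y] prob_charge_nonneg[OF mu(1)]) auto
    qed
    have "(\<integral>\<^sup>+\<epsilon>. g n \<epsilon> * indicator {h..d} \<epsilon> \<partial>lborel)
        \<le> (\<integral>\<^sup>+\<epsilon>. young_rec \<phi> (\<mu> (cball s (- h + 1 * \<epsilon>))) * indicator {0..d} (- h + 1 * \<epsilon>) \<partial>lborel)"
      using pt h by (intro nn_integral_mono) (auto simp: indicator_def)
    also have "\<dots> = ball_integral \<phi> \<mu> s d"
      unfolding ball_integral_def
      using nn_integral_real_affine[of "\<lambda>\<epsilon>. young_rec \<phi> (\<mu> (cball s \<epsilon>)) * indicator {0..d} \<epsilon>" 1 "- h"]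
      by simp
    finally show ?thesis using mu(2) by (simp add: h_def)
  qed
  \<comment> \<open>The point \<open>0\<close> lies in none of the intervals
    \<open>{d / Suc n..d}\<close> and is discarded as a null set; on the rest these intervals
    increase to the full domain.\<close>
  have "ball_integral \<phi> \<nu> s d
      = (\<integral>\<^sup>+\<epsilon>. young_rec \<phi> (\<nu> (cball s \<epsilon>)) * indicator {0<..d} \<epsilon> \<partial>lborel)"
    unfolding ball_integral_def
    by (intro nn_integral_cong_AE, use AE_lborel_singleton[of 0] in eventually_elim) (auto simp: indicator_def)
  also have "\<dots> \<le> (\<integral>\<^sup>+\<epsilon>. liminf (\<lambda>n. g n \<epsilon> * indicator {d / Suc n..d} \<epsilon>) \<partial>lborel)"
  proof (rule nn_integral_mono)
    fix \<epsilon> :: real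
    show "young_rec \<phi> (\<nu> (cball s \<epsilon>)) * indicator {0<..d} \<epsilon>
        \<le> liminf (\<lambda>n. g n \<epsilon> * indicator {d / Suc n..d} \<epsilon>)"
    proof (cases "\<epsilon> \<in> {0<..d}")
      case True
      have "(\<lambda>n. d * (1 / Suc n)) \<longlonglongrightarrow> d * 0"
        by (intro tendsto_intros LIMSEQ_Suc[OF lim_1_over_n])
      then have "eventually (\<lambda>n. d / Suc n < \<epsilon>) sequentially"
        using True by (auto dest: order_tendstoD(2)[where a = \<epsilon>])
      then have "eventually (\<lambda>n. g n \<epsilon> = g n \<epsilon> * indicator {d / Suc n..d} \<epsilon>) sequentially"
        by eventually_elim (use True in auto)
      then have "liminf (\<lambda>n. g n \<epsilon>) = liminf (\<lambda>n. g n \<epsilon> * indicator {d / Suc n..d} \<epsilon>)"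
        by (rule Liminf_eq)
      then show ?thesis
        using young_rec_le_liminf[OF Y prob_charge_nonneg[OF nu, of "cball s \<epsilon>"]] True
        by (simp add: g_def)
    qed simp
  qed
  also have "\<dots> \<le> liminf (\<lambda>n. \<integral>\<^sup>+\<epsilon>. g n \<epsilon> * indicator {d / Suc n..d} \<epsilon> \<partial>lborel)"
    by (rule nn_integral_liminf) measurable
  also have "\<dots> \<le> liminf (\<lambda>n::nat. c)" by (intro Liminf_mono always_eventually allI le)
  also have "\<dots> = c" by (rule Liminf_const) simp
  finally show ?thesis .
qed

text \<open>The cube of all set functions with values in \<open>[0, 1]\<close> is compact by
  Tychonoff, and the closures of the sets \<open>Q F\<close> have the finite intersection property.
  For a common point \<open>\<nu>\<close>, additivity and total mass follow by approximation on
  finitely many sets, and the integral bounds by \<open>ball_integral_le_of_approx\<close>.\<close>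

lemma exists_feasible_charge:
  fixes T :: "'a::metric_space set"
  assumes Y: "young_function \<phi>"
    and feas: "\<And>F. finite F \<Longrightarrow> F \<subseteq> T \<times> T \<Longrightarrow>
      \<exists>\<nu>. prob_charge T \<nu> \<and> (\<forall>(s, t)\<in>F. ball_integral \<phi> \<nu> s (dist s t) \<le> c s t)"
  shows "\<exists>\<nu>. prob_charge T \<nu> \<and> (\<forall>s\<in>T. \<forall>t\<in>T. ball_integral \<phi> \<nu> s (dist s t) \<le> c s t)"
proof -
  define Q where "Q F = {\<nu>. prob_charge T \<nu> \<and> (\<forall>(s, t)\<in>F. ball_integral \<phi> \<nu> s (dist s t) \<le> c s t)}" for F
  let ?I = "{F. finite F \<and> F \<subseteq> T \<times> T}"
  define S where "S = (PiE UNIV (\<lambda>_. {0..1}) :: ('a set \<Rightarrow> real) set)"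
  have "compactin (product_topology (\<lambda>_. euclidean) UNIV) S"
    unfolding S_def compactin_PiE by simp
  then have "compact S" by (simp add: euclidean_product_topology)
  have "S \<inter> (\<Inter>F\<in>?I. closure (Q F)) \<noteq> {}"
  proof (rule compact_imp_fip_image[OF \<open>compact S\<close>])
    fix \<F> assume "finite \<F>" "\<F> \<subseteq> ?I"
    then have "finite (\<Union>\<F>)" "\<Union>\<F> \<subseteq> T \<times> T" by auto
    from feas[OF this] obtain \<nu> where nu: "\<nu> \<in> Q (\<Union>\<F>)" by (auto simp: Q_def)
    then have "\<nu> \<in> S"
      using prob_charge_nonneg prob_charge_le_1 by (auto simp: S_def Q_def)
    moreover have "\<nu> \<in> closure (Q F)" if "F \<in> \<F>" for F
      using nu that closure_subset[of "Q F"] by (fastforce simp: Q_def)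
    ultimately show "S \<inter> (\<Inter>F\<in>\<F>. closure (Q F)) \<noteq> {}" by auto
  qed simp
  then obtain \<nu> where nu: "\<nu> \<in> S" "\<And>F. finite F \<Longrightarrow> F \<subseteq> T \<times> T \<Longrightarrow> \<nu> \<in> closure (Q F)" by auto
  have approx: "\<exists>\<mu>\<in>Q F. \<forall>A\<in>\<A>. \<bar>\<mu> A - \<nu> A\<bar> < e"
    if "finite F" "F \<subseteq> T \<times> T" "finite \<A>" "0 < e" for F \<A> and e :: real
  proof -
    let ?U = "{\<mu>. \<forall>A\<in>\<A>. \<mu> (id A) \<in> ball (\<nu> A) e}"
    have "open ?U" using that by (intro product_topology_basis') auto
    moreover have "\<nu> \<in> ?U" using that by auto
    ultimately have "?U \<inter> Q F \<noteq> {}"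
      using nu(2)[OF that(1,2)] open_Int_closure_eq_empty[of ?U "Q F"] by blast
    then show ?thesis by (auto simp: dist_real_def abs_minus_commute)
  qed
  have charge: "prob_charge T \<nu>"
    unfolding prob_charge_def
  proof (intro conjI allI impI)
    show "0 \<le> \<nu> A" for A using nu(1) by (auto simp: S_def PiE_iff)
    have small: "x = y" if "\<And>e::real. 0 < e \<Longrightarrow> \<bar>x - y\<bar> < 3 * e" for x y
      using that[of "\<bar>x - y\<bar> / 3"] by (cases "x = y") auto
    show "\<nu> (A \<union> B) = \<nu> A + \<nu> B" if "A \<inter> B = {}" for A B
    proof (rule small)
      fix e :: real assume "0 < e"
      with approx[of "{}" "{A, B, A \<union> B}" e] obtain \<mu> where "prob_charge T \<mu>"
        "\<bar>\<mu> A - \<nu> A\<bar> < e" "\<bar>\<mu> B - \<nu> B\<bar> < e" "\<bar>\<mu> (A \<union> B) - \<nu> (A \<union> B)\<bar> < e" by (auto simp: Q_def)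
      moreover from this that have "\<mu> (A \<union> B) = \<mu> A + \<mu> B" by (auto simp: prob_charge_def)
      ultimately show "\<bar>\<nu> (A \<union> B) - (\<nu> A + \<nu> B)\<bar> < 3 * e" by linarith
    qed
    have "\<nu> A = 1" if "A = T \<or> A = UNIV" for A
    proof (rule small)
      fix e :: real assume "0 < e"
      with approx[of "{}" "{A}" e] obtain \<mu> where "prob_charge T \<mu>" "\<bar>\<mu> A - \<nu> A\<bar> < e"
        by (auto simp: Q_def)
      moreover from this that have "\<mu> A = 1" by (auto simp: prob_charge_def)
      ultimately show "\<bar>\<nu> A - 1\<bar> < 3 * e" by linarith
    qed
    then show "\<nu> T = 1" "\<nu> UNIV = 1" by auto
  qed
  moreover have "ball_integral \<phi> \<nu> s (dist s t) \<le> c s t" if st: "s \<in> T" "t \<in> T" for s t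
  proof (cases "s = t")
    case True
    have "AE \<epsilon> in lborel. young_rec \<phi> (\<nu> (cball s \<epsilon>)) * indicator {0..0} \<epsilon> = 0"
      using AE_lborel_singleton[of "0::real"] by eventually_elim auto
    from nn_integral_cong_AE[OF this] have "ball_integral \<phi> \<nu> s 0 = 0"
      unfolding ball_integral_def by simp
    then show ?thesis using True by simp
  next
    case False
    show ?thesis
    proof (rule ball_integral_le_of_approx[OF Y charge])
      fix \<A> :: "'a set set" and e :: real assume "finite \<A>" "0 < e"
      with approx[of "{(s, t)}" \<A> e] st
      show "\<exists>\<mu>. prob_charge T \<mu> \<and> ball_integral \<phi> \<mu> s (dist s t) \<le> c s t \<and> (\<forall>A\<in>\<A>. \<bar>\<mu> A - \<nu> A\<bar> < e)"
        by (auto simp: Q_def)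
    qed (use False in simp)
  qed
  ultimately show ?thesis by blast
qed

text \<open>A measure with larger mass on closed balls has smaller integrals. The bound for
  \<open>(t, s)\<close> handles the second entry of the maximum because \<open>c\<close> is
  symmetric.\<close>

lemma exists_measure_of_feasible:
  fixes T :: "'a::metric_space set"
  assumes T: "compact T" and Y: "young_function \<phi>"
    and sym: "\<And>s t. s \<in> T \<Longrightarrow> t \<in> T \<Longrightarrow> c s t = c t s"
    and feas: "\<And>F. finite F \<Longrightarrow> F \<subseteq> T \<times> T \<Longrightarrow>
      \<exists>\<nu>. prob_charge T \<nu> \<and> (\<forall>(s, t)\<in>F. ball_integral \<phi> \<nu> s (dist s t) \<le> c s t)"
  shows "\<exists>m. prob_space m \<and> sets m = sets (restrict_space borel T) \<and>
     (\<forall>s\<in>T. \<forall>t\<in>T. minorizing_metric T m \<phi> s t \<le> c s t)"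
proof -
  obtain \<nu> where nu: "prob_charge T \<nu>" "\<And>s t. s \<in> T \<Longrightarrow> t \<in> T \<Longrightarrow> ball_integral \<phi> \<nu> s (dist s t) \<le> c s t"
    using exists_feasible_charge[of \<phi> T c, OF Y feas] by metis
  obtain m where m: "prob_space m" "sets m = sets (restrict_space borel T)"
    and ge: "\<And>C. closed C \<Longrightarrow> ennreal (\<nu> C) \<le> emeasure m (T \<inter> C)"
    using prob_charge_closed_dominated[OF T nu(1)] by metis
  interpret m: prob_space m by (rule m(1))
  have rec: "young_inv \<phi> (1 / emeasure m (T \<inter> cball x \<epsilon>)) \<le> young_rec \<phi> (\<nu> (cball x \<epsilon>))" for x \<epsilon>
  proof -
    have "\<nu> (cball x \<epsilon>) \<le> measure m (T \<inter> cball x \<epsilon>)"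
      using ge[of "cball x \<epsilon>"] by (simp add: m.emeasure_eq_measure)
    then have "young_rec \<phi> (measure m (T \<inter> cball x \<epsilon>)) \<le> young_rec \<phi> (\<nu> (cball x \<epsilon>))"
      by (intro young_rec_antimono[OF Y] prob_charge_nonneg[OF nu(1)])
    then show ?thesis by (simp add: m.emeasure_eq_measure young_rec_def)
  qed
  have le: "(\<integral>\<^sup>+\<epsilon>\<in>{0..d}. young_inv \<phi> (1 / emeasure m (T \<inter> cball x \<epsilon>)) \<partial>lborel) \<le> ball_integral \<phi> \<nu> x d" for x d
    unfolding ball_integral_def by (intro nn_integral_mono mult_right_mono rec) auto
  have "minorizing_metric T m \<phi> s t \<le> c s t" if st: "s \<in> T" "t \<in> T" for s t
    unfolding minorizing_metric_def
    using order_trans[OF le nu(2)[OF st]] order_trans[OF le nu(2)[OF st(2,1)]] sym[OF st]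
    by (auto simp: dist_commute)
  with m show ?thesis by blast
qed

section \<open>Random humps\<close>

text \<open>A distribution function evaluated at its own random variable is stochastically at least
  uniform. By finiteness the event has an element with the largest value of \<open>r\<close>, and it
  is contained in the sublevel set of that element, whose probability is at most
  \<open>x\<close>.\<close>

lemma pmf_cdf_le:
  fixes r :: "'w \<Rightarrow> real"
  assumes fin: "finite (set_pmf q)" and x: "0 \<le> x"
  shows "measure_pmf.prob q {\<omega>. measure_pmf.prob q {\<omega>'. r \<omega>' \<le> r \<omega>} \<le> x} \<le> x"
proof -
  define A where "A = {\<omega>\<in>set_pmf q. measure_pmf.prob q {\<omega>'. r \<omega>' \<le> r \<omega>} \<le> x}"
  have eq: "measure_pmf.prob q {\<omega>. measure_pmf.prob q {\<omega>'. r \<omega>' \<le> r \<omega>} \<le> x} = measure_pmf.prob q A"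
    by (intro measure_pmf.finite_measure_eq_AE AE_pmfI) (auto simp: A_def)
  show ?thesis
  proof (cases "A = {}")
    case False
    have "finite A" using fin by (simp add: A_def)
    then have "Max (r ` A) \<in> r ` A" using False by (intro Max_in) auto
    then obtain \<omega> where w: "\<omega> \<in> A" "r \<omega> = Max (r ` A)" by auto
    have "A \<subseteq> {\<omega>'. r \<omega>' \<le> r \<omega>}" using w \<open>finite A\<close> by auto
    then have "measure_pmf.prob q A \<le> measure_pmf.prob q {\<omega>'. r \<omega>' \<le> r \<omega>}"
      by (intro measure_pmf.finite_measure_mono) auto
    then show ?thesis using w eq by (auto simp: A_def)
  qed (simp add: eq x)
qed

text \<open>If \<open>z\<close> exceeds \<open>R ^ Suc n\<close>, then
  \<open>R ^ (j + n) \<le> z < R ^ (Suc j + n)\<close> for some \<open>j\<close>, and the summand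
  for this \<open>j\<close> alone is large enough. The term 1 covers smaller
  \<open>z\<close>.\<close>

lemma young_le_layer_sum:
  assumes Y: "young_function \<psi>" "\<psi> 1 = 1" and R: "1 < R" and z: "0 \<le> z"
  shows "ennreal (\<psi> (z / R ^ Suc n)) \<le>
    1 + (\<Sum>j. ennreal (\<psi> (R ^ j)) * indicator {x. R ^ (j + n) \<le> x} z)"
proof (cases "z \<le> R ^ Suc n")
  case True
  then have "z / R ^ Suc n \<le> 1" using R by (simp add: divide_le_eq)
  then have "\<psi> (z / R ^ Suc n) \<le> \<psi> 1" using z R by (intro young_mono[OF Y(1)]) auto
  then have "ennreal (\<psi> (z / R ^ Suc n)) \<le> 1" using Y by simp
  then show ?thesis by (rule order_trans) simp
next
  case False
  define f where "f j = ennreal (\<psi> (R ^ j)) * indicator {x. R ^ (j + n) \<le> x} z" for j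
  define k where "k = (LEAST k. z < R ^ (k + n))"
  obtain i where "z < R ^ i" using real_arch_pow[OF R] by blast
  also have "R ^ i \<le> R ^ (i + n)" using R by (intro power_increasing) auto
  finally have k: "z < R ^ (k + n)" unfolding k_def by (rule LeastI)
  have "R ^ n \<le> R ^ Suc n" using R by (intro power_increasing) auto
  then have "k \<noteq> 0" using False k by (intro notI) simp
  then obtain j where j: "k = Suc j" by (cases k) auto
  then have le: "R ^ (j + n) \<le> z" using not_less_Least[of j "\<lambda>k. z < R ^ (k + n)"] by (auto simp: k_def)
  have "z / R ^ Suc n \<le> R ^ j" using k R by (simp add: j divide_le_eq power_add mult_ac)
  then have "ennreal (\<psi> (z / R ^ Suc n)) \<le> f j"
    unfolding f_def using z R le by (auto intro!: ennreal_leI young_mono[OF Y(1)])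
  also have "\<dots> = (\<Sum>j\<in>{j}. f j)" by simp
  also have "\<dots> \<le> (\<Sum>j. f j)"
    by (rule sum_le_suminf) auto
  finally show ?thesis unfolding f_def by (rule order_trans) simp
qed

text \<open>If the inverse function at \<open>1 / G\<close> reaches \<open>R ^ i\<close>, then
  \<open>G\<close> is at most \<open>1 / \<phi> (R ^ i)\<close>, an event of at most that
  probability. Summing these tails over the geometric layers yields exactly the given
  series.\<close>

lemma young_moment_le:
  assumes Y: "young_function \<phi>" "young_function \<psi>" "\<phi> 1 = 1" "\<psi> 1 = 1" and R: "1 < R"
    and sm: "summable (\<lambda>k. \<psi> (R ^ k) / \<phi> (R ^ (k + n)))"
    and G: "\<And>\<omega>. \<omega> \<in> set_pmf q \<Longrightarrow> 0 < G \<omega>"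
    and cdf: "\<And>x. 0 \<le> x \<Longrightarrow> measure_pmf.prob q {\<omega>. G \<omega> \<le> x} \<le> x"
  shows "(\<integral>\<^sup>+\<omega>. ennreal (\<psi> (enn2real (young_rec \<phi> (G \<omega>)) / R ^ Suc n)) \<partial>q)
    \<le> ennreal (1 + (\<Sum>k. \<psi> (R ^ k) / \<phi> (R ^ (k + n))))"
proof -
  define Z where "Z \<omega> = enn2real (young_rec \<phi> (G \<omega>))" for \<omega>
  have R1: "1 \<le> R ^ i" for i using R by simp
  have pos: "1 \<le> \<phi> (R ^ i)" for i using young_mono[OF Y(1), of 1 "R ^ i"] R1 Y by simp
  have psi: "0 \<le> \<psi> (R ^ i)" for i using R by (intro young_nonneg[OF Y(2)]) simp
  have term_nonneg: "0 \<le> \<psi> (R ^ k) / \<phi> (R ^ (k + n))" for k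
    using psi[of k] pos[of "k + n"] by simp
  have tail: "emeasure q {\<omega>. R ^ i \<le> Z \<omega>} \<le> ennreal (1 / \<phi> (R ^ i))" for i
  proof -
    have "measure_pmf.prob q {\<omega>. R ^ i \<le> Z \<omega>} = measure_pmf.prob q {\<omega>\<in>set_pmf q. R ^ i \<le> Z \<omega>}"
      by (intro measure_pmf.finite_measure_eq_AE AE_pmfI) auto
    also have "\<dots> \<le> measure_pmf.prob q {\<omega>. G \<omega> \<le> 1 / \<phi> (R ^ i)}"
    proof (intro measure_pmf.finite_measure_mono subsetI, clarify)
      fix \<omega> assume w: "\<omega> \<in> set_pmf q" "R ^ i \<le> Z \<omega>"
      obtain z where z: "0 \<le> z" "young_rec \<phi> (G \<omega>) = ennreal z" "\<phi> z = 1 / G \<omega>"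
        using young_rec_eq[OF Y(1) G[OF w(1)]] by blast
      have "\<phi> (R ^ i) \<le> \<phi> z" using w z R by (intro young_mono[OF Y(1)]) (auto simp: Z_def)
      then show "G \<omega> \<le> 1 / \<phi> (R ^ i)"
        using z G[OF w(1)] pos[of i] by (simp add: field_simps)
    qed simp
    also have "\<dots> \<le> 1 / \<phi> (R ^ i)" using pos[of i] by (intro cdf) simp
    finally show ?thesis by (simp add: measure_pmf.emeasure_eq_measure ennreal_leI)
  qed
  have "(\<integral>\<^sup>+\<omega>. ennreal (\<psi> (Z \<omega> / R ^ Suc n)) \<partial>q)
      \<le> (\<integral>\<^sup>+\<omega>. 1 + (\<Sum>j. ennreal (\<psi> (R ^ j)) * indicator {\<omega>. R ^ (j + n) \<le> Z \<omega>} \<omega>) \<partial>q)"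
    using young_le_layer_sum[OF Y(2,4) R, of "Z _" n]
    by (intro nn_integral_mono) (simp add: Z_def indicator_def)
  also have "\<dots> = 1 + (\<Sum>j. ennreal (\<psi> (R ^ j)) * emeasure q {\<omega>. R ^ (j + n) \<le> Z \<omega>})"
    by (subst nn_integral_add; (subst nn_integral_suminf)?) (auto simp: nn_integral_cmult_indicator measure_pmf.emeasure_space_1)
  also have "\<dots> \<le> 1 + (\<Sum>j. ennreal (\<psi> (R ^ j)) * ennreal (1 / \<phi> (R ^ (j + n))))"
    by (intro add_left_mono suminf_le mult_left_mono tail) auto
  also have "\<dots> = 1 + (\<Sum>j. ennreal (\<psi> (R ^ j) / \<phi> (R ^ (j + n))))"
    using psi pos by (simp add: order.trans[OF zero_le_one pos] flip: ennreal_mult)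
  also have "\<dots> = ennreal (1 + (\<Sum>k. \<psi> (R ^ k) / \<phi> (R ^ (k + n))))"
    using suminf_nonneg[OF sm term_nonneg] suminf_ennreal2[OF term_nonneg sm]
    by (simp add: ennreal_plus)
  finally show ?thesis by (simp add: Z_def)
qed

text \<open>Convexity turns the moment bound \<open>S\<close> into \<open>1 / 2\<close> when the
  argument is divided by \<open>2 * S\<close>. The target is \<open>1 / 2\<close> because an
  increment will be bounded by two such terms, one per endpoint; \<open>b\<close> is uniform in
  \<open>q\<close> and \<open>G\<close>.\<close>

lemma young_moment_scale:
  assumes Y: "young_function \<phi>" "young_function \<psi>" "\<phi> 1 = 1" "\<psi> 1 = 1" and R: "1 < R"
    and sm: "summable (\<lambda>k. \<psi> (R ^ k) / \<phi> (R ^ (k + n)))"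
  shows "\<exists>b>0. \<forall>(q :: 'w pmf) G. (\<forall>\<omega>\<in>set_pmf q. 0 < G \<omega>) \<longrightarrow>
    (\<forall>x\<ge>0. measure_pmf.prob q {\<omega>. G \<omega> \<le> x} \<le> x) \<longrightarrow>
    (\<integral>\<^sup>+\<omega>. ennreal (\<psi> (b * enn2real (young_rec \<phi> (G \<omega>)))) \<partial>q) \<le> ennreal (1 / 2)"
proof -
  define S where "S = 1 + (\<Sum>k. \<psi> (R ^ k) / \<phi> (R ^ (k + n)))"
  have "0 \<le> \<psi> (R ^ k) / \<phi> (R ^ (k + n))" for k
    using R young_nonneg[OF Y(1)] young_nonneg[OF Y(2)] by simp
  then have S: "1 \<le> S" using suminf_nonneg[OF sm] by (simp add: S_def)
  define b where "b = 1 / (2 * S) / R ^ Suc n"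
  have b: "b > 0" using S R by (simp add: b_def)
  have "(\<integral>\<^sup>+\<omega>. ennreal (\<psi> (b * enn2real (young_rec \<phi> (G \<omega>)))) \<partial>q) \<le> ennreal (1 / 2)"
    if "\<forall>\<omega>\<in>set_pmf q. 0 < G \<omega>" "\<forall>x\<ge>0. measure_pmf.prob q {\<omega>. G \<omega> \<le> x} \<le> x" for q :: "'w pmf" and G
  proof -
    define Z where "Z \<omega> = enn2real (young_rec \<phi> (G \<omega>)) / R ^ Suc n" for \<omega>
    have Z: "0 \<le> Z \<omega>" for \<omega> using R by (simp add: Z_def)
    have "\<psi> (b * enn2real (young_rec \<phi> (G \<omega>))) \<le> 1 / (2 * S) * \<psi> (Z \<omega>)" for \<omega>
      using young_scale[OF Y(2), of "1 / (2 * S)" "Z \<omega>"] S Z by (simp add: b_def Z_def)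
    then have "(\<integral>\<^sup>+\<omega>. ennreal (\<psi> (b * enn2real (young_rec \<phi> (G \<omega>)))) \<partial>q)
        \<le> (\<integral>\<^sup>+\<omega>. ennreal (1 / (2 * S) * \<psi> (Z \<omega>)) \<partial>q)"
      by (intro nn_integral_mono ennreal_leI)
    also have "\<dots> = ennreal (1 / (2 * S)) * (\<integral>\<^sup>+\<omega>. ennreal (\<psi> (Z \<omega>)) \<partial>q)"
      using S by (subst nn_integral_cmult[symmetric]) (simp_all add: ennreal_mult'[symmetric])
    also have "\<dots> \<le> ennreal (1 / (2 * S)) * ennreal S"
      unfolding Z_def S_def
      using that by (intro mult_left_mono young_moment_le[OF Y R sm]) auto
    also have "\<dots> = ennreal (1 / 2)" using S by (simp flip: ennreal_mult)
    finally show ?thesis .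
  qed
  with b show ?thesis by blast
qed

section \<open>The hump of a single pair\<close>

text \<open>
  The factor \<open>2\<close> ensures that \<open>cball s (2 * dist u s)\<close> contains \<open>cball u (dist u s)\<close>. Hence the increments
  at \<open>u\<close> are controlled by \<open>\<mu> (cball u (dist u s))\<close>, which is the distribution function of \<open>dist u s\<close>
  evaluated at that random variable when \<open>s\<close> has law \<open>\<mu>\<close>.
\<close>

definition hump ::
    "(real \<Rightarrow> real) \<Rightarrow> ('a::metric_space set \<Rightarrow> real) \<Rightarrow> 'a \<Rightarrow> real \<Rightarrow> 'a \<Rightarrow> real" where
  "hump \<phi> \<mu> s D u = enn2real (\<integral>\<^sup>+\<epsilon>\<in>{2 * dist u s..D}. young_rec \<phi> (\<mu> (cball s \<epsilon>)) \<partial>lborel)"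

lemma hump_eq_0:
  assumes "D \<le> 2 * dist u s"
  shows "hump \<phi> \<mu> s D u = 0"
proof -
  have "AE \<epsilon> in lborel. young_rec \<phi> (\<mu> (cball s \<epsilon>)) * indicator {2 * dist u s..D} \<epsilon> = 0"
    using AE_lborel_singleton[of D] by eventually_elim (use assms in \<open>auto simp: indicator_def\<close>)
  from nn_integral_cong_AE[OF this] show ?thesis by (simp add: hump_def)
qed

text \<open>The atom at \<open>s\<close> bounds the integrand by a finite constant, so
  \<open>enn2real\<close> in \<open>hump\<close> loses nothing.\<close>

lemma hump_integral_finite:
  fixes \<delta> D :: real
  assumes Y: "young_function \<phi>" and mu: "prob_charge T \<mu>" "0 < \<mu> {s}" and "0 \<le> \<delta>"
  shows "(\<integral>\<^sup>+\<epsilon>\<in>{\<delta>..D}. young_rec \<phi> (\<mu> (cball s \<epsilon>)) \<partial>lborel) < \<infinity>"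
proof -
  have "(\<integral>\<^sup>+\<epsilon>\<in>{\<delta>..D}. young_rec \<phi> (\<mu> (cball s \<epsilon>)) \<partial>lborel)
      \<le> (\<integral>\<^sup>+\<epsilon>. young_rec \<phi> (\<mu> {s}) * indicator {\<delta>..D} \<epsilon> \<partial>lborel)"
    using assms(4)
    by (intro nn_integral_mono)
       (auto simp: indicator_def intro!: young_rec_antimono[OF Y] prob_charge_nonneg[OF mu(1)] prob_charge_mono[OF mu(1)])
  also have "\<dots> = young_rec \<phi> (\<mu> {s}) * emeasure lborel {\<delta>..D}"
    by (rule nn_integral_cmult_indicator) simp
  also have "\<dots> < \<infinity>"
    using young_rec_finite[OF Y mu(2)] by (simp add: ennreal_mult_less_top emeasure_lborel_Icc_eq)
  finally show ?thesis .
qed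

text \<open>The domain of integration for \<open>u\<close> exceeds that for \<open>v\<close> by at
  most an interval of length \<open>2 * (dist v s - dist u s)\<close>. There the radius is at least
  \<open>2 * dist u s\<close>, so the integrand is bounded by its value for the ball around
  \<open>u\<close>.\<close>

lemma hump_le:
  assumes Y: "young_function \<phi>" and mu: "prob_charge T \<mu>" "0 < \<mu> {s}" and uv: "dist u s \<le> dist v s"
  shows "hump \<phi> \<mu> s D v \<le> hump \<phi> \<mu> s D u"
    and "hump \<phi> \<mu> s D u \<le> hump \<phi> \<mu> s D v + 2 * dist u v * enn2real (young_rec \<phi> (\<mu> (cball u (dist u s))))"
proof -
  have [measurable]: "(\<lambda>\<epsilon>. young_rec \<phi> (\<mu> (cball s \<epsilon>))) \<in> borel_measurable borel"
    by (rule young_rec_charge_measurable[OF Y mu(1)])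
  define I where "I x = (\<integral>\<^sup>+\<epsilon>\<in>{2 * x..D}. young_rec \<phi> (\<mu> (cball s \<epsilon>)) \<partial>lborel)" for x
  have fin: "I x < \<infinity>" if "0 \<le> x" for x
    unfolding I_def using that by (intro hump_integral_finite[OF Y mu]) auto
  have I: "I (dist u s) < \<infinity>" "I (dist v s) < \<infinity>" by (rule fin, simp)+
  have hump_I: "hump \<phi> \<mu> s D w = enn2real (I (dist w s))" for w by (simp add: hump_def I_def)
  have "I (dist v s) \<le> I (dist u s)"
    unfolding I_def using uv by (intro nn_integral_mono) (auto simp: indicator_def)
  then show "hump \<phi> \<mu> s D v \<le> hump \<phi> \<mu> s D u"
    unfolding hump_I using I by (intro enn2real_mono) auto
  define g where "g = young_rec \<phi> (\<mu> (cball u (dist u s)))"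
  have "\<mu> {s} \<le> \<mu> (cball u (dist u s))" by (intro prob_charge_mono[OF mu(1)]) auto
  then have "g < \<infinity>" unfolding g_def using mu(2) by (intro young_rec_finite[OF Y]) auto
  then have g: "g = ennreal (enn2real g)" by (simp add: less_top)
  have rec: "young_rec \<phi> (\<mu> (cball s \<epsilon>)) \<le> g" if "2 * dist u s \<le> \<epsilon>" for \<epsilon>
  proof -
    have "cball u (dist u s) \<subseteq> cball s \<epsilon>"
    proof
      fix x assume "x \<in> cball u (dist u s)"
      then show "x \<in> cball s \<epsilon>"
        using dist_triangle[of s x u] that by (simp add: dist_commute)
    qed
    then show ?thesis unfolding g_def
      by (intro young_rec_antimono[OF Y] prob_charge_nonneg[OF mu(1)] prob_charge_mono[OF mu(1)])
  qed
  have "I (dist u s) \<le> (\<integral>\<^sup>+\<epsilon>. young_rec \<phi> (\<mu> (cball s \<epsilon>)) * indicator {2 * dist v s..D} \<epsilon>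
        + g * indicator {2 * dist u s..2 * dist v s} \<epsilon> \<partial>lborel)"
    unfolding I_def using rec by (intro nn_integral_mono) (auto simp: indicator_def)
  also have "\<dots> = I (dist v s) + g * emeasure lborel {2 * dist u s..2 * dist v s}"
    unfolding I_def by (subst nn_integral_add) (auto simp: nn_integral_cmult_indicator)
  also have "\<dots> = ennreal (hump \<phi> \<mu> s D v + 2 * (dist v s - dist u s) * enn2real g)"
    using uv I by (subst g) (simp add: hump_I emeasure_lborel_Icc_eq ennreal_plus mult.commute flip: ennreal_mult)
  finally have "hump \<phi> \<mu> s D u \<le> hump \<phi> \<mu> s D v + 2 * (dist v s - dist u s) * enn2real g"
    using uv by (simp add: hump_I enn2real_leI)
  also have "2 * (dist v s - dist u s) * enn2real g \<le> 2 * dist u v * enn2real g"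
    using dist_triangle[of v s u] by (intro mult_right_mono mult_left_mono) (auto simp: dist_commute)
  finally show "hump \<phi> \<mu> s D u \<le> hump \<phi> \<mu> s D v + 2 * dist u v * enn2real (young_rec \<phi> (\<mu> (cball u (dist u s))))"
    by (simp add: g_def)
qed

lemma hump_diff_le:
  assumes Y: "young_function \<phi>" and mu: "prob_charge T \<mu>" "0 < \<mu> {s}"
  shows "\<bar>hump \<phi> \<mu> s D u - hump \<phi> \<mu> s D v\<bar> \<le> 2 * dist u v *
    max (enn2real (young_rec \<phi> (\<mu> (cball u (dist u s))))) (enn2real (young_rec \<phi> (\<mu> (cball v (dist v s)))))"
    (is "_ \<le> 2 * dist u v * max ?a ?b")
proof -
  have "2 * dist u v * ?a \<le> 2 * dist u v * max ?a ?b" "2 * dist u v * ?b \<le> 2 * dist u v * max ?a ?b"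
    by (intro mult_left_mono; simp)+
  then show ?thesis
    using hump_le[OF Y mu, of u v D] hump_le[OF Y mu, of v u D]
    by (cases "dist u s \<le> dist v s") (auto simp: dist_commute abs_le_iff)
qed

text \<open>A crude constant depending on the size of the atom. It serves only for continuity and
  for \<open>lipschitz_imp_dominated\<close>.\<close>

lemma hump_lipschitz:
  assumes Y: "young_function \<phi>" and mu: "prob_charge T \<mu>" "0 < \<mu> {s}"
  shows "\<bar>hump \<phi> \<mu> s D u - hump \<phi> \<mu> s D v\<bar> \<le> 2 * enn2real (young_rec \<phi> (\<mu> {s})) * dist u v"
proof -
  have "enn2real (young_rec \<phi> (\<mu> (cball w (dist w s)))) \<le> enn2real (young_rec \<phi> (\<mu> {s}))" for w
    using young_rec_finite[OF Y mu(2)]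
    by (intro enn2real_mono young_rec_antimono[OF Y] prob_charge_nonneg[OF mu(1)] prob_charge_mono[OF mu(1)]) auto
  then have "2 * dist u v *
      max (enn2real (young_rec \<phi> (\<mu> (cball u (dist u s))))) (enn2real (young_rec \<phi> (\<mu> (cball v (dist v s)))))
    \<le> 2 * dist u v * enn2real (young_rec \<phi> (\<mu> {s}))"
    by (intro mult_left_mono) auto
  then show ?thesis using hump_diff_le[OF Y mu, of D u v] by (simp add: mult_ac)
qed

text \<open>Up to radius \<open>D\<close> half of \<open>\<mu>\<close> controls the integrand at the
  cost of a factor \<open>2\<close>. For larger radii in the domain of integration the ball contains
  \<open>s\<^sub>0\<close>, so the integrand is at most \<open>2\<close>.\<close>

lemma ball_integral_dirac_mix_le:
  assumes Y: "young_function \<phi>" "\<phi> 1 = 1" and mu: "prob_charge T \<mu>" "0 < \<mu> {s}" and s0: "s\<^sub>0 \<in> T"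
    and L: "\<bar>dist s s\<^sub>0 - dist t s\<^sub>0\<bar> \<le> L" and D: "D = min (dist s t) (dist s s\<^sub>0)"
  shows "ball_integral \<phi> (\<lambda>A. (indicator A s\<^sub>0 + \<mu> A) / 2) s (dist s t) \<le> ennreal (10 * hump \<phi> \<mu> s D s + 4 * L)"
proof -
  define \<nu> where "\<nu> A = (indicator A s\<^sub>0 + \<mu> A) / 2" for A
  have nu: "prob_charge T \<nu>"
    unfolding \<nu>_def by (intro prob_charge_midpoint prob_charge_dirac s0 mu)
  define J where "J = hump \<phi> \<mu> s D s"
  define d where "d = dist s t"
  have [measurable]: "(\<lambda>\<epsilon>. young_rec \<phi> (\<mu> (cball s \<epsilon>))) \<in> borel_measurable borel"
    by (rule young_rec_charge_measurable[OF Y(1) mu(1)])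
  have D0: "0 \<le> D" "0 \<le> d" by (auto simp: D d_def)
  have J: "ball_integral \<phi> \<mu> s D = ennreal J" "0 \<le> J"
    using hump_integral_finite[OF Y(1) mu, of 0 D] by (auto simp: ball_integral_def J_def hump_def less_top)
  have pt: "young_rec \<phi> (\<nu> (cball s \<epsilon>)) * indicator {0..d} \<epsilon>
      \<le> 2 * (young_rec \<phi> (\<mu> (cball s \<epsilon>)) * indicator {0..D} \<epsilon>) + 2 * indicator {0..d} \<epsilon>" for \<epsilon>
  proof (cases "\<epsilon> \<in> {0..d}")
    case True
    show ?thesis
    proof (cases "\<epsilon> \<le> D")
      case le: True
      have "young_rec \<phi> (\<nu> (cball s \<epsilon>)) \<le> young_rec \<phi> (\<mu> (cball s \<epsilon>) / 2)"
        using prob_charge_nonneg[OF mu(1)] by (intro young_rec_antimono[OF Y(1)]) (auto simp: \<nu>_def)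
      also have "\<dots> \<le> ennreal 2 * young_rec \<phi> (2 * (\<mu> (cball s \<epsilon>) / 2))"
        using prob_charge_nonneg[OF mu(1)] by (intro young_rec_scale[OF Y(1)]) auto
      finally show ?thesis using True le by (simp add: add_increasing2)
    next
      case False
      then have "s\<^sub>0 \<in> cball s \<epsilon>" using True by (auto simp: D d_def)
      then have "young_rec \<phi> (\<nu> (cball s \<epsilon>)) \<le> young_rec \<phi> (1 / 2)"
        using prob_charge_nonneg[OF mu(1)] by (intro young_rec_antimono[OF Y(1)]) (auto simp: \<nu>_def)
      also have "\<dots> \<le> ennreal 2 * young_rec \<phi> (2 * (1 / 2))"
        by (intro young_rec_scale[OF Y(1)]) auto
      finally show ?thesis using True young_rec_1[OF Y] by (simp add: add_increasing)
    qed
  qed simp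
  have "ball_integral \<phi> \<nu> s d \<le> (\<integral>\<^sup>+\<epsilon>. 2 * (young_rec \<phi> (\<mu> (cball s \<epsilon>)) * indicator {0..D} \<epsilon>)
      + 2 * indicator {0..d} \<epsilon> \<partial>lborel)"
    unfolding ball_integral_def by (intro nn_integral_mono pt)
  also have "\<dots> = 2 * ball_integral \<phi> \<mu> s D + 2 * emeasure lborel {0..d}"
    unfolding ball_integral_def
    by (subst nn_integral_add) (auto simp: nn_integral_cmult nn_integral_cmult_indicator)
  also have "\<dots> = ennreal (2 * J + 2 * d)"
    using J D0 by (simp add: emeasure_lborel_Icc_eq ennreal_plus ennreal_mult)
  \<comment> \<open>If \<open>d \<le> 4 * D\<close>, then \<open>D \<le> J\<close> suffices.
    Otherwise \<open>D\<close> is the distance from \<open>s\<close> to \<open>s\<^sub>0\<close> and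
    less than \<open>d / 4\<close>, so the distances of \<open>s\<close> and \<open>t\<close> to
    \<open>s\<^sub>0\<close> differ by more than \<open>d / 2\<close>, which bounds \<open>d\<close>
    by \<open>2 * L\<close>.\<close>
  also have "2 * d \<le> 8 * J + 4 * L"
  proof (cases "d \<le> 4 * D")
    case True
    have "ennreal D = (\<integral>\<^sup>+\<epsilon>. 1 * indicator {0..D} \<epsilon> \<partial>lborel)"
      using D0 by (simp add: emeasure_lborel_Icc_eq)
    also have "\<dots> \<le> ball_integral \<phi> \<mu> s D"
      unfolding ball_integral_def
      by (intro nn_integral_mono mult_right_mono young_rec_ge_1[OF Y] prob_charge_nonneg[OF mu(1)]
          prob_charge_le_1[OF mu(1)]) auto
    finally have "D \<le> J" using J by simp
    moreover have "0 \<le> L" using L by linarith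
    ultimately show ?thesis using True by simp
  next
    case False
    then have "d > 4 * dist s s\<^sub>0" by (auto simp: D d_def min_def split: if_splits)
    moreover have "d \<le> dist s s\<^sub>0 + dist t s\<^sub>0" unfolding d_def by (metis dist_triangle2)
    ultimately show ?thesis using L J by linarith
  qed
  then have "ennreal (2 * J + 2 * d) \<le> ennreal (10 * J + 4 * L)" by (intro ennreal_leI) simp
  finally show ?thesis by (simp add: \<nu>_def[abs_def] d_def J_def)
qed

section \<open>Families of humps near an infeasible point\<close>

text \<open>The interface between the construction of one random hump and the gliding hump argument:
  \<open>r\<close> governs the support and \<open>\<kappa>\<close> the size of the jump relative to
  \<open>\<rho>\<close>. The constant \<open>C\<close> may be arbitrarily large, as it is fixed
  before the next family is chosen.\<close>

definition hump_family ::
    "(real \<Rightarrow> real) \<Rightarrow> 'a::metric_space set \<Rightarrow> ('a \<Rightarrow> 'a \<Rightarrow> real) \<Rightarrow> 'a \<Rightarrow> real \<Rightarrow> real \<Rightarrow>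
      ('a \<times> 'a) pmf \<Rightarrow> ('a \<times> 'a \<Rightarrow> 'a \<Rightarrow> real) \<Rightarrow> bool" where
  "hump_family \<psi> T \<rho> s\<^sub>0 r \<kappa> q Y \<longleftrightarrow> finite (set_pmf q) \<and> set_pmf q \<subseteq> (T - {s\<^sub>0}) \<times> T \<and>
    (\<exists>C\<ge>0. \<forall>\<omega>\<in>set_pmf q. \<forall>u v. \<bar>Y \<omega> u - Y \<omega> v\<bar> \<le> C * dist u v) \<and>
    (\<forall>\<omega>\<in>set_pmf q. \<forall>u. u = s\<^sub>0 \<or> 2 * r \<le> dist u s\<^sub>0 \<longrightarrow> Y \<omega> u = 0) \<and>
    (\<forall>u v. (\<integral>\<^sup>+\<omega>. ennreal (\<psi> (\<bar>Y \<omega> u - Y \<omega> v\<bar> / dist u v)) \<partial>q) \<le> 1) \<and>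
    measure_pmf.prob q {\<omega>. \<kappa> * \<rho> (fst \<omega>) (snd \<omega>) < Y \<omega> (fst \<omega>) - Y \<omega> (snd \<omega>)} \<ge> 1 / 4"

text \<open>For a pair on which the mixed charge violates its bound,
  \<open>ball_integral_dirac_mix_le\<close> forces the hump to be high at the first point, while it
  vanishes at the second. Hardness of \<open>q\<close> makes such pairs have probability at least
  \<open>1 / 4\<close>.\<close>

lemma exists_hump_family:
  fixes T :: "'a::metric_space set"
  assumes Y: "young_function \<phi>" "young_function \<psi>" "\<phi> 1 = 1"
    and b: "0 < b" "\<And>(q :: ('a \<times> 'a) pmf) G. \<forall>\<omega>\<in>set_pmf q. 0 < G \<omega> \<Longrightarrow>
      \<forall>x\<ge>0. measure_pmf.prob q {\<omega>. G \<omega> \<le> x} \<le> x \<Longrightarrow>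
      (\<integral>\<^sup>+\<omega>. ennreal (\<psi> (b * enn2real (young_rec \<phi> (G \<omega>)))) \<partial>q) \<le> ennreal (1 / 2)"
    and rho: "\<And>s t. 0 \<le> \<rho> s t" and s0: "s\<^sub>0 \<in> T" and kappa: "0 \<le> \<kappa>"
    and L: "0 \<le> L" "\<And>s t. s \<in> T \<Longrightarrow> t \<in> T \<Longrightarrow> \<bar>dist s s\<^sub>0 - dist t s\<^sub>0\<bar> \<le> L * \<rho> s t"
    and infeas: "\<And>K. 0 \<le> K \<Longrightarrow> \<exists>F. finite F \<and> F \<subseteq> (T \<inter> ball s\<^sub>0 r - {s\<^sub>0}) \<times> T \<and>
      \<not> (\<exists>\<nu>. prob_charge T \<nu> \<and> (\<forall>(s, t)\<in>F. ball_integral \<phi> \<nu> s (dist s t) \<le> ennreal (K * \<rho> s t)))"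
  shows "\<exists>q Y. hump_family \<psi> T \<rho> s\<^sub>0 r \<kappa> q Y"
proof -
  \<comment> \<open>Halving \<open>b\<close> compensates the factor \<open>2\<close> in
    \<open>hump_diff_le\<close>.\<close>
  define b' where "b' = b / 2"
  have b': "0 < b'" using b by (simp add: b'_def)
  \<comment> \<open>Chosen so that \<open>K / 4 = 10 * (\<kappa> / b') + 4 * L\<close>, the bound of
    \<open>ball_integral_dirac_mix_le\<close> per unit of \<open>\<rho>\<close> for a hump of height
    \<open>\<kappa> / b'\<close> times \<open>\<rho>\<close>.\<close>
  define K where "K = 40 * \<kappa> / b' + 16 * L"
  have K: "0 \<le> K" using b' kappa L by (simp add: K_def)
  obtain F where F: "finite F" "F \<subseteq> (T \<inter> ball s\<^sub>0 r - {s\<^sub>0}) \<times> T"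
    and notfeas: "\<not> (\<exists>\<nu>. prob_charge T \<nu> \<and> (\<forall>(s, t)\<in>F. ball_integral \<phi> \<nu> s (dist s t) \<le> ennreal (K * \<rho> s t)))"
    using infeas[OF K] by (elim exE conjE) (rule that)
  have "T \<noteq> {}" using s0 by auto
  obtain q where q: "set_pmf q \<subseteq> F" and hard: "\<forall>\<nu>. prob_charge T \<nu> \<longrightarrow>
      measure_pmf.prob q {(s, t). ball_integral \<phi> \<nu> s (dist s t) \<le> ennreal (K / 4 * \<rho> s t)} < 3 / 4"
    using infeasible_imp_hard_distribution[OF Y(1) \<open>T \<noteq> {}\<close> F(1) K rho notfeas] by (elim exE conjE) (rule that)
  have fin: "finite (set_pmf q)" using q F(1) finite_subset by auto
  have qT: "fst \<omega> \<in> T" "snd \<omega> \<in> T" "fst \<omega> \<noteq> s\<^sub>0" "dist (fst \<omega>) s\<^sub>0 < r" if "\<omega> \<in> set_pmf q" for \<omega>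
    using that q F(2) by (auto simp: dist_commute)
  define \<mu> where "\<mu> A = measure_pmf.prob q (fst -` A)" for A
  have mu: "prob_charge T \<mu>" unfolding \<mu>_def using qT by (intro prob_charge_pmf) auto
  have atom: "0 < \<mu> {fst \<omega>}" if "\<omega> \<in> set_pmf q" for \<omega>
  proof -
    have "0 < measure_pmf.prob q {\<omega>}" using that by (simp add: measure_pmf_single pmf_positive)
    also have "\<dots> \<le> \<mu> {fst \<omega>}" unfolding \<mu>_def by (intro measure_pmf.finite_measure_mono) auto
    finally show ?thesis .
  qed
  define D where "D \<omega> = min (dist (fst \<omega>) (snd \<omega>)) (dist (fst \<omega>) s\<^sub>0)" for \<omega>
  define H where "H \<omega> = hump \<phi> \<mu> (fst \<omega>) (D \<omega>)" for \<omega>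
  define g where "g u \<omega> = enn2real (young_rec \<phi> (\<mu> (cball u (dist u (fst \<omega>)))))" for u and \<omega> :: "'a \<times> 'a"
  define C where "C = b' * (2 * (\<Sum>\<omega>\<in>set_pmf q. enn2real (young_rec \<phi> (\<mu> {fst \<omega>}))))"
  have lip: "\<bar>b' * H \<omega> u - b' * H \<omega> v\<bar> \<le> C * dist u v" if w: "\<omega> \<in> set_pmf q" for \<omega> u v
  proof -
    have "\<bar>H \<omega> u - H \<omega> v\<bar> \<le> 2 * enn2real (young_rec \<phi> (\<mu> {fst \<omega>})) * dist u v"
      unfolding H_def by (rule hump_lipschitz[OF Y(1) mu atom[OF w]])
    also have "\<dots> \<le> 2 * (\<Sum>\<omega>\<in>set_pmf q. enn2real (young_rec \<phi> (\<mu> {fst \<omega>}))) * dist u v"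
      using fin w by (intro mult_right_mono mult_left_mono member_le_sum) auto
    finally have "b' * \<bar>H \<omega> u - H \<omega> v\<bar> \<le> C * dist u v"
      using b' by (simp add: C_def mult.assoc)
    then show ?thesis using b' by (simp add: abs_mult flip: right_diff_distrib)
  qed
  have zero: "H \<omega> u = 0" if w: "\<omega> \<in> set_pmf q" and u: "u = s\<^sub>0 \<or> u = snd \<omega> \<or> 2 * r \<le> dist u s\<^sub>0" for \<omega> u
    unfolding H_def
  proof (rule hump_eq_0)
    \<comment> \<open>Such a \<open>u\<close> is further than \<open>r\<close> from the centre of
      the hump, whereas the centre is within \<open>r\<close> of \<open>s\<^sub>0\<close>.\<close>
    have "dist (fst \<omega>) s\<^sub>0 \<le> 2 * dist u (fst \<omega>)" if "2 * r \<le> dist u s\<^sub>0"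
      using that qT(4)[OF w] dist_triangle[of u s\<^sub>0 "fst \<omega>"] zero_le_dist[of "fst \<omega>" s\<^sub>0] by linarith
    then show "D \<omega> \<le> 2 * dist u (fst \<omega>)"
      using u by (auto simp: D_def dist_commute min_le_iff_disj)
  qed
  have half: "(\<integral>\<^sup>+\<omega>. ennreal (\<psi> (b * g u \<omega>)) \<partial>q) \<le> ennreal (1 / 2)" for u
    unfolding g_def
  proof (rule b(2))
    show "\<forall>\<omega>\<in>set_pmf q. 0 < \<mu> (cball u (dist u (fst \<omega>)))"
    proof
      fix \<omega> assume "\<omega> \<in> set_pmf q"
      then have "0 < \<mu> {fst \<omega>}" by (rule atom)
      also have "\<dots> \<le> \<mu> (cball u (dist u (fst \<omega>)))" by (intro prob_charge_mono[OF mu]) auto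
      finally show "0 < \<mu> (cball u (dist u (fst \<omega>)))" .
    qed
    show "\<forall>x\<ge>0. measure_pmf.prob q {\<omega>. \<mu> (cball u (dist u (fst \<omega>))) \<le> x} \<le> x"
      using pmf_cdf_le[OF fin, of _ "\<lambda>\<omega>. dist u (fst \<omega>)"]
      by (simp add: \<mu>_def vimage_def)
  qed
  have incr: "(\<integral>\<^sup>+\<omega>. ennreal (\<psi> (\<bar>b' * H \<omega> u - b' * H \<omega> v\<bar> / dist u v)) \<partial>q) \<le> 1" for u v
  proof -
    have le: "\<psi> (\<bar>b' * H \<omega> u - b' * H \<omega> v\<bar> / dist u v) \<le> \<psi> (b * g u \<omega>) + \<psi> (b * g v \<omega>)"
      if w: "\<omega> \<in> set_pmf q" for \<omega>
    proof -
      have g0: "0 \<le> g x \<omega>" for x by (simp add: g_def)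
      have psi0: "0 \<le> \<psi> (b * g x \<omega>)" for x using b(1) g0 by (intro young_nonneg[OF Y(2)]) simp
      have "\<bar>H \<omega> u - H \<omega> v\<bar> \<le> 2 * dist u v * max (g u \<omega>) (g v \<omega>)"
        unfolding H_def g_def by (rule hump_diff_le[OF Y(1) mu atom[OF w]])
      then have "b' * \<bar>H \<omega> u - H \<omega> v\<bar> \<le> b' * (2 * dist u v * max (g u \<omega>) (g v \<omega>))"
        using b' by (intro mult_left_mono) auto
      also have "\<dots> = b * max (g u \<omega>) (g v \<omega>) * dist u v" by (simp add: b'_def)
      finally have "\<bar>b' * H \<omega> u - b' * H \<omega> v\<bar> \<le> b * max (g u \<omega>) (g v \<omega>) * dist u v"
        using b' by (simp add: abs_mult flip: right_diff_distrib)
      then have "\<bar>b' * H \<omega> u - b' * H \<omega> v\<bar> / dist u v \<le> b * max (g u \<omega>) (g v \<omega>)"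
        using b(1) g0[of u] by (cases "u = v") (auto simp: pos_divide_le_eq le_max_iff_disj)
      then have "\<psi> (\<bar>b' * H \<omega> u - b' * H \<omega> v\<bar> / dist u v) \<le> \<psi> (b * max (g u \<omega>) (g v \<omega>))"
        by (intro young_mono[OF Y(2)]) auto
      also have "\<dots> \<le> \<psi> (b * g u \<omega>) + \<psi> (b * g v \<omega>)"
        using psi0[of u] psi0[of v] by (auto simp: max_def)
      finally show ?thesis .
    qed
    have "(\<integral>\<^sup>+\<omega>. ennreal (\<psi> (\<bar>b' * H \<omega> u - b' * H \<omega> v\<bar> / dist u v)) \<partial>q)
        \<le> (\<integral>\<^sup>+\<omega>. ennreal (\<psi> (b * g u \<omega>)) + ennreal (\<psi> (b * g v \<omega>)) \<partial>q)"
    proof (intro nn_integral_mono_AE AE_pmfI)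
      fix \<omega> assume w: "\<omega> \<in> set_pmf q"
      have "0 \<le> \<psi> (b * g x \<omega>)" for x using b(1) by (intro young_nonneg[OF Y(2)]) (simp add: g_def)
      then show "ennreal (\<psi> (\<bar>b' * H \<omega> u - b' * H \<omega> v\<bar> / dist u v)) \<le> ennreal (\<psi> (b * g u \<omega>)) + ennreal (\<psi> (b * g v \<omega>))"
        using le[OF w] by (simp add: ennreal_leI flip: ennreal_plus)
    qed
    also have "\<dots> \<le> ennreal (1 / 2) + ennreal (1 / 2)"
      using add_mono[OF half[of u] half[of v]] by (subst nn_integral_add) auto
    also have "\<dots> = ennreal (1 / 2 + 1 / 2)" by (rule ennreal_plus[symmetric]) auto
    also have "\<dots> = 1" by simp
    finally show ?thesis .
  qed
  define \<nu> where "\<nu> A = (indicator A s\<^sub>0 + \<mu> A) / 2" for A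
  have nu: "prob_charge T \<nu>"
    unfolding \<nu>_def by (intro prob_charge_midpoint prob_charge_dirac s0 mu)
  let ?bad = "{\<omega>. ball_integral \<phi> \<nu> (fst \<omega>) (dist (fst \<omega>) (snd \<omega>)) \<le> ennreal (K / 4 * \<rho> (fst \<omega>) (snd \<omega>))}"
  let ?good = "{\<omega>. \<kappa> * \<rho> (fst \<omega>) (snd \<omega>) < b' * H \<omega> (fst \<omega>) - b' * H \<omega> (snd \<omega>)}"
  have sub: "\<omega> \<in> ?bad \<or> \<omega> \<in> ?good" if w: "\<omega> \<in> set_pmf q" for \<omega>
  proof (rule ccontr)
    assume "\<not> ?thesis"
    then have n: "\<omega> \<notin> ?bad" "\<omega> \<notin> ?good" by auto
    define r0 where "r0 = \<rho> (fst \<omega>) (snd \<omega>)"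
    have "b' * H \<omega> (fst \<omega>) \<le> \<kappa> * r0" using n(2) zero[OF w, of "snd \<omega>"] by (simp add: r0_def)
    then have "H \<omega> (fst \<omega>) \<le> \<kappa> / b' * r0" using b' by (simp add: field_simps)
    then have "10 * H \<omega> (fst \<omega>) + 4 * (L * r0) \<le> 10 * (\<kappa> / b' * r0) + 4 * (L * r0)" by simp
    also have "\<dots> = K / 4 * r0" by (simp add: K_def algebra_simps)
    finally have "10 * H \<omega> (fst \<omega>) + 4 * (L * r0) \<le> K / 4 * r0" .
    moreover have "ball_integral \<phi> \<nu> (fst \<omega>) (dist (fst \<omega>) (snd \<omega>))
        \<le> ennreal (10 * H \<omega> (fst \<omega>) + 4 * (L * r0))"
      unfolding \<nu>_def H_def r0_def
      by (intro ball_integral_dirac_mix_le[OF Y(1,3) mu atom[OF w] s0] L(2) qT[OF w] D_def)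
    ultimately have "ball_integral \<phi> \<nu> (fst \<omega>) (dist (fst \<omega>) (snd \<omega>)) \<le> ennreal (K / 4 * r0)"
      using order_trans[OF _ ennreal_leI] by blast
    then have "\<omega> \<in> ?bad" by (simp add: r0_def)
    then show False using n by simp
  qed
  have "1 = measure_pmf.prob q (?bad \<union> ?good)"
    using sub by (intro measure_pmf.prob_eq_1[THEN iffD2, symmetric]) (auto intro!: AE_pmfI)
  also have "\<dots> \<le> measure_pmf.prob q ?bad + measure_pmf.prob q ?good"
    by (intro measure_Un_le) auto
  also have "measure_pmf.prob q ?bad < 3 / 4" using hard[rule_format, OF nu] by (simp add: case_prod_unfold)
  finally have "measure_pmf.prob q ?good \<ge> 1 / 4" by simp
  moreover have "0 \<le> C" using b' by (simp add: C_def sum_nonneg)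
  moreover have "set_pmf q \<subseteq> (T - {s\<^sub>0}) \<times> T" using q F by auto
  ultimately show ?thesis
    using fin lip zero incr unfolding hump_family_def
    by (intro exI[of _ q] exI[of _ "\<lambda>\<omega> u. b' * H \<omega> u"] conjI exI[of _ C]) auto
qed

section \<open>Consequences of domination\<close>

text \<open>Transfer to path space, with the largest \<open>\<sigma>\<close>-algebra that makes the path map measurable.\<close>

lemma increments_as_dominatedD:
  fixes T :: "'a::metric_space set" and X :: "'a \<Rightarrow> 'w \<Rightarrow> real"
  assumes dom: "increments_as_dominated \<psi> T \<rho>" and Y: "young_function \<psi>"
    and M: "prob_space M" and X: "\<And>t. t \<in> T \<Longrightarrow> X t \<in> borel_measurable M"
    and D: "countable D" "D \<subseteq> T"
    and sep: "\<And>\<omega> t. \<omega> \<in> space M \<Longrightarrow> t \<in> T \<Longrightarrow>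
      \<exists>u. (\<forall>n::nat. u n \<in> D) \<and> u \<longlonglongrightarrow> t \<and> (\<lambda>n. X (u n) \<omega>) \<longlonglongrightarrow> X t \<omega>"
    and incr: "\<And>s t. s \<in> T \<Longrightarrow> t \<in> T \<Longrightarrow> (\<integral>\<^sup>+\<omega>. ennreal (\<psi> (\<bar>X s \<omega> - X t \<omega>\<bar> / dist s t)) \<partial>M) \<le> 1"
  shows "AE \<omega> in M. (SUP (s, t)\<in>T \<times> T. ennreal (\<bar>X s \<omega> - X t \<omega>\<bar> / \<rho> s t)) < \<infinity>"
proof -
  define W where "W \<omega> = (\<lambda>t. X t \<omega>)" for \<omega>
  define N where "N = sigma UNIV {A. W -` A \<inter> space M \<in> sets M}"
  have N_sets: "A \<in> sets N" if "W -` A \<inter> space M \<in> sets M" for A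
    using that by (auto simp: N_def)
  have space_N: "space N = UNIV" by (simp add: N_def)
  have W: "W \<in> measurable M N"
    unfolding N_def by (rule measurable_measure_of) auto
  define M' where "M' = distr M N W"
  have M': "prob_space M'" unfolding M'_def by (rule prob_space.prob_space_distr[OF M W])
  define X' where "X' t g = (g t :: real)" for t :: 'a and g
  have X': "X' t \<in> borel_measurable N" if "t \<in> T" for t
  proof (rule measurableI)
    fix B :: "real set" assume "B \<in> sets borel"
    from measurable_sets[OF X[OF that] this]
    show "X' t -` B \<inter> space N \<in> sets N"
      unfolding space_N Int_UNIV_right by (intro N_sets) (simp add: X'_def W_def vimage_def)
  qed simp
  have W_eq: "X' t (W \<omega>) = X t \<omega>" for t \<omega> by (simp add: X'_def W_def)
  have "separable_process T M' X'"
    unfolding separable_process_def stochastic_process_def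
  proof (intro conjI ballI M' exI[of _ D] D)
    show "X' t \<in> borel_measurable M'" if "t \<in> T" for t using X'[OF that] by (simp add: M'_def)
    let ?P = "\<lambda>g. \<forall>t\<in>T. \<exists>u. (\<forall>n::nat. u n \<in> D) \<and> u \<longlonglongrightarrow> t \<and> (\<lambda>n. X' (u n) g) \<longlonglongrightarrow> X' t g"
    have "W -` {g. ?P g} \<inter> space M = space M" using sep by (auto simp: W_eq)
    then have "{g \<in> space N. ?P g} \<in> sets N" using N_sets by (simp add: space_N)
    then show "AE g in M'. ?P g"
      unfolding M'_def by (subst AE_distr_iff[OF W]) (auto simp: W_eq sep)
  qed
  moreover have "bounded_increments \<psi> T M' X'"
    unfolding bounded_increments_def
  proof (rule SUP_least, clarify)
    fix s t assume st: "s \<in> T" "t \<in> T"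
    \<comment> \<open>Monotonicity of \<open>\<psi>\<close> is known on nonnegative reals only; with
      \<open>max 0\<close> it holds on the whole line and gives measurability.\<close>
    define f where "f x = \<psi> (max 0 x)" for x
    have [measurable]: "f \<in> borel_measurable borel"
      unfolding f_def by (intro borel_measurable_mono monoI young_mono[OF Y]) auto
    have [measurable]: "X' s \<in> borel_measurable N" "X' t \<in> borel_measurable N" using st by (auto intro: X')
    have "(\<integral>\<^sup>+g. ennreal (\<psi> (\<bar>X' s g - X' t g\<bar> / dist s t)) \<partial>M')
        = (\<integral>\<^sup>+g. ennreal (f (\<bar>X' s g - X' t g\<bar> / dist s t)) \<partial>M')" by (simp add: f_def)
    also have "\<dots> = (\<integral>\<^sup>+\<omega>. ennreal (f (\<bar>X s \<omega> - X t \<omega>\<bar> / dist s t)) \<partial>M)"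
      unfolding M'_def by (subst nn_integral_distr[OF W]) (simp_all add: W_eq)
    also have "\<dots> \<le> 1" using incr[OF st] by (simp add: f_def)
    finally show "(\<integral>\<^sup>+g. ennreal (\<psi> (\<bar>X' s g - X' t g\<bar> / dist s t)) \<partial>M') \<le> 1" .
  qed
  ultimately have "AE g in M'. (SUP (s, t)\<in>T \<times> T. ennreal (\<bar>X' s g - X' t g\<bar> / \<rho> s t)) < \<infinity>"
    using dom unfolding increments_as_dominated_def by blast
  from AE_distrD[OF W this[unfolded M'_def]] show ?thesis by (simp add: W_eq)
qed

lemma compact_imp_countable_dense:
  fixes T :: "'a::metric_space set"
  assumes "compact T"
  obtains D where "countable D" "D \<subseteq> T" "T \<subseteq> closure D"
proof -
  have "\<exists>k. finite k \<and> k \<subseteq> T \<and> T \<subseteq> (\<Union>x\<in>k. ball x (1 / Suc n))" for n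
  proof (rule compactE_image[OF assms, of T "\<lambda>x. ball x (1 / Suc n)"])
    show "T \<subseteq> (\<Union>c\<in>T. ball c (1 / Suc n))" by force
  qed auto
  then obtain k where k: "\<And>n. finite (k n)" "\<And>n. k n \<subseteq> T" "\<And>n. T \<subseteq> (\<Union>x\<in>k n. ball x (1 / Suc n))"
    by metis
  show ?thesis
  proof (rule that[of "\<Union>n. k n"])
    show "countable (\<Union>n. k n)" using k(1) by (auto intro: countable_finite)
    show "(\<Union>n. k n) \<subseteq> T" using k(2) by auto
    show "T \<subseteq> closure (\<Union>n. k n)"
    proof (clarsimp simp: closure_approachable)
      fix x and e :: real assume "x \<in> T" "0 < e"
      obtain n where "1 / Suc n < e" using \<open>0 < e\<close> nat_approx_posE by metis
      moreover obtain y where "y \<in> k n" "dist y x < 1 / Suc n" using k(3)[of n] \<open>x \<in> T\<close> by auto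
      ultimately show "\<exists>n. \<exists>y\<in>k n. dist y x < e" by (meson order.strict_trans)
    qed
  qed
qed

lemma dense_sequence_continuous:
  fixes h :: "'a::metric_space \<Rightarrow> real"
  assumes "t \<in> closure D" "isCont h t"
  shows "\<exists>u. (\<forall>n::nat. u n \<in> D) \<and> u \<longlonglongrightarrow> t \<and> (\<lambda>n. h (u n)) \<longlonglongrightarrow> h t"
  using assms closure_sequential[of t D] isCont_tendsto_compose[of t h] by blast

lemma lipschitz_isCont:
  fixes h :: "'a::metric_space \<Rightarrow> real"
  assumes "0 \<le> C" "\<And>u v. \<bar>h u - h v\<bar> \<le> C * dist u v"
  shows "isCont h t"
proof -
  have "C-lipschitz_on UNIV h"
    using assms by (intro lipschitz_onI) (auto simp: dist_real_def)
  then show ?thesis using lipschitz_on_continuous_on continuous_on_eq_continuous_at by blast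
qed

text \<open>Apply the hypothesis to the deterministic process \<open>h / (C + 1)\<close>.\<close>

lemma lipschitz_imp_dominated:
  fixes T :: "'a::metric_space set" and h :: "'a \<Rightarrow> real"
  assumes T: "compact T" and dom: "increments_as_dominated \<psi> T \<rho>" and Y: "young_function \<psi>" "\<psi> 1 = 1"
    and rho: "Metric_space T \<rho>" and C: "0 \<le> C" "\<And>u v. \<bar>h u - h v\<bar> \<le> C * dist u v"
  shows "\<exists>L\<ge>0. \<forall>s\<in>T. \<forall>t\<in>T. \<bar>h s - h t\<bar> \<le> L * \<rho> s t"
proof -
  interpret Metric_space T \<rho> by (rule rho)
  \<comment> \<open>The divisor \<open>C + 1\<close> is positive even for \<open>C = 0\<close> and
    keeps all difference quotients at most 1, where \<open>\<psi> 1 = 1\<close> bounds the moment.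
    On a one-point sample space almost surely means surely.\<close>
  define X where "X t (\<omega>::unit) = h t / (C + 1)" for t \<omega>
  let ?M = "measure_pmf (return_pmf ())"
  obtain D where D: "countable D" "D \<subseteq> T" "T \<subseteq> closure D"
    using compact_imp_countable_dense[OF T] by metis
  have cont: "isCont (\<lambda>t. X t \<omega>) t" for t \<omega>
    unfolding X_def using C(1) by (intro continuous_divide lipschitz_isCont[OF C] continuous_const) auto
  have "AE \<omega> in ?M. (SUP (s, t)\<in>T \<times> T. ennreal (\<bar>X s \<omega> - X t \<omega>\<bar> / \<rho> s t)) < \<infinity>"
  proof (rule increments_as_dominatedD[OF dom Y(1) _ _ D(1,2)])
    show "\<exists>u. (\<forall>n::nat. u n \<in> D) \<and> u \<longlonglongrightarrow> t \<and> (\<lambda>n. X (u n) \<omega>) \<longlonglongrightarrow> X t \<omega>" if "t \<in> T" for \<omega> t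
      using dense_sequence_continuous[OF _ cont] D(3) that by blast
    show "(\<integral>\<^sup>+\<omega>. ennreal (\<psi> (\<bar>X s \<omega> - X t \<omega>\<bar> / dist s t)) \<partial>?M) \<le> 1" for s t
    proof -
      have "\<bar>X s () - X t ()\<bar> = \<bar>h s - h t\<bar> / (C + 1)"
        using C(1) by (simp add: X_def flip: diff_divide_distrib)
      also have "\<dots> \<le> C * dist s t / (C + 1)" using C by (intro divide_right_mono) auto
      also have "\<dots> \<le> dist s t" using C(1) by (simp add: field_simps)
      finally have "\<bar>X s () - X t ()\<bar> / dist s t \<le> 1"
        by (cases "s = t") (auto simp: divide_le_eq)
      then have "\<psi> (\<bar>X s () - X t ()\<bar> / dist s t) \<le> \<psi> 1"
        by (intro young_mono[OF Y(1)]) auto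
      then show ?thesis using Y(2) by (simp add: X_def)
    qed
  qed (auto simp: measure_pmf.prob_space_axioms)
  then have "(SUP (s, t)\<in>T \<times> T. ennreal (\<bar>X s () - X t ()\<bar> / \<rho> s t)) < \<infinity>"
    by (simp add: AE_measure_pmf_iff)
  then obtain B where B: "0 \<le> B" "(SUP (s, t)\<in>T \<times> T. ennreal (\<bar>X s () - X t ()\<bar> / \<rho> s t)) = ennreal B"
    unfolding infinity_ennreal_def less_top_ennreal by (elim exE conjE) (rule that)
  have "\<bar>h s - h t\<bar> \<le> (C + 1) * B * \<rho> s t" if st: "s \<in> T" "t \<in> T" for s t
  proof (cases "s = t")
    case False
    then have r: "0 < \<rho> s t" using st by simp
    have "ennreal (\<bar>X s () - X t ()\<bar> / \<rho> s t) \<le> ennreal B"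
      unfolding B(2)[symmetric] using st by (intro SUP_upper2[of "(s, t)"]) auto
    then have "\<bar>X s () - X t ()\<bar> / \<rho> s t \<le> B" using B(1) by simp
    then have "\<bar>X s () - X t ()\<bar> \<le> B * \<rho> s t" using r by (simp add: pos_divide_le_eq)
    moreover have "\<bar>X s () - X t ()\<bar> = \<bar>h s - h t\<bar> / (C + 1)"
      using C(1) by (simp add: X_def flip: diff_divide_distrib)
    ultimately have "\<bar>h s - h t\<bar> / (C + 1) \<le> B * \<rho> s t" by simp
    then show ?thesis using C(1) by (simp add: pos_divide_le_eq mult_ac)
  qed (simp add: B nonneg C)
  then show ?thesis using B C by (intro exI[of _ "(C + 1) * B"]) auto
qed

section \<open>Uniform feasibility\<close>

text \<open>Only the first point of a pair, the centre of the balls, is restricted to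
  \<open>S\<close>, so that a finite cover of \<open>T\<close> localises the problem.\<close>

definition feasible_on ::
    "(real \<Rightarrow> real) \<Rightarrow> 'a::metric_space set \<Rightarrow> ('a \<Rightarrow> 'a \<Rightarrow> real) \<Rightarrow> 'a set \<Rightarrow> bool" where
  "feasible_on \<phi> T \<rho> S \<longleftrightarrow> (\<exists>K\<ge>0. \<forall>F. finite F \<longrightarrow> F \<subseteq> S \<times> T \<longrightarrow>
     (\<exists>\<nu>. prob_charge T \<nu> \<and> (\<forall>(s, t)\<in>F. ball_integral \<phi> \<nu> s (dist s t) \<le> ennreal (K * \<rho> s t))))"

lemma not_feasible_onD:
  assumes "\<not> feasible_on \<phi> T \<rho> S" "0 \<le> K"
  shows "\<exists>F. finite F \<and> F \<subseteq> S \<times> T \<and>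
    \<not> (\<exists>\<nu>. prob_charge T \<nu> \<and> (\<forall>(s, t)\<in>F. ball_integral \<phi> \<nu> s (dist s t) \<le> ennreal (K * \<rho> s t)))"
proof -
  define C where "C K F \<longleftrightarrow> (\<exists>\<nu>. prob_charge T \<nu> \<and>
    (\<forall>(s, t)\<in>F. ball_integral \<phi> \<nu> s (dist s t) \<le> ennreal (K * \<rho> s t)))" for K F
  show ?thesis using assms unfolding feasible_on_def C_def[symmetric] by blast
qed

lemma ball_integral_half_le:
  assumes Y: "young_function \<phi>" and mu: "prob_charge T \<mu>" "prob_charge T \<nu>" and le: "\<And>A. \<mu> A / 2 \<le> \<nu> A"
  shows "ball_integral \<phi> \<nu> s d \<le> 2 * ball_integral \<phi> \<mu> s d"
proof -
  have [measurable]: "(\<lambda>\<epsilon>. young_rec \<phi> (\<mu> (cball s \<epsilon>))) \<in> borel_measurable borel"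
    by (rule young_rec_charge_measurable[OF Y mu(1)])
  have "young_rec \<phi> (\<nu> A) \<le> 2 * young_rec \<phi> (\<mu> A)" for A
  proof -
    have "young_rec \<phi> (\<nu> A) \<le> young_rec \<phi> (\<mu> A / 2)"
      using prob_charge_nonneg[OF mu(1)] by (intro young_rec_antimono[OF Y] le) auto
    also have "\<dots> \<le> ennreal 2 * young_rec \<phi> (2 * (\<mu> A / 2))"
      using prob_charge_nonneg[OF mu(1)] by (intro young_rec_scale[OF Y]) auto
    finally show ?thesis by simp
  qed
  then have "ball_integral \<phi> \<nu> s d \<le> (\<integral>\<^sup>+\<epsilon>. 2 * (young_rec \<phi> (\<mu> (cball s \<epsilon>)) * indicator {0..d} \<epsilon>) \<partial>lborel)"
    unfolding ball_integral_def by (intro nn_integral_mono) (auto simp: indicator_def)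
  also have "\<dots> = 2 * ball_integral \<phi> \<mu> s d"
    unfolding ball_integral_def by (rule nn_integral_cmult) measurable
  finally show ?thesis .
qed

text \<open>The average of two charges dominates half of each, which at most doubles the
  constants.\<close>

lemma feasible_on_Un:
  assumes Y: "young_function \<phi>" and rho: "\<And>s t. 0 \<le> \<rho> s t"
    and "feasible_on \<phi> T \<rho> S\<^sub>1" "feasible_on \<phi> T \<rho> S\<^sub>2"
  shows "feasible_on \<phi> T \<rho> (S\<^sub>1 \<union> S\<^sub>2)"
proof -
  obtain K\<^sub>1 where K1: "0 \<le> K\<^sub>1" "\<And>F. finite F \<Longrightarrow> F \<subseteq> S\<^sub>1 \<times> T \<Longrightarrow>
      \<exists>\<nu>. prob_charge T \<nu> \<and> (\<forall>(s, t)\<in>F. ball_integral \<phi> \<nu> s (dist s t) \<le> ennreal (K\<^sub>1 * \<rho> s t))"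
    using assms(3) unfolding feasible_on_def by (elim exE conjE) (rule that, auto)
  obtain K\<^sub>2 where K2: "0 \<le> K\<^sub>2" "\<And>F. finite F \<Longrightarrow> F \<subseteq> S\<^sub>2 \<times> T \<Longrightarrow>
      \<exists>\<nu>. prob_charge T \<nu> \<and> (\<forall>(s, t)\<in>F. ball_integral \<phi> \<nu> s (dist s t) \<le> ennreal (K\<^sub>2 * \<rho> s t))"
    using assms(4) unfolding feasible_on_def by (elim exE conjE) (rule that, auto)
  define K where "K = 2 * max K\<^sub>1 K\<^sub>2"
  have half: "ball_integral \<phi> \<nu> s d \<le> ennreal (K * r)"
    if "prob_charge T \<mu>" "prob_charge T \<nu>" "\<And>A. \<mu> A / 2 \<le> \<nu> A" "ball_integral \<phi> \<mu> s d \<le> ennreal (K' * r)"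
      "0 \<le> K'" "2 * K' \<le> K" "0 \<le> r" for \<mu> \<nu> s d r K'
  proof -
    have "ball_integral \<phi> \<nu> s d \<le> 2 * ball_integral \<phi> \<mu> s d"
      by (rule ball_integral_half_le[OF Y that(1-3)])
    also have "\<dots> \<le> ennreal 2 * ennreal (K' * r)" using that(4) by (auto intro: mult_left_mono)
    also have "\<dots> = ennreal (2 * K' * r)" using that by (simp add: mult.assoc ennreal_mult')
    also have "\<dots> \<le> ennreal (K * r)" using that by (intro ennreal_leI mult_right_mono) auto
    finally show ?thesis .
  qed
  have "\<exists>\<nu>. prob_charge T \<nu> \<and> (\<forall>(s, t)\<in>F. ball_integral \<phi> \<nu> s (dist s t) \<le> ennreal (K * \<rho> s t))"
    if F: "finite F" "F \<subseteq> (S\<^sub>1 \<union> S\<^sub>2) \<times> T" for F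
  proof -
    obtain \<mu>\<^sub>1 where m1: "prob_charge T \<mu>\<^sub>1"
      "\<forall>(s, t)\<in>F \<inter> S\<^sub>1 \<times> T. ball_integral \<phi> \<mu>\<^sub>1 s (dist s t) \<le> ennreal (K\<^sub>1 * \<rho> s t)"
      using K1(2)[of "F \<inter> S\<^sub>1 \<times> T"] F(1) by auto
    obtain \<mu>\<^sub>2 where m2: "prob_charge T \<mu>\<^sub>2"
      "\<forall>(s, t)\<in>F \<inter> S\<^sub>2 \<times> T. ball_integral \<phi> \<mu>\<^sub>2 s (dist s t) \<le> ennreal (K\<^sub>2 * \<rho> s t)"
      using K2(2)[of "F \<inter> S\<^sub>2 \<times> T"] F(1) by auto
    define \<nu> where "\<nu> A = (\<mu>\<^sub>1 A + \<mu>\<^sub>2 A) / 2" for A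
    have nu: "prob_charge T \<nu>" unfolding \<nu>_def by (intro prob_charge_midpoint m1 m2)
    have le: "\<mu>\<^sub>1 A / 2 \<le> \<nu> A" "\<mu>\<^sub>2 A / 2 \<le> \<nu> A" for A
      using prob_charge_nonneg[OF m1(1), of A] prob_charge_nonneg[OF m2(1), of A] by (auto simp: \<nu>_def)
    have "ball_integral \<phi> \<nu> s (dist s t) \<le> ennreal (K * \<rho> s t)" if st: "(s, t) \<in> F" for s t
    proof (cases "s \<in> S\<^sub>1")
      case True
      then show ?thesis
        using m1(2) st F(2) K1(1) rho by (intro half[OF m1(1) nu le(1), of _ _ K\<^sub>1]) (auto simp: K_def)
    next
      case False
      then show ?thesis
        using m2(2) st F(2) K2(1) rho by (intro half[OF m2(1) nu le(2), of _ _ K\<^sub>2]) (auto simp: K_def)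
    qed
    with nu show ?thesis by auto
  qed
  moreover have "0 \<le> K" using K1(1) by (simp add: K_def)
  ultimately show ?thesis unfolding feasible_on_def by blast
qed

lemma feasible_on_subset:
  assumes "feasible_on \<phi> T \<rho> S'" "S \<subseteq> S'"
  shows "feasible_on \<phi> T \<rho> S"
proof -
  have "F \<subseteq> S' \<times> T" if "F \<subseteq> S \<times> T" for F :: "('a \<times> 'a) set" using that assms(2) by auto
  then show ?thesis using assms(1) unfolding feasible_on_def by meson
qed

text \<open>A finite subcover reduces this to finite unions. Its contrapositive supplies the point
  at which the humps concentrate.\<close>

lemma feasible_on_local:
  assumes T: "compact T" "T \<noteq> {}" and Y: "young_function \<phi>" and rho: "\<And>s t. 0 \<le> \<rho> s t"
    and loc: "\<And>s. s \<in> T \<Longrightarrow> \<exists>r>0. feasible_on \<phi> T \<rho> (T \<inter> ball s r)"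
  shows "feasible_on \<phi> T \<rho> T"
proof -
  obtain r where r: "\<And>s. s \<in> T \<Longrightarrow> 0 < r s" "\<And>s. s \<in> T \<Longrightarrow> feasible_on \<phi> T \<rho> (T \<inter> ball s (r s))"
    using loc by metis
  have "T \<subseteq> (\<Union>s\<in>T. ball s (r s))" using r(1) by force
  then obtain I where I: "I \<subseteq> T" "finite I" "T \<subseteq> (\<Union>s\<in>I. ball s (r s))"
    by (rule compactE_image[OF T(1), rotated]) auto
  obtain a where "a \<in> T" using T(2) by auto
  have "feasible_on \<phi> T \<rho> (\<Union>s\<in>I. T \<inter> ball s (r s))"
    using I(2,1)
  proof (induction I rule: finite_induct)
    case empty
    have "\<exists>\<nu>. prob_charge T \<nu>" using prob_charge_dirac[OF \<open>a \<in> T\<close>] by blast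
    then show ?case unfolding feasible_on_def by (intro exI[of _ 0]) auto
  next
    case (insert s I)
    then show ?case using feasible_on_Un[OF Y rho r(2)[of s]] by simp
  qed
  then show ?thesis by (rule feasible_on_subset) (use I(3) in auto)
qed

text \<open>For the point mass at \<open>s\<^sub>0\<close> the integral equals
  \<open>dist s\<^sub>0 t\<close>. Hence deleting \<open>s\<^sub>0\<close> from its neighbourhoods
  cannot restore feasibility.\<close>

lemma feasible_on_singleton:
  assumes Y: "young_function \<phi>" "\<phi> 1 = 1" and s0: "s\<^sub>0 \<in> T" and L: "0 \<le> L" "\<And>t. t \<in> T \<Longrightarrow> dist s\<^sub>0 t \<le> L * \<rho> s\<^sub>0 t"
  shows "feasible_on \<phi> T \<rho> {s\<^sub>0}"
proof -
  have dirac: "ball_integral \<phi> (\<lambda>A. indicator A s\<^sub>0) s\<^sub>0 d = ennreal d" if "0 \<le> d" for d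
  proof -
    have "ball_integral \<phi> (\<lambda>A. indicator A s\<^sub>0) s\<^sub>0 d = (\<integral>\<^sup>+\<epsilon>. indicator {0..d} \<epsilon> \<partial>lborel)"
      unfolding ball_integral_def
      by (intro nn_integral_cong) (auto simp: indicator_def young_rec_1[OF Y])
    then show ?thesis using that by (simp add: emeasure_lborel_Icc_eq)
  qed
  have "\<forall>(s, t)\<in>F. ball_integral \<phi> (\<lambda>A. indicator A s\<^sub>0) s (dist s t) \<le> ennreal (L * \<rho> s t)"
    if "F \<subseteq> {s\<^sub>0} \<times> T" for F
  proof clarify
    fix s t assume "(s, t) \<in> F"
    then have "s = s\<^sub>0" "t \<in> T" using that by auto
    with dirac[of "dist s t"] L(2) show "ball_integral \<phi> (\<lambda>A. indicator A s\<^sub>0) s (dist s t) \<le> ennreal (L * \<rho> s t)"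
      by (simp add: ennreal_leI)
  qed
  then show ?thesis unfolding feasible_on_def using L(1) prob_charge_dirac[OF s0] by blast
qed

section \<open>The gliding hump\<close>

text \<open>Jensen's inequality with the missing mass placed at \<open>0\<close>. The induction
  peels off the first term and uses midpoint convexity for it and the rescaled tail.\<close>

lemma young_dyadic_sum_le:
  assumes Y: "young_function \<psi>" and x: "\<And>n. 0 \<le> x n"
  shows "\<psi> (\<Sum>n<N. (1 / 2) ^ Suc n * x n) \<le> (\<Sum>n<N. (1 / 2) ^ Suc n * \<psi> (x n))"
  using x
proof (induction N arbitrary: x)
  case 0
  then show ?case using Y by (simp add: young_function_def)
next
  case (Suc N)
  define s where "s = (\<Sum>n<N. (1 / 2) ^ Suc n * x (Suc n))"
  have s: "0 \<le> s" unfolding s_def using Suc.prems by (intro sum_nonneg) auto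
  have "(\<Sum>n<Suc N. (1 / 2) ^ Suc n * x n) = 1 / 2 * x 0 + 1 / 2 * s"
    unfolding s_def by (subst sum.lessThan_Suc_shift) (simp add: sum_distrib_left mult.assoc)
  also have "\<psi> (1 / 2 * x 0 + 1 / 2 * s) \<le> 1 / 2 * \<psi> (x 0) + 1 / 2 * \<psi> s"
    using convex_onD[of "{0..}" \<psi> "1 / 2" "x 0" s] Y s Suc.prems by (simp add: young_function_def)
  also have "\<psi> s \<le> (\<Sum>n<N. (1 / 2) ^ Suc n * \<psi> (x (Suc n)))"
    unfolding s_def using Suc.prems by (intro Suc.IH) auto
  also have "1 / 2 * \<psi> (x 0) + 1 / 2 * (\<Sum>n<N. (1 / 2) ^ Suc n * \<psi> (x (Suc n)))
      = (\<Sum>n<Suc N. (1 / 2) ^ Suc n * \<psi> (x n))"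
    by (subst sum.lessThan_Suc_shift) (simp add: sum_distrib_left mult.assoc)
  finally show ?case by simp
qed

text \<open>
  \<open>\<Lambda> n\<close> is a Lipschitz constant, with respect to \<open>\<rho>\<close>, of the functions in the families up to index \<open>n\<close>;
  \<open>\<kappa>\<close> grows fast enough for their contribution to be negligible. The support of the later families
  avoids all points of the pairs drawn from the earlier ones.
\<close>

locale gliding_humps =
  fixes \<psi> :: "real \<Rightarrow> real" and T :: "'a::metric_space set" and \<rho> :: "'a \<Rightarrow> 'a \<Rightarrow> real" and s\<^sub>0 :: 'a
    and q :: "nat \<Rightarrow> ('a \<times> 'a) pmf" and Y :: "nat \<Rightarrow> 'a \<times> 'a \<Rightarrow> 'a \<Rightarrow> real"
    and r \<kappa> \<Lambda> :: "nat \<Rightarrow> real"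
  assumes T: "compact T" and young: "young_function \<psi>" and rho: "Metric_space T \<rho>" and s0: "s\<^sub>0 \<in> T"
    and family: "\<And>n. hump_family \<psi> T \<rho> s\<^sub>0 (r n) (\<kappa> n) (q n) (Y n)"
    and r: "\<And>n. r n \<le> (1 / 2) ^ n" "\<And>n. r (Suc n) \<le> r n"
    and Lambda: "\<And>n. 0 \<le> \<Lambda> n" "\<And>n. \<Lambda> n \<le> \<Lambda> (Suc n)"
    and lip: "\<And>n \<omega> s t. \<omega> \<in> set_pmf (q n) \<Longrightarrow> s \<in> T \<Longrightarrow> t \<in> T \<Longrightarrow> \<bar>Y n \<omega> s - Y n \<omega> t\<bar> \<le> \<Lambda> n * \<rho> s t"
    and avoid: "\<And>n \<omega> x. \<omega> \<in> set_pmf (q n) \<Longrightarrow> x = fst \<omega> \<or> x = snd \<omega> \<Longrightarrow> x \<noteq> s\<^sub>0 \<Longrightarrow> 2 * r (Suc n) \<le> dist x s\<^sub>0"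
    and kappa: "\<And>n. 2 ^ Suc (Suc n) * (real (Suc n) + \<Lambda> n) \<le> \<kappa> (Suc n)"
begin

text \<open>The value \<open>0\<close> off the support makes continuity and the support condition
  hold for every \<open>\<omega>\<close>, not just almost every one.\<close>

definition Z :: "nat \<Rightarrow> (nat \<Rightarrow> 'a \<times> 'a) \<Rightarrow> 'a \<Rightarrow> real" where
  "Z n \<omega> u = (if \<omega> n \<in> set_pmf (q n) then Y n (\<omega> n) u else 0)"

definition X :: "'a \<Rightarrow> (nat \<Rightarrow> 'a \<times> 'a) \<Rightarrow> real" where
  "X u \<omega> = (\<Sum>n. (1 / 2) ^ Suc n * Z n \<omega> u)"

definition \<Omega> :: "(nat \<Rightarrow> 'a \<times> 'a) measure" where
  "\<Omega> = PiM UNIV (\<lambda>n. measure_pmf (q n))"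

lemma prob_space_Omega: "prob_space \<Omega>"
  unfolding \<Omega>_def by (intro prob_space_PiM measure_pmf.prob_space_axioms)

lemma component_measurable [measurable]: "(\<lambda>\<omega>. \<omega> n) \<in> measurable \<Omega> (measure_pmf (q n))"
  unfolding \<Omega>_def by (rule measurable_component_singleton) simp

lemma distr_component: "distr \<Omega> (measure_pmf (q n)) (\<lambda>\<omega>. \<omega> n) = measure_pmf (q n)"
  unfolding \<Omega>_def by (rule distr_PiM_component) (auto simp: measure_pmf.prob_space_axioms)

lemma r_antimono: "m \<le> n \<Longrightarrow> r n \<le> r m"
  using decseqD[of r] r(2) by (simp add: decseq_Suc_iff)

lemma Lambda_mono: "m \<le> n \<Longrightarrow> \<Lambda> m \<le> \<Lambda> n"
  using incseqD[of \<Lambda>] Lambda(2) by (simp add: incseq_Suc_iff)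

lemma Z_eq_0: "u = s\<^sub>0 \<or> 2 * r n \<le> dist u s\<^sub>0 \<Longrightarrow> Z n \<omega> u = 0"
  using family[of n] unfolding hump_family_def Z_def by auto

text \<open>The supports shrink to \<open>s\<^sub>0\<close>, and all summands vanish at
  \<open>s\<^sub>0\<close> itself. So \<open>X\<close> is a finite sum at each point, with a number
  of terms that does not depend on \<open>\<omega>\<close>.\<close>

lemma Z_eventually_0:
  assumes "0 < \<delta>"
  shows "\<exists>N. \<forall>n\<ge>N. \<forall>\<omega> u. u = s\<^sub>0 \<or> \<delta> \<le> dist u s\<^sub>0 \<longrightarrow> Z n \<omega> u = 0"
proof -
  obtain N where N: "(1 / 2) ^ N < \<delta> / 2" using assms real_arch_pow_inv[of "\<delta> / 2" "1 / 2"] by auto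
  have "Z n \<omega> u = 0" if "N \<le> n" "u = s\<^sub>0 \<or> \<delta> \<le> dist u s\<^sub>0" for n \<omega> u
  proof -
    have "2 * r n \<le> \<delta>" using r_antimono[OF that(1)] r(1)[of N] N by linarith
    then show ?thesis using that(2) by (intro Z_eq_0) auto
  qed
  then show ?thesis by blast
qed

lemma X_eq_sum:
  assumes "\<And>n. N \<le> n \<Longrightarrow> Z n \<omega> u = 0"
  shows "X u \<omega> = (\<Sum>n<N. (1 / 2) ^ Suc n * Z n \<omega> u)"
  unfolding X_def using assms by (intro suminf_finite) (auto simp: not_less)

lemma X_eq_sum_common:
  obtains N where "\<And>\<omega>. X u \<omega> = (\<Sum>n<N. (1 / 2) ^ Suc n * Z n \<omega> u)"
    "\<And>\<omega>. X v \<omega> = (\<Sum>n<N. (1 / 2) ^ Suc n * Z n \<omega> v)"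
proof -
  \<comment> \<open>The default \<open>1\<close> keeps \<open>\<delta>\<close> positive when one of
    the points is \<open>s\<^sub>0\<close>, where every \<open>Z n\<close> vanishes.\<close>
  define \<delta> where "\<delta> = min (if u = s\<^sub>0 then 1 else dist u s\<^sub>0) (if v = s\<^sub>0 then 1 else dist v s\<^sub>0)"
  have "0 < \<delta>" by (auto simp: \<delta>_def)
  from Z_eventually_0[OF this] obtain N
    where N: "\<And>n \<omega> w. N \<le> n \<Longrightarrow> w = s\<^sub>0 \<or> \<delta> \<le> dist w s\<^sub>0 \<Longrightarrow> Z n \<omega> w = 0" by metis
  have "u = s\<^sub>0 \<or> \<delta> \<le> dist u s\<^sub>0" "v = s\<^sub>0 \<or> \<delta> \<le> dist v s\<^sub>0" by (auto simp: \<delta>_def)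
  then show ?thesis using that[of N] X_eq_sum N by blast
qed

lemma Z_measurable [measurable]: "(\<lambda>\<omega>. Z n \<omega> u) \<in> borel_measurable \<Omega>"
proof -
  have "(\<lambda>p. if p \<in> set_pmf (q n) then Y n p u else 0) \<in> borel_measurable (measure_pmf (q n))" by simp
  from measurable_compose[OF component_measurable this] show ?thesis by (simp add: Z_def)
qed

lemma X_measurable: "X u \<in> borel_measurable \<Omega>"
proof -
  obtain N where N: "\<And>\<omega>. X u \<omega> = (\<Sum>n<N. (1 / 2) ^ Suc n * Z n \<omega> u)" by (rule X_eq_sum_common[of u u]) (rule that)
  have "(\<lambda>\<omega>. \<Sum>n<N. (1 / 2) ^ Suc n * Z n \<omega> u) \<in> borel_measurable \<Omega>" by measurable
  then show ?thesis by (simp add: N[abs_def] cong: measurable_cong)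
qed

lemma Z_isCont: "isCont (Z n \<omega>) t"
proof (cases "\<omega> n \<in> set_pmf (q n)")
  case True
  obtain C where "0 \<le> C" "\<And>u v. \<bar>Y n (\<omega> n) u - Y n (\<omega> n) v\<bar> \<le> C * dist u v"
    using family[of n] True unfolding hump_family_def by auto
  from lipschitz_isCont[OF this] show ?thesis using True by (simp add: Z_def[abs_def])
qed (simp add: Z_def[abs_def])

text \<open>Near \<open>t\<close> only finitely many humps are present. Continuity at
  \<open>s\<^sub>0\<close> is not claimed; the point is added to the separating set in
  \<open>not_dominated\<close> instead.\<close>

lemma X_isCont:
  assumes "t \<noteq> s\<^sub>0"
  shows "isCont (\<lambda>u. X u \<omega>) t"
proof -
  define \<delta> where "\<delta> = dist t s\<^sub>0 / 2"
  have "0 < \<delta>" using assms by (simp add: \<delta>_def)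
  from Z_eventually_0[OF this] obtain N
    where N: "\<And>n \<omega> w. N \<le> n \<Longrightarrow> w = s\<^sub>0 \<or> \<delta> \<le> dist w s\<^sub>0 \<Longrightarrow> Z n \<omega> w = 0" by metis
  have "X u \<omega> = (\<Sum>n<N. (1 / 2) ^ Suc n * Z n \<omega> u)" if "u \<in> ball t \<delta>" for u
  proof -
    have "\<delta> \<le> dist u s\<^sub>0"
      using that dist_triangle[of t s\<^sub>0 u] by (simp add: \<delta>_def)
    then show ?thesis using N by (intro X_eq_sum) auto
  qed
  then have ev: "eventually (\<lambda>u. X u \<omega> = (\<Sum>n<N. (1 / 2) ^ Suc n * Z n \<omega> u)) (nhds t)"
    using \<open>0 < \<delta>\<close> eventually_nhds_in_open[of "ball t \<delta>" t] by (auto elim: eventually_mono)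
  show ?thesis
    by (subst isCont_cong[OF ev]) (intro continuous_intros Z_isCont)
qed

lemma Z_increments: "(\<integral>\<^sup>+\<omega>. ennreal (\<psi> (\<bar>Z n \<omega> u - Z n \<omega> v\<bar> / dist u v)) \<partial>\<Omega>) \<le> 1"
proof -
  define f where "f p = ennreal (\<psi> (\<bar>(if p \<in> set_pmf (q n) then Y n p u else 0)
      - (if p \<in> set_pmf (q n) then Y n p v else 0)\<bar> / dist u v))" for p
  have "(\<integral>\<^sup>+\<omega>. ennreal (\<psi> (\<bar>Z n \<omega> u - Z n \<omega> v\<bar> / dist u v)) \<partial>\<Omega>) = (\<integral>\<^sup>+\<omega>. f (\<omega> n) \<partial>\<Omega>)"
    by (simp add: f_def Z_def)
  also have "\<dots> = (\<integral>\<^sup>+p. f p \<partial>distr \<Omega> (measure_pmf (q n)) (\<lambda>\<omega>. \<omega> n))"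
    by (rule nn_integral_distr[symmetric, OF component_measurable]) simp
  also have "\<dots> = (\<integral>\<^sup>+p. ennreal (\<psi> (\<bar>Y n p u - Y n p v\<bar> / dist u v)) \<partial>q n)"
    unfolding distr_component by (intro nn_integral_cong_AE AE_pmfI) (simp add: f_def)
  also have "\<dots> \<le> 1" using family[of n] unfolding hump_family_def by blast
  finally show ?thesis .
qed

text \<open>Only finitely many terms matter for a given pair, and convexity with dyadic weights of
  total mass at most 1 carries the bound over from the single humps.\<close>

lemma X_increments: "(\<integral>\<^sup>+\<omega>. ennreal (\<psi> (\<bar>X u \<omega> - X v \<omega>\<bar> / dist u v)) \<partial>\<Omega>) \<le> 1"
proof -
  obtain N where N: "\<And>\<omega>. X u \<omega> = (\<Sum>n<N. (1 / 2) ^ Suc n * Z n \<omega> u)"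
    "\<And>\<omega>. X v \<omega> = (\<Sum>n<N. (1 / 2) ^ Suc n * Z n \<omega> v)" by (rule X_eq_sum_common[of u v]) (rule that)
  define x where "x n \<omega> = \<bar>Z n \<omega> u - Z n \<omega> v\<bar> / dist u v" for n \<omega>
  have x: "0 \<le> x n \<omega>" for n \<omega> by (simp add: x_def)
  define f where "f n \<omega> = \<psi> (max 0 (x n \<omega>))" for n \<omega>
  have [measurable]: "(\<lambda>y. \<psi> (max 0 y)) \<in> borel_measurable borel"
    by (intro borel_measurable_mono monoI young_mono[OF young]) auto
  have [measurable]: "f n \<in> borel_measurable \<Omega>" for n unfolding f_def x_def by measurable
  have f0: "0 \<le> f n \<omega>" for n \<omega> unfolding f_def by (intro young_nonneg[OF young]) simp
  have f: "f n \<omega> = \<psi> (x n \<omega>)" for n \<omega> using x by (simp add: f_def)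
  have "\<psi> (\<bar>X u \<omega> - X v \<omega>\<bar> / dist u v) \<le> (\<Sum>n<N. (1 / 2) ^ Suc n * f n \<omega>)" for \<omega>
  proof -
    have "\<bar>X u \<omega> - X v \<omega>\<bar> = \<bar>\<Sum>n<N. (1 / 2) ^ Suc n * (Z n \<omega> u - Z n \<omega> v)\<bar>"
      by (simp only: N sum_subtractf right_diff_distrib)
    also have "\<dots> \<le> (\<Sum>n<N. \<bar>(1 / 2) ^ Suc n * (Z n \<omega> u - Z n \<omega> v)\<bar>)" by (rule sum_abs)
    also have "\<dots> = (\<Sum>n<N. (1 / 2) ^ Suc n * \<bar>Z n \<omega> u - Z n \<omega> v\<bar>)" by (simp add: abs_mult)
    finally have "\<bar>X u \<omega> - X v \<omega>\<bar> / dist u v \<le> (\<Sum>n<N. (1 / 2) ^ Suc n * x n \<omega>)"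
      unfolding x_def by (auto simp: sum_divide_distrib dest: divide_right_mono[of _ _ "dist u v"])
    then have "\<psi> (\<bar>X u \<omega> - X v \<omega>\<bar> / dist u v) \<le> \<psi> (\<Sum>n<N. (1 / 2) ^ Suc n * x n \<omega>)"
      by (intro young_mono[OF young]) auto
    also have "\<dots> \<le> (\<Sum>n<N. (1 / 2) ^ Suc n * f n \<omega>)"
      unfolding f by (rule young_dyadic_sum_le[OF young x])
    finally show ?thesis .
  qed
  then have "(\<integral>\<^sup>+\<omega>. ennreal (\<psi> (\<bar>X u \<omega> - X v \<omega>\<bar> / dist u v)) \<partial>\<Omega>)
      \<le> (\<integral>\<^sup>+\<omega>. (\<Sum>n<N. ennreal ((1 / 2) ^ Suc n) * ennreal (f n \<omega>)) \<partial>\<Omega>)"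
    using f0 by (intro nn_integral_mono) (simp add: ennreal_leI sum_ennreal flip: ennreal_mult del: power_Suc)
  also have "\<dots> = (\<Sum>n<N. ennreal ((1 / 2) ^ Suc n) * (\<integral>\<^sup>+\<omega>. ennreal (f n \<omega>) \<partial>\<Omega>))"
    by (subst nn_integral_sum) (auto simp: nn_integral_cmult simp del: power_Suc)
  also have "\<dots> \<le> (\<Sum>n<N. ennreal ((1 / 2) ^ Suc n) * 1)"
    unfolding f x_def by (intro sum_mono mult_left_mono Z_increments) auto
  also have "\<dots> = ennreal (\<Sum>n<N. (1 / 2) ^ Suc n)" by (simp add: sum_ennreal del: power_Suc)
  also have "\<dots> \<le> ennreal 1"
  proof (rule ennreal_leI)
    show "(\<Sum>n<N. (1 / 2) ^ Suc n) \<le> (1::real)"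
      using power_half_series sum_le_suminf[of "\<lambda>n. (1 / 2 :: real) ^ Suc n" "{..<N}"]
      by (auto simp: sums_iff simp del: power_Suc)
  qed
  finally show ?thesis by simp
qed

definition jump :: "nat \<Rightarrow> ('a \<times> 'a) set" where
  "jump n = {p \<in> set_pmf (q n). \<kappa> n * \<rho> (fst p) (snd p) < Y n p (fst p) - Y n p (snd p)}"

lemma jump_prob:
  "measure \<Omega> {\<omega>\<in>space \<Omega>. \<omega> n \<in> jump n} \<ge> 1 / 4"
proof -
  have "1 / 4 \<le> measure_pmf.prob (q n) {p. \<kappa> n * \<rho> (fst p) (snd p) < Y n p (fst p) - Y n p (snd p)}"
    using family[of n] unfolding hump_family_def by blast
  also have "\<dots> = measure_pmf.prob (q n) (jump n)"
    by (intro measure_pmf.finite_measure_eq_AE AE_pmfI) (auto simp: jump_def)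
  also have "\<dots> = measure (distr \<Omega> (measure_pmf (q n)) (\<lambda>\<omega>. \<omega> n)) (jump n)"
    by (simp add: distr_component)
  also have "\<dots> = measure \<Omega> {\<omega>\<in>space \<Omega>. \<omega> n \<in> jump n}"
    by (subst measure_distr[OF component_measurable]) (auto simp: vimage_def Int_def conj_commute)
  finally show ?thesis .
qed

text \<open>Later humps vanish at both points by \<open>avoid\<close>. Earlier ones contribute at
  most \<open>\<Lambda> k * \<rho> s t\<close> in absolute value, since the weights sum to at most
  1. The factor \<open>2 ^ Suc (Suc k)\<close> in \<open>kappa\<close> cancels the weight of the
  current hump and leaves \<open>Suc k + \<Lambda> k\<close>.\<close>

lemma jump_increment:
  assumes jump: "\<omega> (Suc k) \<in> jump (Suc k)"
  defines "s \<equiv> fst (\<omega> (Suc k))" and "t \<equiv> snd (\<omega> (Suc k))"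
  shows "s \<in> T" "t \<in> T" "0 < \<rho> s t" "real (Suc k) * \<rho> s t \<le> X s \<omega> - X t \<omega>"
proof -
  interpret Metric_space T \<rho> by (rule rho)
  define n where "n = Suc k"
  have w: "\<omega> n \<in> set_pmf (q n)" and big: "\<kappa> n * \<rho> s t < Y n (\<omega> n) s - Y n (\<omega> n) t"
    using jump by (auto simp: jump_def n_def s_def t_def)
  have "set_pmf (q n) \<subseteq> (T - {s\<^sub>0}) \<times> T" using family[of n] unfolding hump_family_def by blast
  then show st: "s \<in> T" "t \<in> T" using w by (auto simp: s_def t_def n_def)
  have "s \<noteq> t" using big st by auto
  then show pos: "0 < \<rho> s t" using st by simp
  have zero: "Z m \<omega> x = 0" if "Suc n \<le> m" "x = s \<or> x = t" for m x
  proof (rule Z_eq_0)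
    have "2 * r (Suc n) \<le> dist x s\<^sub>0" if "x \<noteq> s\<^sub>0"
      using avoid[OF w, of x] that \<open>x = s \<or> x = t\<close> by (auto simp: s_def t_def n_def)
    then show "x = s\<^sub>0 \<or> 2 * r m \<le> dist x s\<^sub>0" using r_antimono[OF \<open>Suc n \<le> m\<close>] by force
  qed
  have "\<bar>\<Sum>m<n. (1 / 2) ^ Suc m * (Z m \<omega> s - Z m \<omega> t)\<bar> \<le> (\<Sum>m<n. (1 / 2) ^ Suc m * (\<Lambda> k * \<rho> s t))"
  proof (rule order_trans[OF sum_abs], rule sum_mono)
    fix m assume "m \<in> {..<n}"
    then have "\<Lambda> m * \<rho> s t \<le> \<Lambda> k * \<rho> s t" using pos by (intro mult_right_mono Lambda_mono) (auto simp: n_def)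
    moreover have "\<bar>Z m \<omega> s - Z m \<omega> t\<bar> \<le> \<Lambda> m * \<rho> s t"
      using lip[of "\<omega> m" m s t] st pos Lambda(1)[of m] by (auto simp: Z_def)
    ultimately show "\<bar>(1 / 2) ^ Suc m * (Z m \<omega> s - Z m \<omega> t)\<bar> \<le> (1 / 2) ^ Suc m * (\<Lambda> k * \<rho> s t)"
      by (simp add: abs_mult)
  qed
  also have "\<dots> = (\<Sum>m<n. (1 / 2) ^ Suc m) * (\<Lambda> k * \<rho> s t)" by (rule sum_distrib_right[symmetric])
  also have "\<dots> \<le> 1 * (\<Lambda> k * \<rho> s t)"
  proof (rule mult_right_mono)
    show "(\<Sum>m<n. (1 / 2) ^ Suc m) \<le> (1::real)"
      using power_half_series sum_le_suminf[of "\<lambda>n. (1 / 2 :: real) ^ Suc n" "{..<n}"]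
      by (auto simp: sums_iff simp del: power_Suc)
  qed (use Lambda(1)[of k] pos in simp)
  finally have early: "- (\<Lambda> k * \<rho> s t) \<le> (\<Sum>m<n. (1 / 2) ^ Suc m * (Z m \<omega> s - Z m \<omega> t))" by linarith
  have "(real (Suc k) + \<Lambda> k) * \<rho> s t = (1 / 2) ^ Suc n * (2 ^ Suc n * (real (Suc k) + \<Lambda> k) * \<rho> s t)"
    by (simp add: power_one_over)
  also have "\<dots> \<le> (1 / 2) ^ Suc n * (\<kappa> n * \<rho> s t)"
    using kappa[of k] pos unfolding n_def by (intro mult_left_mono mult_right_mono) auto
  also have "\<dots> \<le> (1 / 2) ^ Suc n * (Z n \<omega> s - Z n \<omega> t)"
    using big w by (intro mult_left_mono) (auto simp: Z_def)
  finally have main: "(real (Suc k) + \<Lambda> k) * \<rho> s t \<le> (1 / 2) ^ Suc n * (Z n \<omega> s - Z n \<omega> t)" .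
  have X: "X s \<omega> = (\<Sum>m<Suc n. (1 / 2) ^ Suc m * Z m \<omega> s)" "X t \<omega> = (\<Sum>m<Suc n. (1 / 2) ^ Suc m * Z m \<omega> t)"
    by (rule X_eq_sum, rule zero, simp, simp)+
  have "X s \<omega> - X t \<omega> = (\<Sum>m<Suc n. (1 / 2) ^ Suc m * (Z m \<omega> s - Z m \<omega> t))"
    unfolding X by (simp only: sum_subtractf right_diff_distrib)
  also have "\<dots> = (\<Sum>m<n. (1 / 2) ^ Suc m * (Z m \<omega> s - Z m \<omega> t)) + (1 / 2) ^ Suc n * (Z n \<omega> s - Z n \<omega> t)"
    by (rule sum.lessThan_Suc)
  finally show "real (Suc k) * \<rho> s t \<le> X s \<omega> - X t \<omega>"
    using early main by (simp only: distrib_right)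
qed

text \<open>A finite supremum permits only finitely many jumps, so the events \<open>A N\<close>
  would increase to one of probability 1. Each of them excludes a jump at stage \<open>N\<close> and
  has probability at most \<open>3 / 4\<close>.\<close>

lemma not_dominated:
  assumes dom: "increments_as_dominated \<psi> T \<rho>"
  shows False
proof -
  interpret Om: prob_space \<Omega> by (rule prob_space_Omega)
  obtain D where D: "countable D" "D \<subseteq> T" "T \<subseteq> closure D"
    using compact_imp_countable_dense[OF T] by metis
  have ae: "AE \<omega> in \<Omega>. (SUP (s, t)\<in>T \<times> T. ennreal (\<bar>X s \<omega> - X t \<omega>\<bar> / \<rho> s t)) < \<infinity>"
  proof (rule increments_as_dominatedD[OF dom young prob_space_Omega X_measurable _ _ _ X_increments])
    show "countable (insert s\<^sub>0 D)" "insert s\<^sub>0 D \<subseteq> T" using D s0 by auto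
    show "\<exists>u. (\<forall>n::nat. u n \<in> insert s\<^sub>0 D) \<and> u \<longlonglongrightarrow> t \<and> (\<lambda>n. X (u n) \<omega>) \<longlonglongrightarrow> X t \<omega>"
      if "t \<in> T" for \<omega> t
    proof (cases "t = s\<^sub>0")
      case True
      then show ?thesis by (intro exI[of _ "\<lambda>_. s\<^sub>0"]) auto
    next
      case False
      then show ?thesis
        using dense_sequence_continuous[of t D, OF _ X_isCont] D(3) that by blast
    qed
  qed
  define A where "A N = {\<omega>\<in>space \<Omega>. \<forall>n\<ge>N. \<omega> n \<notin> jump n}" for N
  have [measurable]: "{\<omega>\<in>space \<Omega>. \<omega> n \<in> jump n} \<in> sets \<Omega>" for n
    using measurable_sets[OF component_measurable, of "jump n" n] by (simp add: vimage_def Int_def conj_commute)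
  have A_sets: "A N \<in> sets \<Omega>" for N
    unfolding A_def by measurable
  have "AE \<omega> in \<Omega>. \<omega> \<in> (\<Union>N. A N)"
    using ae AE_space
  proof eventually_elim
    fix \<omega> assume fin: "(SUP (s, t)\<in>T \<times> T. ennreal (\<bar>X s \<omega> - X t \<omega>\<bar> / \<rho> s t)) < \<infinity>" and sp: "\<omega> \<in> space \<Omega>"
    then obtain B where B: "0 \<le> B" "(SUP (s, t)\<in>T \<times> T. ennreal (\<bar>X s \<omega> - X t \<omega>\<bar> / \<rho> s t)) = ennreal B"
      unfolding infinity_ennreal_def less_top_ennreal by (elim exE conjE) (rule that)
    obtain N where N: "B < real N" using reals_Archimedean2 by blast
    have "\<omega> n \<notin> jump n" if n: "Suc N \<le> n" for n
    proof
      assume j: "\<omega> n \<in> jump n"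
      obtain k where k: "n = Suc k" using n by (cases n) auto
      define s where "s = fst (\<omega> n)"
      define t where "t = snd (\<omega> n)"
      have st: "s \<in> T" "t \<in> T" "0 < \<rho> s t" "real (Suc k) * \<rho> s t \<le> X s \<omega> - X t \<omega>"
        using jump_increment[of \<omega> k] j by (auto simp: s_def t_def k)
      have "ennreal (\<bar>X s \<omega> - X t \<omega>\<bar> / \<rho> s t) \<le> ennreal B"
        unfolding B(2)[symmetric] using st by (intro SUP_upper2[of "(s, t)"]) auto
      then have "\<bar>X s \<omega> - X t \<omega>\<bar> / \<rho> s t \<le> B" using B(1) by simp
      moreover have "real (Suc k) \<le> \<bar>X s \<omega> - X t \<omega>\<bar> / \<rho> s t"
        using st by (simp add: pos_le_divide_eq)
      ultimately show False using N n k by simp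
    qed
    then show "\<omega> \<in> (\<Union>N. A N)" using sp by (auto simp: A_def)
  qed
  moreover have U_sets: "(\<Union>N. A N) \<in> sets \<Omega>" using A_sets by auto
  ultimately have "Om.prob (\<Union>N. A N) = 1" by (simp add: Om.prob_eq_1)
  moreover have "(\<lambda>N. Om.prob (A N)) \<longlonglongrightarrow> Om.prob (\<Union>N. A N)"
    using A_sets by (intro Om.finite_Lim_measure_incseq) (auto simp: incseq_def A_def)
  moreover have "Om.prob (A N) \<le> 3 / 4" for N
  proof -
    have "Om.prob (A N) \<le> Om.prob (space \<Omega> - {\<omega>\<in>space \<Omega>. \<omega> N \<in> jump N})"
      by (intro Om.finite_measure_mono) (auto simp: A_def)
    also have "\<dots> = 1 - Om.prob {\<omega>\<in>space \<Omega>. \<omega> N \<in> jump N}"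
      by (rule Om.prob_compl) measurable
    finally show ?thesis using jump_prob[of N] by linarith
  qed
  ultimately show False
    using LIMSEQ_le_const2[of "\<lambda>N. Om.prob (A N)" 1 "3 / 4"] by auto
qed

end

text \<open>The families are chosen recursively. The Lipschitz constants with respect to
  \<open>\<rho>\<close> come from the domination hypothesis itself, applied to the finitely many
  functions of a family; the next jump size is chosen after them.\<close>

lemma hump_families_imp_not_dominated:
  fixes T :: "'a::metric_space set"
  assumes T: "compact T" and Y: "young_function \<psi>" "\<psi> 1 = 1" and rho: "Metric_space T \<rho>" and s0: "s\<^sub>0 \<in> T"
    and fam: "\<And>r \<kappa>. 0 < r \<Longrightarrow> 0 \<le> \<kappa> \<Longrightarrow> \<exists>q Y. hump_family \<psi> T \<rho> s\<^sub>0 r \<kappa> q Y"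
  shows "\<not> increments_as_dominated \<psi> T \<rho>"
proof
  assume dom: "increments_as_dominated \<psi> T \<rho>"
  interpret Metric_space T \<rho> by (rule rho)
  define P where "P n = (\<lambda>(q, Y, r, \<kappa>, \<Lambda>). hump_family \<psi> T \<rho> s\<^sub>0 r \<kappa> q Y \<and> 0 < r \<and> r \<le> (1 / 2) ^ n \<and> 0 \<le> \<Lambda> \<and>
      (\<forall>\<omega>\<in>set_pmf q. \<forall>s\<in>T. \<forall>t\<in>T. \<bar>Y \<omega> s - Y \<omega> t\<bar> \<le> \<Lambda> * \<rho> s t))"
    for n :: nat
  define Q where "Q n = (\<lambda>(q :: ('a \<times> 'a) pmf, Y :: 'a \<times> 'a \<Rightarrow> 'a \<Rightarrow> real, r, \<kappa> :: real, \<Lambda>)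
        (q' :: ('a \<times> 'a) pmf, Y' :: 'a \<times> 'a \<Rightarrow> 'a \<Rightarrow> real, r', \<kappa>', \<Lambda>').
      r' \<le> r \<and> \<Lambda> \<le> \<Lambda>' \<and> 2 ^ Suc (Suc n) * (real (Suc n) + \<Lambda>) \<le> \<kappa>' \<and>
      (\<forall>\<omega>\<in>set_pmf q. \<forall>x. (x = fst \<omega> \<or> x = snd \<omega>) \<and> x \<noteq> s\<^sub>0 \<longrightarrow> 2 * r' \<le> dist x s\<^sub>0))"
    for n :: nat
  have ex: "\<exists>q Y \<Lambda>. hump_family \<psi> T \<rho> s\<^sub>0 r \<kappa> q Y \<and> \<Lambda>\<^sub>0 \<le> \<Lambda> \<and>
      (\<forall>\<omega>\<in>set_pmf q. \<forall>s\<in>T. \<forall>t\<in>T. \<bar>Y \<omega> s - Y \<omega> t\<bar> \<le> \<Lambda> * \<rho> s t)"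
    if r: "0 < r" and kappa: "0 \<le> \<kappa>" for r \<kappa> \<Lambda>\<^sub>0
  proof -
    obtain q Y where qY: "hump_family \<psi> T \<rho> s\<^sub>0 r \<kappa> q Y" using fam[OF r kappa] by blast
    then obtain C where C: "0 \<le> C" "\<And>\<omega> u v. \<omega> \<in> set_pmf q \<Longrightarrow> \<bar>Y \<omega> u - Y \<omega> v\<bar> \<le> C * dist u v"
      and fin: "finite (set_pmf q)" unfolding hump_family_def by metis
    have "\<exists>L\<ge>0. \<forall>s\<in>T. \<forall>t\<in>T. \<bar>Y \<omega> s - Y \<omega> t\<bar> \<le> L * \<rho> s t" if "\<omega> \<in> set_pmf q" for \<omega>
      using lipschitz_imp_dominated[OF T dom \<open>young_function \<psi>\<close> \<open>\<psi> 1 = 1\<close> rho C(1) C(2)[OF that]] .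
    then obtain L where L: "\<And>\<omega>. \<omega> \<in> set_pmf q \<Longrightarrow> 0 \<le> L \<omega>"
      "\<And>\<omega> s t. \<omega> \<in> set_pmf q \<Longrightarrow> s \<in> T \<Longrightarrow> t \<in> T \<Longrightarrow> \<bar>Y \<omega> s - Y \<omega> t\<bar> \<le> L \<omega> * \<rho> s t" by metis
    define \<Lambda> where "\<Lambda> = \<bar>\<Lambda>\<^sub>0\<bar> + (\<Sum>\<omega>\<in>set_pmf q. L \<omega>)"
    have "\<bar>Y \<omega> s - Y \<omega> t\<bar> \<le> \<Lambda> * \<rho> s t" if "\<omega> \<in> set_pmf q" "s \<in> T" "t \<in> T" for \<omega> s t
    proof -
      have "L \<omega> \<le> (\<Sum>\<omega>\<in>set_pmf q. L \<omega>)" using fin that L(1) by (intro member_le_sum) auto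
      then have "L \<omega> * \<rho> s t \<le> \<Lambda> * \<rho> s t" by (intro mult_right_mono) (auto simp: \<Lambda>_def)
      then show ?thesis using L(2)[OF that] by linarith
    qed
    moreover have "0 \<le> (\<Sum>\<omega>\<in>set_pmf q. L \<omega>)" by (intro sum_nonneg L(1))
    then have "\<Lambda>\<^sub>0 \<le> \<Lambda>" by (simp add: \<Lambda>_def)
    ultimately show ?thesis using qY by blast
  qed
  have "\<exists>f. \<forall>n. P n (f n) \<and> Q n (f n) (f (Suc n))"
  proof (rule dependent_nat_choice)
    obtain q Y \<Lambda> where "hump_family \<psi> T \<rho> s\<^sub>0 1 0 q Y" "0 \<le> \<Lambda>"
      "\<forall>\<omega>\<in>set_pmf q. \<forall>s\<in>T. \<forall>t\<in>T. \<bar>Y \<omega> s - Y \<omega> t\<bar> \<le> \<Lambda> * \<rho> s t"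
      using ex[of 1 0 0] by auto
    then show "\<exists>x. P 0 x" unfolding P_def by (intro exI[of _ "(q, Y, 1, 0, \<Lambda>)"]) auto
  next
    fix x n assume Px: "P n x"
    obtain q Y r \<kappa> \<Lambda> where x: "x = (q, Y, r, \<kappa>, \<Lambda>)" by (metis prod_cases5)
    have P: "hump_family \<psi> T \<rho> s\<^sub>0 r \<kappa> q Y" "0 < r" "0 \<le> \<Lambda>" using Px by (auto simp: P_def x)
    have fin: "finite (set_pmf q)" using P(1) by (simp add: hump_family_def)
    \<comment> \<open>Candidates for the next radius: the old radius, the dyadic bound, and half the
      distance to \<open>s\<^sub>0\<close> of every other point in the current pairs. They are
      finitely many and positive, and so is their minimum.\<close>
    define S where "S = insert r (insert ((1 / 2) ^ Suc n)
        ((\<lambda>x. dist x s\<^sub>0 / 2) ` ((fst ` set_pmf q \<union> snd ` set_pmf q) - {s\<^sub>0})))"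
    define r' where "r' = Min S"
    have S: "finite S" "S \<noteq> {}" using fin by (auto simp: S_def)
    have "\<forall>y\<in>S. 0 < y" using P(2) by (auto simp: S_def)
    then have r': "0 < r'" unfolding r'_def using S by simp
    have le: "r' \<le> y" if "y \<in> S" for y unfolding r'_def using S(1) that by simp
    define \<kappa>' where "\<kappa>' = 2 ^ Suc (Suc n) * (real (Suc n) + \<Lambda>)"
    have "0 \<le> \<kappa>'" using P(3) by (simp add: \<kappa>'_def)
    from ex[OF r' this, of \<Lambda>] obtain q' Y' \<Lambda>' where *: "hump_family \<psi> T \<rho> s\<^sub>0 r' \<kappa>' q' Y'" "\<Lambda> \<le> \<Lambda>'"
      "\<forall>\<omega>\<in>set_pmf q'. \<forall>s\<in>T. \<forall>t\<in>T. \<bar>Y' \<omega> s - Y' \<omega> t\<bar> \<le> \<Lambda>' * \<rho> s t" by auto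
    have "2 * r' \<le> dist z s\<^sub>0" if "\<omega> \<in> set_pmf q" "z = fst \<omega> \<or> z = snd \<omega>" "z \<noteq> s\<^sub>0" for \<omega> z
    proof -
      have "z \<in> (fst ` set_pmf q \<union> snd ` set_pmf q) - {s\<^sub>0}" using that by auto
      then have "dist z s\<^sub>0 / 2 \<in> S" unfolding S_def by blast
      from le[OF this] show ?thesis by simp
    qed
    moreover have "r' \<le> r" "r' \<le> (1 / 2) ^ Suc n" by (rule le, simp add: S_def)+
    ultimately show "\<exists>y. P (Suc n) y \<and> Q n x y"
      using * P(3) r' unfolding P_def Q_def x
      by (intro exI[of _ "(q', Y', r', \<kappa>', \<Lambda>')"]) (auto simp: \<kappa>'_def)
  qed
  then obtain f where f: "\<And>n. P n (f n)" "\<And>n. Q n (f n) (f (Suc n))" by blast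
  define q where "q n = fst (f n)" for n
  define Y where "Y n = fst (snd (f n))" for n
  define r where "r n = fst (snd (snd (f n)))" for n
  define \<kappa> where "\<kappa> n = fst (snd (snd (snd (f n))))" for n
  define \<Lambda> where "\<Lambda> n = snd (snd (snd (snd (f n))))" for n
  have f_eq: "f n = (q n, Y n, r n, \<kappa> n, \<Lambda> n)" for n
    by (simp add: q_def Y_def r_def \<kappa>_def \<Lambda>_def)
  have P: "hump_family \<psi> T \<rho> s\<^sub>0 (r n) (\<kappa> n) (q n) (Y n)" "r n \<le> (1 / 2) ^ n" "0 \<le> \<Lambda> n"
    "\<And>\<omega> s t. \<omega> \<in> set_pmf (q n) \<Longrightarrow> s \<in> T \<Longrightarrow> t \<in> T \<Longrightarrow> \<bar>Y n \<omega> s - Y n \<omega> t\<bar> \<le> \<Lambda> n * \<rho> s t" for n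
    using f(1)[of n] unfolding f_eq P_def by auto
  have Q: "r (Suc n) \<le> r n" "\<Lambda> n \<le> \<Lambda> (Suc n)"
    "2 ^ Suc (Suc n) * (real (Suc n) + \<Lambda> n) \<le> \<kappa> (Suc n)"
    "\<And>\<omega> x. \<omega> \<in> set_pmf (q n) \<Longrightarrow> x = fst \<omega> \<or> x = snd \<omega> \<Longrightarrow> x \<noteq> s\<^sub>0 \<Longrightarrow> 2 * r (Suc n) \<le> dist x s\<^sub>0" for n
    using f(2)[of n] unfolding f_eq Q_def by auto
  interpret gliding_humps \<psi> T \<rho> s\<^sub>0 q Y r \<kappa> \<Lambda>
    by unfold_locales (fact T \<open>young_function \<psi>\<close> s0 P Q)+
  show False by (rule not_dominated[OF dom])
qed

lemma dominated_imp_feasible: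
  fixes T :: "'a::metric_space set"
  assumes T: "compact T" "T \<noteq> {}" and Y: "young_function \<phi>" "young_function \<psi>" "\<phi> 1 = 1" "\<psi> 1 = 1"
    and R: "1 \<le> R" and sm: "summable (\<lambda>k. \<psi> (R ^ k) / \<phi> (R ^ (k + n)))"
    and rho: "Metric_space T \<rho>" and dom: "increments_as_dominated \<psi> T \<rho>"
  shows "feasible_on \<phi> T \<rho> T"
proof (rule ccontr)
  interpret Metric_space T \<rho> by (rule rho)
  assume notfeas: "\<not> feasible_on \<phi> T \<rho> T"
  \<comment> \<open>For \<open>R = 1\<close> the normalisation makes every term of the series equal
    to 1.\<close>
  have "R \<noteq> 1"
  proof
    assume "R = 1"
    then have "summable (\<lambda>k::nat. 1::real)" using sm Y by simp
    then show False by (simp add: summable_const_iff)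
  qed
  with R have R: "1 < R" by simp
  obtain s\<^sub>0 where s0: "s\<^sub>0 \<in> T" and loc: "\<And>r. 0 < r \<Longrightarrow> \<not> feasible_on \<phi> T \<rho> (T \<inter> ball s\<^sub>0 r)"
    using feasible_on_local[of T \<phi> \<rho>, OF T Y(1) nonneg] notfeas by metis
  \<comment> \<open>The distance to \<open>s\<^sub>0\<close> is Lipschitz, so domination compares it
    with \<open>\<rho>\<close>; this yields the constant \<open>L\<close> that the humps and the
    singleton case require.\<close>
  have "\<bar>dist u s\<^sub>0 - dist v s\<^sub>0\<bar> \<le> 1 * dist u v" for u v
    using dist_triangle[of u s\<^sub>0 v] dist_triangle[of v s\<^sub>0 u] by (simp add: dist_commute)
  from lipschitz_imp_dominated[OF T(1) dom Y(2,4) rho _ this]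
  obtain L where L: "0 \<le> L" "\<And>s t. s \<in> T \<Longrightarrow> t \<in> T \<Longrightarrow> \<bar>dist s s\<^sub>0 - dist t s\<^sub>0\<bar> \<le> L * \<rho> s t" by auto
  have "dist s\<^sub>0 t \<le> L * \<rho> s\<^sub>0 t" if "t \<in> T" for t
    using L(2)[OF s0 that] by (simp add: dist_commute)
  then have single: "feasible_on \<phi> T \<rho> {s\<^sub>0}"
    by (rule feasible_on_singleton[OF Y(1,3) s0 L(1)])
  obtain b where b: "0 < b" "\<forall>(q :: ('a \<times> 'a) pmf) G. (\<forall>\<omega>\<in>set_pmf q. 0 < G \<omega>) \<longrightarrow>
    (\<forall>x\<ge>0. measure_pmf.prob q {\<omega>. G \<omega> \<le> x} \<le> x) \<longrightarrow>
    (\<integral>\<^sup>+\<omega>. ennreal (\<psi> (b * enn2real (young_rec \<phi> (G \<omega>)))) \<partial>q) \<le> ennreal (1 / 2)"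
    using young_moment_scale[OF Y R sm] by (elim exE conjE) (rule that)
  have "\<exists>q Y. hump_family \<psi> T \<rho> s\<^sub>0 r \<kappa> q Y" if "0 < r" "0 \<le> \<kappa>" for r \<kappa>
  proof -
    have "\<not> feasible_on \<phi> T \<rho> (T \<inter> ball s\<^sub>0 r - {s\<^sub>0})"
    proof
      assume "feasible_on \<phi> T \<rho> (T \<inter> ball s\<^sub>0 r - {s\<^sub>0})"
      from feasible_on_Un[OF Y(1) nonneg this single] have "feasible_on \<phi> T \<rho> (T \<inter> ball s\<^sub>0 r)"
        by (rule feasible_on_subset) auto
      then show False using loc[OF that(1)] by simp
    qed
    from exists_hump_family[OF Y(1,2,3) b(1) b(2)[rule_format] nonneg s0 that(2) L not_feasible_onD[OF this]]
    show ?thesis by blast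
  qed
  from hump_families_imp_not_dominated[OF T(1) Y(2,4) rho s0 this] dom show False by blast
qed

theorem theorem2:
  fixes T :: "'a::metric_space set"
    and \<phi> \<psi> :: "real \<Rightarrow> real"
    and \<rho> :: "'a \<Rightarrow> 'a \<Rightarrow> real"
  assumes "compact T" and "T \<noteq> {}"
    and "young_function \<phi>" and "young_function \<psi>"
    and "\<phi> 1 = 1" and "\<psi> 1 = 1"
    and "\<exists>(R::real) (n\<^sub>0::nat). R \<ge> 1 \<and> n\<^sub>0 \<ge> 1 \<and> summable (\<lambda>k. \<psi> (R ^ k) / \<phi> (R ^ (k + n\<^sub>0)))"
    and "Metric_space T \<rho>"
    and "increments_as_dominated \<psi> T \<rho>"
  shows "\<exists>(K::real) m. prob_space m \<and> sets m = sets (restrict_space borel T) \<and>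
           (\<forall>s\<in>T. \<forall>t\<in>T. minorizing_metric T m \<phi> s t \<le> ennreal (K * \<rho> s t))"
proof -
  interpret Metric_space T \<rho> by fact
  obtain R n where R: "1 \<le> R" "summable (\<lambda>k. \<psi> (R ^ k) / \<phi> (R ^ (k + n)))"
    using assms(7) by blast
  have "feasible_on \<phi> T \<rho> T"
    by (rule dominated_imp_feasible[OF assms(1-6) R assms(8,9)])
  then obtain K where K: "\<And>F. finite F \<Longrightarrow> F \<subseteq> T \<times> T \<Longrightarrow>
      \<exists>\<nu>. prob_charge T \<nu> \<and> (\<forall>(s, t)\<in>F. ball_integral \<phi> \<nu> s (dist s t) \<le> ennreal (K * \<rho> s t))"
    unfolding feasible_on_def by (elim exE conjE) (rule that, auto)
  have "ennreal (K * \<rho> s t) = ennreal (K * \<rho> t s)" for s t by (simp add: commute)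
  from exists_measure_of_feasible[OF assms(1,3) this K] show ?thesis by blast
qed

end
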